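(* Let $K\subset\mathbb R^n$ be a nondegenerate $n$-simplex. A matrix field $\tau\in P_2^\ast(K;\mathbb S)$ is uniquely determined by the following degrees of freedom (i.e. they are unisolvent for $P_2^\ast(K;\mathbb S)$: they vanish simultaneously only for $\tau=0$, and their total number equals $\dim P_2^\ast(K;\mathbb S)$): (1) for each $\ell$-dimensional subsimplex $\triangle_\ell$ of $K$, $0\le\ell\le n-1$, with $\ell$ linearly independent tangential vectors $\mathbf t_1,\dots,\mathbf t_\ell$ and $n-\ell$ linearly independent normal vectors $\boldsymbol\nu_1,\dots,\boldsymbol\nu_{n-\ell}$, the mean moments of degree at most $n-\ell$ over $\triangle_\ell$ of $\mathbf t_l^T\tau\boldsymbol\nu_i$ and $\boldsymbol\nu_i^T\tau\boldsymbol\nu_j$, $l=1,\dots,\ell$, $i,j=1,\dots,n-\ell$; these are $\big(\binom{n+1-\ell}{2}+\ell(n-\ell)\big)\binom n\ell=\frac{(n-\ell)(n+\ell+1)}2\binom n\ell$ degrees of freedom for each $\triangle_\ell$; (2) the average of $\tau$ over $K$; $\frac{n(n+1)}2$ degrees of freedom; (3) the values of the moments $\int_K\tau:\theta\,dx$, $\theta\in M_2(K)$; $\frac{(2n-1)!}{n!(n-1)!}\frac{n(n+1)}2+\frac{n(n+1)}2-n\frac{(2n)!}{n!\,n!}$ degrees of freedom.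
   Context: $\mathbb S$ is the space of symmetric $n\times n$ real matrices; $P_m(K;\mathbb S)$ is the space of $\mathbb S$-valued polynomials of degree $\le m$ on $K$; $\operatorname{div}$ acts row-wise. $\Sigma_{3\to n+1,DF}(K;\mathbb S)$ is the space of divergence-free $\mathbb S$-valued polynomials on $K$ that are sums of homogeneous polynomials of degrees $3,\dots,n+1$ (it is $\{0\}$ if $n=1$), and $$P_2^\ast(K;\mathbb S):=P_2(K;\mathbb S)+\Sigma_{3\to n+1,DF}(K;\mathbb S),\qquad M_2(K):=\{\tau\in P_2^\ast(K;\mathbb S):\operatorname{div}\tau=0,\ \tau\nu|_{\partial K}=0\},$$ where $\nu$ is the normal vector of $\partial K$. The moments of degree at most $m$ of a function $g$ over $\triangle_\ell$ are the integrals $\int_{\triangle_\ell}g\,q$ for $q$ in a basis of $P_m(\triangle_\ell;\mathbb R)$; for a vertex ($\ell=0$) the moment is the point value of $g$. *)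

theory Defs
  imports "HOL-Analysis.Analysis" "HOL-Library.Function_Algebras"
begin

text \<open>The pointwise real vector space structure on functions, so that \<open>span\<close>, \<open>independent\<close>
  and \<open>dim\<close> apply to spaces of polynomials.\<close>

instantiation "fun" :: (type, real_vector) real_vector
begin

definition scaleR_fun :: "real \<Rightarrow> ('a \<Rightarrow> 'b) \<Rightarrow> 'a \<Rightarrow> 'b"
  where "scaleR_fun c f = (\<lambda>x. c *\<^sub>R f x)"

instance
  by standard (auto simp: scaleR_fun_def plus_fun_def scaleR_add_right scaleR_add_left)

end

definition basis_of :: "'a::real_vector set \<Rightarrow> 'a set \<Rightarrow> bool"
  where "basis_of B V \<longleftrightarrow> independent B \<and> span B = V"

subsection \<open>Polynomials\<close>

definition monomial_fun :: "('n::finite \<Rightarrow> nat) \<Rightarrow> real^'n \<Rightarrow> real"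
  where "monomial_fun \<alpha> x = (\<Prod>i\<in>UNIV. x $ i ^ \<alpha> i)"

text \<open>Sums of homogeneous polynomials whose degrees lie in \<open>D\<close>. A polynomial on the simplex
  \<open>K\<close>, which has nonempty interior, is identified with the polynomial function on the whole
  space that extends it.\<close>

definition polys :: "nat set \<Rightarrow> (real^'n \<Rightarrow> real) set"
  where "polys D = span {monomial_fun \<alpha> | \<alpha>. (\<Sum>i\<in>UNIV. \<alpha> i) \<in> D}"

text \<open>On a set \<open>F\<close> of lower dimension different polynomials may agree, so the elements of
  \<open>P\<^sub>m(F)\<close> are genuine restrictions to \<open>F\<close>, extended by zero.\<close>

definition polys_on :: "nat \<Rightarrow> (real^'n) set \<Rightarrow> (real^'n \<Rightarrow> real) set"
  where "polys_on m F = (\<lambda>p x. if x \<in> F then p x else 0) ` polys {..m}"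

definition sym_polys :: "nat set \<Rightarrow> (real^'n \<Rightarrow> real^'n^'n) set"
  where "sym_polys D =
    {\<tau>. (\<forall>x. transpose (\<tau> x) = \<tau> x) \<and> (\<forall>i j. (\<lambda>x. \<tau> x $ i $ j) \<in> polys D)}"

definition row_div :: "(real^'n \<Rightarrow> real^'n^'n) \<Rightarrow> real^'n \<Rightarrow> real^'n"
  where "row_div \<tau> x =
    (\<chi> i. \<Sum>j\<in>UNIV. frechet_derivative (\<lambda>y. \<tau> y $ i $ j) (at x) (axis j 1))"

definition Sigma_DF :: "(real^'n) set \<Rightarrow> (real^'n \<Rightarrow> real^'n^'n) set"
  where "Sigma_DF K = {\<tau> \<in> sym_polys {3..CARD('n) + 1}. \<forall>x\<in>K. row_div \<tau> x = 0}"

definition P2star :: "(real^'n) set \<Rightarrow> (real^'n \<Rightarrow> real^'n^'n) set"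
  where "P2star K = {\<sigma> + \<rho> | \<sigma> \<rho>. \<sigma> \<in> sym_polys {..2} \<and> \<rho> \<in> Sigma_DF K}"

subsection \<open>Subsimplices and their tangential and normal vectors\<close>

definition subsimplices :: "nat \<Rightarrow> (real^'n) set \<Rightarrow> (real^'n) set set"
  where "subsimplices l K = {F. F face_of K \<and> int l simplex F}"

definition tangent_vectors :: "(real^'n) set \<Rightarrow> (real^'n) set"
  where "tangent_vectors F = span {x - y | x y. x \<in> F \<and> y \<in> F}"

definition normal_vectors :: "(real^'n) set \<Rightarrow> (real^'n) set"
  where "normal_vectors F = (tangent_vectors F)\<^sup>\<bottom>"

text \<open>The boundary condition is imposed facet by facet: at a point shared by several facets,
  it is required for the normals of each of them.\<close>

definition M2 :: "(real^'n) set \<Rightarrow> (real^'n \<Rightarrow> real^'n^'n) set"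
  where "M2 K = {\<tau> \<in> P2star K. (\<forall>x\<in>K. row_div \<tau> x = 0) \<and>
    (\<forall>F. F facet_of K \<longrightarrow> (\<forall>x\<in>F. \<forall>\<nu>\<in>normal_vectors F. \<tau> x *v \<nu> = 0))}"

subsection \<open>Moments\<close>

text \<open>The Lebesgue measure, of dimension \<open>dim (tangent_vectors F)\<close>, of the affine hull of \<open>F\<close>:
  the image of the Lebesgue measure on coordinates under an isometric parametrization. It does
  not depend on the choices of the orthonormal basis \<open>B\<close> and of the origin \<open>a\<close>. If \<open>F\<close> is a
  single point, it is the unit point mass there.\<close>

definition flat_measure :: "(real^'n) set \<Rightarrow> (real^'n) measure"
  where "flat_measure F =
    (let B = (SOME B. pairwise orthogonal B \<and> (\<forall>b\<in>B. norm b = 1) \<and> span B = tangent_vectors F);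
         a = (SOME a. a \<in> F)
     in distr (\<Pi>\<^sub>M b\<in>B. lborel) borel (\<lambda>y. a + (\<Sum>b\<in>B. y b *\<^sub>R b)))"

definition mean_moment :: "(real^'n) set \<Rightarrow> (real^'n \<Rightarrow> real) \<Rightarrow> (real^'n \<Rightarrow> real) \<Rightarrow> real"
  where "mean_moment F g q = (LINT x:F|flat_measure F. g x * q x) / measure (flat_measure F) F"

subsection \<open>Degrees of freedom\<close>

text \<open>Degrees of freedom are functionals on the shape function space \<open>V\<close>, represented by
  functions restricted to \<open>V\<close>. Hence functionals that agree on \<open>V\<close> are counted once, such as
  those obtained by exchanging \<open>i\<close> and \<open>j\<close> for symmetric \<open>\<tau>\<close>.\<close>

definition unisolvent :: "'v::real_vector set \<Rightarrow> ('v \<Rightarrow> real) set \<Rightarrow> bool"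
  where "unisolvent V \<Phi> \<longleftrightarrow>
    finite \<Phi> \<and> card \<Phi> = dim V \<and> (\<forall>v\<in>V. (\<forall>\<phi>\<in>\<Phi>. \<phi> v = 0) \<longrightarrow> v = 0)"

definition face_dofs :: "(real^'n) set \<Rightarrow> (real^'n) set \<Rightarrow> (real^'n) set \<Rightarrow> (real^'n) set
    \<Rightarrow> (real^'n \<Rightarrow> real) set \<Rightarrow> ((real^'n \<Rightarrow> real^'n^'n) \<Rightarrow> real) set"
  where "face_dofs K F T N Q =
    {(\<lambda>\<tau>\<in>P2star K. mean_moment F (\<lambda>x. t \<bullet> (\<tau> x *v \<nu>)) q) | t \<nu> q. t \<in> T \<and> \<nu> \<in> N \<and> q \<in> Q} \<union>
    {(\<lambda>\<tau>\<in>P2star K. mean_moment F (\<lambda>x. \<mu> \<bullet> (\<tau> x *v \<nu>)) q) | \<mu> \<nu> q. \<mu> \<in> N \<and> \<nu> \<in> N \<and> q \<in> Q}"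

definition average_dofs :: "(real^'n) set \<Rightarrow> ((real^'n \<Rightarrow> real^'n^'n) \<Rightarrow> real) set"
  where "average_dofs K =
    {(\<lambda>\<tau>\<in>P2star K. (LINT x:K|lborel. \<tau> x $ i $ j) / measure lborel K) | i j. True}"

text \<open>The inner product of the type \<open>real^'n^'n\<close> is the Frobenius product \<open>\<tau> : \<theta>\<close>.\<close>

definition interior_dofs :: "(real^'n) set \<Rightarrow> (real^'n \<Rightarrow> real^'n^'n) set
    \<Rightarrow> ((real^'n \<Rightarrow> real^'n^'n) \<Rightarrow> real) set"
  where "interior_dofs K \<Theta> = {(\<lambda>\<tau>\<in>P2star K. LINT x:K|lborel. \<tau> x \<bullet> \<theta> x) | \<theta>. \<theta> \<in> \<Theta>}"

end

theory Submission
  imports Defs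
begin

text \<open>
  The degrees of freedom are shown to be injective on \<open>P2star K\<close>, and the number of functionals is
  compared with the dimension.

  Injectivity. Let all degrees of freedom of \<open>\<tau>\<close> vanish. By induction on the dimension \<open>l\<close> of the face,
  \<open>\<tau> \<nu>\<close> vanishes on each face for all its normal vectors \<open>\<nu>\<close>: it vanishes on the boundary of the face,
  because \<open>\<nu>\<close> is also normal to the subfaces, and has degree at most \<open>n + 1\<close>, so its components are the
  product of the \<open>l + 1\<close> barycentric coordinates of the face and cofactors of degree at most \<open>n - l\<close>
  (\<open>polys_divisible_on_face\<close>); the moments against these cofactors vanish
  (\<open>zero_on_face_if_moments_vanish\<close>, \<open>normal_traces_vanish\<close>). Hence \<open>\<tau> \<nu> = 0\<close> on every facet. The
  divergence of \<open>\<tau>\<close> is affine, as the components of higher degree in \<open>P2star K\<close> are divergence-free.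
  Testing it against itself and integrating by parts pairs \<open>\<tau>\<close> with a constant matrix, and the average
  of \<open>\<tau>\<close> is zero, so the divergence vanishes (\<open>bubble_with_zero_average_div_free\<close>). Thus \<open>\<tau>\<close> lies in
  \<open>M2 K\<close>, and the interior moments give \<open>\<tau> = 0\<close>.

  Bubble fields. For the edges \<open>t\<close> of the simplex, the matrices \<open>t t\<^sup>T\<close> form a basis of the symmetric
  matrices, and in this basis the coefficient of a field with vanishing normal components is divisible by
  the two barycentric coordinates of the ends of the edge (\<open>bubbles_representation\<close>). So integration by
  parts only concerns functions \<open>lam u * lam w * p\<close> and derivatives along the edge from \<open>w\<close> to \<open>u\<close>; it is
  derived from the translation invariance of the Lebesgue measure
  (\<open>integral_dir_deriv_edge_bubble\<close>).

  Counting. Exact dimensions are not computed one by one. The dimension of \<open>P2star K\<close> is bounded from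
  below, because its elements are the fields of degree at most \<open>n + 1\<close> for which the coefficients of
  degree \<open>2, \<dots>, n\<close> of the divergence vanish (\<open>dim_P2star_ge\<close>). The dimension of \<open>M2 K\<close> is bounded
  from above by rank and nullity of the divergence on bubble fields: a vector polynomial that is
  orthogonal to all divergences of bubble fields has zero strain along all edges, so it is an
  infinitesimal rigid motion (\<open>orthogonal_to_div_bubbles_rigid\<close>, \<open>dim_M2_le\<close>). With the evident upper
  bounds for the numbers of face moments and averages, the total number of degrees of freedom is at
  most the lower bound for the dimension, by two instances of Vandermonde's identity
  (\<open>sum_face_weights\<close>). Injectivity gives the opposite inequality, so all bounds are attained; in
  particular different choices of indices give different functionals.
\<close>

section \<open>Dimension counting with linear maps on subspaces\<close>

text \<open>Linearity is required on a subspace only: \<open>row_div\<close> is additive on differentiable fields but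
  not on all functions, and degrees of freedom are restricted to the shape function space.\<close>

definition linear_on :: "'a::real_vector set \<Rightarrow> ('a \<Rightarrow> 'b::real_vector) \<Rightarrow> bool"
  where "linear_on V f \<longleftrightarrow> (\<forall>x\<in>V. \<forall>y\<in>V. f (x + y) = f x + f y) \<and> (\<forall>c. \<forall>x\<in>V. f (c *\<^sub>R x) = c *\<^sub>R f x)"

lemma linear_onI:
  assumes "\<And>x y. x \<in> V \<Longrightarrow> y \<in> V \<Longrightarrow> f (x + y) = f x + f y"
    and "\<And>c x. x \<in> V \<Longrightarrow> f (c *\<^sub>R x) = c *\<^sub>R f x"
  shows "linear_on V f"
  using assms by (auto simp: linear_on_def)

lemma linear_on_add: "linear_on V f \<Longrightarrow> x \<in> V \<Longrightarrow> y \<in> V \<Longrightarrow> f (x + y) = f x + f y"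
  by (auto simp: linear_on_def)

lemma linear_on_scale: "linear_on V f \<Longrightarrow> x \<in> V \<Longrightarrow> f (c *\<^sub>R x) = c *\<^sub>R f x"
  by (auto simp: linear_on_def)

lemma linear_on_zero: "linear_on V f \<Longrightarrow> subspace V \<Longrightarrow> f 0 = 0"
  using linear_on_scale[of V f 0 0] by (auto simp: subspace_def)

lemma linear_on_diff:
  assumes "linear_on V f" "subspace V" "x \<in> V" "y \<in> V"
  shows "f (x - y) = f x - f y"
proof -
  have "f (x + (-1) *\<^sub>R y) = f x + (-1) *\<^sub>R f y"
    using assms by (metis linear_on_add linear_on_scale subspace_scale)
  then show ?thesis by simp
qed

lemma linear_on_subset: "linear_on V f \<Longrightarrow> W \<subseteq> V \<Longrightarrow> linear_on W f"
  unfolding linear_on_def by blast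

lemma linear_on_sum:
  assumes "linear_on V f" "subspace V" "\<And>i. i \<in> I \<Longrightarrow> g i \<in> V"
  shows "f (\<Sum>i\<in>I. g i) = (\<Sum>i\<in>I. f (g i))"
  using assms(3)
proof (induction I rule: infinite_finite_induct)
  case (insert i I)
  then show ?case
    using assms(1,2) by (simp add: linear_on_add subspace_sum)
qed (use linear_on_zero[OF assms(1,2)] in auto)

lemma subspace_kernel_on:
  assumes "linear_on V f" "subspace V"
  shows "subspace {v \<in> V. f v = 0}"
  using assms linear_on_zero[OF assms]
  by (auto simp: subspace_def linear_on_def)

text \<open>The spaces below lie in an infinite-dimensional function space, where \<open>dim\<close> is monotone only
  for subsets of finitely generated spaces.\<close>

definition fin_dim :: "'a::real_vector set \<Rightarrow> bool"
  where "fin_dim V \<longleftrightarrow> (\<exists>B. finite B \<and> V \<subseteq> span B)"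

lemma fin_dimI: "finite B \<Longrightarrow> V \<subseteq> span B \<Longrightarrow> fin_dim V"
  by (auto simp: fin_dim_def)

lemma fin_dim_subset: "fin_dim V \<Longrightarrow> W \<subseteq> V \<Longrightarrow> fin_dim W"
  by (auto simp: fin_dim_def)

lemma fin_dim_independent_finite: "fin_dim V \<Longrightarrow> B \<subseteq> V \<Longrightarrow> independent B \<Longrightarrow> finite B"
  unfolding fin_dim_def by (meson independent_span_bound subset_trans)

lemma fin_dim_basis:
  assumes "fin_dim V"
  shows "\<exists>B. finite B \<and> B \<subseteq> V \<and> independent B \<and> V \<subseteq> span B \<and> card B = dim V"
proof -
  obtain B where B: "B \<subseteq> V" "independent B" "V \<subseteq> span B" "card B = dim V"
    by (rule basis_exists)
  then have "finite B" using fin_dim_independent_finite[OF assms] by simp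
  with B show ?thesis by (intro exI[of _ B]) simp
qed

lemma dim_mono_fin:
  assumes "fin_dim W" "V \<subseteq> W"
  shows "dim V \<le> dim W"
proof -
  obtain B where "finite B" "W \<subseteq> span B" "card B = dim W"
    using fin_dim_basis[OF assms(1)] by blast
  then show ?thesis
    using dim_le_card[of V B] assms(2) by auto
qed

lemma independent_card_le_dim_fin:
  assumes "fin_dim V" "B \<subseteq> V" "independent B"
  shows "card B \<le> dim V"
proof -
  obtain C where "finite C" "V \<subseteq> span C" "card C = dim V"
    using fin_dim_basis[OF assms(1)] by blast
  then show ?thesis
    using independent_span_bound[of C B] assms by (metis order_trans)
qed

lemma fin_dim_image:
  assumes "fin_dim V" "subspace V" "linear_on V f"
  shows "fin_dim (f ` V)"
proof -
  obtain B where B: "finite B" "B \<subseteq> V" "independent B" "V \<subseteq> span B"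
    using fin_dim_basis[OF assms(1)] by blast
  have "f ` V \<subseteq> span (f ` B)"
  proof
    fix y assume "y \<in> f ` V"
    then obtain x where x: "x \<in> V" "y = f x" by auto
    then obtain u where "x = (\<Sum>b\<in>B. u b *\<^sub>R b)"
      using B by (auto simp: span_finite)
    then have "y = (\<Sum>b\<in>B. u b *\<^sub>R f b)"
      using x B(2) assms
      by (simp add: linear_on_sum linear_on_scale subspace_scale subset_iff)
    then show "y \<in> span (f ` B)"
      by (simp add: span_base span_scale span_sum)
  qed
  then show ?thesis using B(1) by (intro fin_dimI[of "f ` B"]) auto
qed

text \<open>A basis of the kernel is completed to a basis of \<open>V\<close>; the images of the added vectors
  span the image.\<close>

lemma dim_kernel_add_dim_image_le:
  assumes "fin_dim V" "subspace V" "linear_on V f"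
  shows "dim {v \<in> V. f v = 0} + dim (f ` V) \<le> dim V"
proof -
  let ?K = "{v \<in> V. f v = 0}"
  have finK: "fin_dim ?K" using assms(1) by (rule fin_dim_subset) auto
  obtain A where A: "finite A" "A \<subseteq> ?K" "independent A" "card A = dim ?K"
    using fin_dim_basis[OF finK] by blast
  obtain B where B: "A \<subseteq> B" "B \<subseteq> V" "independent B" "V \<subseteq> span B"
    using maximal_independent_subset_extend[of A V] A by auto
  have finB: "finite B" using fin_dim_independent_finite assms(1) B by blast
  have "f ` V \<subseteq> span (f ` (B - A))"
  proof
    fix y assume "y \<in> f ` V"
    then obtain x where x: "x \<in> V" "y = f x" by auto
    then obtain u where "x = (\<Sum>b\<in>B. u b *\<^sub>R b)"
      using B finB by (auto simp: span_finite)
    then have "y = (\<Sum>b\<in>B. u b *\<^sub>R f b)"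
      using x B(2) assms
      by (simp add: linear_on_sum linear_on_scale subspace_scale subset_iff)
    also have "\<dots> = (\<Sum>b\<in>B - A. u b *\<^sub>R f b)"
      using A(2) finB by (intro sum.mono_neutral_right) auto
    also have "\<dots> \<in> span (f ` (B - A))"
      by (intro span_sum span_scale span_base) auto
    finally show "y \<in> span (f ` (B - A))" .
  qed
  then have "dim (f ` V) \<le> card (f ` (B - A))"
    using finB by (intro dim_le_card) auto
  also have "\<dots> \<le> card (B - A)"
    using finB by (intro card_image_le) auto
  also have "\<dots> = card B - card A"
    using B(1) A(1) by (simp add: card_Diff_subset)
  finally have "dim (f ` V) \<le> card B - card A" .
  moreover have "card A \<le> card B" using B(1) finB by (simp add: card_mono)
  moreover have "card B = dim V" using B by (intro basis_card_eq_dim) auto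
  ultimately show ?thesis using A(4) by linarith
qed

lemma dim_le_dim_kernel_functional:
  fixes \<phi> :: "'a::real_vector \<Rightarrow> real"
  assumes "fin_dim V" "subspace V" "linear_on V \<phi>"
  shows "dim V \<le> Suc (dim {v \<in> V. \<phi> v = 0})"
proof (cases "\<forall>v\<in>V. \<phi> v = 0")
  case True
  then have "{v \<in> V. \<phi> v = 0} = V" by auto
  then show ?thesis by simp
next
  case False
  then obtain b where b: "b \<in> V" "\<phi> b \<noteq> 0" by auto
  let ?K = "{v \<in> V. \<phi> v = 0}"
  have finK: "fin_dim ?K" using assms(1) by (rule fin_dim_subset) auto
  obtain A where A: "finite A" "?K \<subseteq> span A" "card A = dim ?K"
    using fin_dim_basis[OF finK] by blast
  have "V \<subseteq> span (insert b A)"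
  proof
    fix x assume x: "x \<in> V"
    define c where "c = \<phi> x / \<phi> b"
    have "\<phi> (x - c *\<^sub>R b) = 0"
      using x b assms by (simp add: linear_on_diff linear_on_scale subspace_scale c_def)
    moreover have "x - c *\<^sub>R b \<in> V"
      using x b(1) assms(2) by (simp add: subspace_diff subspace_scale)
    ultimately have "x - c *\<^sub>R b \<in> span A"
      using A(2) by blast
    then show "x \<in> span (insert b A)"
      by (auto simp: span_insert)
  qed
  then have "dim V \<le> card (insert b A)"
    using A(1) by (intro dim_le_card) auto
  also have "\<dots> \<le> Suc (card A)"
    using card_insert_le_m1 A(1) by (simp add: card_insert_if)
  finally show ?thesis using A(3) by simp
qed

text \<open>The estimate is used in two ways: it bounds the dimension of a solution space from below and,
  if the conditions have only the trivial solution, the dimension of \<open>V\<close> from above.\<close>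

lemma dim_le_dim_kernel_functionals:
  fixes \<phi> :: "'i \<Rightarrow> 'a::real_vector \<Rightarrow> real"
  assumes "finite I" "fin_dim V" "subspace V" "\<And>i. i \<in> I \<Longrightarrow> linear_on V (\<phi> i)"
  shows "dim V \<le> dim {v \<in> V. \<forall>i\<in>I. \<phi> i v = 0} + card I"
  using assms(1,4)
proof (induction I rule: finite_induct)
  case (insert i I)
  let ?K = "{v \<in> V. \<forall>i\<in>I. \<phi> i v = 0}"
  have sub: "subspace ?K"
  proof -
    have "?K = V \<inter> (\<Inter>i\<in>I. {v \<in> V. \<phi> i v = 0})" by auto
    also have "subspace \<dots>"
      using insert.prems assms(3)
      by (intro subspace_inter subspace_Inter) (auto intro!: subspace_kernel_on)
    finally show ?thesis .
  qed
  have "dim ?K \<le> Suc (dim {v \<in> ?K. \<phi> i v = 0})"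
    using insert.prems sub assms(2)
    by (intro dim_le_dim_kernel_functional) (auto intro: fin_dim_subset linear_on_subset)
  moreover have "{v \<in> ?K. \<phi> i v = 0} = {v \<in> V. \<forall>i\<in>insert i I. \<phi> i v = 0}" by auto
  ultimately show ?case using insert by simp
qed auto

lemma dim_le_card_separating_functionals:
  fixes \<phi> :: "'i \<Rightarrow> 'a::real_vector \<Rightarrow> real"
  assumes "finite I" "fin_dim V" "subspace V" "\<And>i. i \<in> I \<Longrightarrow> linear_on V (\<phi> i)"
    and "\<And>v. v \<in> V \<Longrightarrow> (\<forall>i\<in>I. \<phi> i v = 0) \<Longrightarrow> v = 0"
  shows "dim V \<le> card I"
proof -
  have "{v \<in> V. \<forall>i\<in>I. \<phi> i v = 0} \<subseteq> {0}" using assms(5) by auto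
  then have "dim {v \<in> V. \<forall>i\<in>I. \<phi> i v = 0} = 0"
    using dim_le_card[of "{v \<in> V. \<forall>i\<in>I. \<phi> i v = 0}" "{}"] by simp
  then show ?thesis
    using dim_le_dim_kernel_functionals[of I V \<phi>] assms(1-4) by simp
qed

text \<open>Dual systems of vectors and functionals give the lower bounds for the spaces that have explicit
  monomial bases.\<close>

lemma card_le_dim_biorthogonal:
  fixes \<phi> :: "'i \<Rightarrow> 'a::real_vector \<Rightarrow> real"
  assumes "finite I" "fin_dim V" "\<And>i. i \<in> I \<Longrightarrow> v i \<in> V" "\<And>i. i \<in> I \<Longrightarrow> linear (\<phi> i)"
    and "\<And>i j. i \<in> I \<Longrightarrow> j \<in> I \<Longrightarrow> \<phi> i (v j) = (if i = j then 1 else 0)"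
  shows "card I \<le> dim V"
proof -
  have inj: "inj_on v I"
  proof (rule inj_onI)
    fix i j assume ij: "i \<in> I" "j \<in> I" "v i = v j"
    then have "\<phi> i (v j) = 1" using assms(5)[of i i] by simp
    then show "i = j" using assms(5)[of i j] ij by (auto split: if_splits)
  qed
  have "independent (v ` I)"
    unfolding dependent_finite[OF finite_imageI[OF assms(1)]]
  proof clarify
    fix u i assume s: "(\<Sum>b\<in>v ` I. u b *\<^sub>R b) = 0" and i: "i \<in> I" "u (v i) \<noteq> 0"
    have "0 = \<phi> i (\<Sum>j\<in>I. u (v j) *\<^sub>R v j)"
      using s inj assms(4)[OF i(1)] by (simp add: sum.reindex linear_0)
    also have "\<dots> = (\<Sum>j\<in>I. u (v j) * \<phi> i (v j))"
      using assms(4)[OF i(1)] by (simp add: linear_sum linear_scale)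
    also have "\<dots> = u (v i)"
    proof -
      have "(\<Sum>j\<in>I. u (v j) * \<phi> i (v j)) = (\<Sum>j\<in>I. if i = j then u (v j) else 0)"
        using assms(5) i(1) by (intro sum.cong) auto
      then show ?thesis using assms(1) i(1) by simp
    qed
    finally show False using i by simp
  qed
  then have "card (v ` I) \<le> dim V"
    using assms by (intro independent_card_le_dim_fin) auto
  then show ?thesis by (simp add: card_image[OF inj])
qed

text \<open>Independent entries of symmetric matrices, and symmetric pairs of normal vectors, are counted
  without an order on their indices.\<close>

lemma unordered_pairs_exist:
  assumes "finite N"
  shows "\<exists>P \<subseteq> N \<times> N. card P = (card N + 1) choose 2
    \<and> (\<forall>a\<in>N. \<forall>b\<in>N. (a, b) \<in> P \<or> (b, a) \<in> P)
    \<and> (\<forall>a b. (a, b) \<in> P \<and> (b, a) \<in> P \<longrightarrow> a = b)"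
  using assms
proof (induction N rule: finite_induct)
  case (insert x N)
  then obtain P where P: "P \<subseteq> N \<times> N" "card P = (card N + 1) choose 2"
    "\<forall>a\<in>N. \<forall>b\<in>N. (a, b) \<in> P \<or> (b, a) \<in> P" "\<forall>a b. (a, b) \<in> P \<and> (b, a) \<in> P \<longrightarrow> a = b"
    by (elim exE conjE)
  let ?P = "P \<union> Pair x ` insert x N"
  have "finite P" using P(1) insert.hyps(1) finite_subset by blast
  then have "card ?P = card P + card (Pair x ` insert x N)"
    using P(1) insert.hyps by (intro card_Un_disjoint) auto
  also have "card (Pair x ` insert x N) = card N + 1"
    using insert.hyps by (subst card_image) (auto simp: inj_on_def)
  finally have "card ?P = (card (insert x N) + 1) choose 2"
    using P(2) insert.hyps by (simp add: numeral_2_eq_2)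
  moreover have "?P \<subseteq> insert x N \<times> insert x N" using P(1) by auto
  moreover have "\<forall>a\<in>insert x N. \<forall>b\<in>insert x N. (a, b) \<in> ?P \<or> (b, a) \<in> ?P"
    using P(3) by auto
  moreover have "\<forall>a b. (a, b) \<in> ?P \<and> (b, a) \<in> ?P \<longrightarrow> a = b"
    using P(1,4) insert.hyps(2) by auto
  ultimately show ?case by (intro exI[of _ ?P] conjI)
qed auto

section \<open>Multi-indices and monomials\<close>

definition multi_indices :: "'a set \<Rightarrow> nat \<Rightarrow> ('a \<Rightarrow> nat) set"
  where "multi_indices S m = {\<alpha>. (\<forall>i. i \<notin> S \<longrightarrow> \<alpha> i = 0) \<and> sum \<alpha> S = m}"

lemma bij_multi_indices_lists:
  assumes "distinct xs" "set xs = S"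
  shows "bij_betw (\<lambda>\<alpha>. map \<alpha> xs) (multi_indices S m) {l. length l = card S \<and> sum_list l = m}"
proof (rule bij_betw_imageI)
  show "inj_on (\<lambda>\<alpha>. map \<alpha> xs) (multi_indices S m)"
  proof (rule inj_onI)
    fix \<alpha> \<beta> assume a: "\<alpha> \<in> multi_indices S m" "\<beta> \<in> multi_indices S m" "map \<alpha> xs = map \<beta> xs"
    show "\<alpha> = \<beta>"
    proof
      fix i show "\<alpha> i = \<beta> i"
        using a assms(2) by (cases "i \<in> S") (auto simp: multi_indices_def)
    qed
  qed
  have len: "length xs = card S" using assms distinct_card by metis
  have sum: "sum \<alpha> S = sum_list (map \<alpha> xs)" for \<alpha> :: "'a \<Rightarrow> nat"
    using assms by (simp add: sum_list_distinct_conv_sum_set)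
  show "(\<lambda>\<alpha>. map \<alpha> xs) ` multi_indices S m = {l. length l = card S \<and> sum_list l = m}"
  proof
    show "(\<lambda>\<alpha>. map \<alpha> xs) ` multi_indices S m \<subseteq> {l. length l = card S \<and> sum_list l = m}"
      using len sum by (auto simp: multi_indices_def)
  next
    show "{l. length l = card S \<and> sum_list l = m} \<subseteq> (\<lambda>\<alpha>. map \<alpha> xs) ` multi_indices S m"
    proof
      fix l :: "nat list" assume l: "l \<in> {l. length l = card S \<and> sum_list l = m}"
      define \<alpha> where "\<alpha> i = (case map_of (zip xs l) i of None \<Rightarrow> 0 | Some k \<Rightarrow> k)" for i
      have ll: "length xs = length l" using l len by simp
      have map: "map \<alpha> xs = l"
      proof (rule nth_equalityI)
        fix j assume "j < length (map \<alpha> xs)"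
        then show "map \<alpha> xs ! j = l ! j"
          using map_of_zip_nth[OF ll assms(1), of j] ll by (simp add: \<alpha>_def)
      qed (use ll in simp)
      have "\<alpha> i = 0" if "i \<notin> S" for i
      proof -
        have "map_of (zip xs l) i = None"
          using that assms(2) ll by (simp add: map_of_zip_is_None)
        then show ?thesis by (simp add: \<alpha>_def)
      qed
      then have "\<alpha> \<in> multi_indices S m"
        using l map sum[of \<alpha>] by (simp add: multi_indices_def)
      then show "l \<in> (\<lambda>\<alpha>. map \<alpha> xs) ` multi_indices S m"
        using map by (intro image_eqI[of _ _ \<alpha>]) auto
    qed
  qed
qed

lemma card_multi_indices:
  assumes "finite S"
  shows "card (multi_indices S m) = (m + card S - 1) choose m"
proof -
  obtain xs where "distinct xs" "set xs = S"
    using finite_distinct_list[OF assms] by auto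
  from bij_betw_same_card[OF bij_multi_indices_lists[OF this, of m]]
  show ?thesis using card_length_sum_list[of "card S" m] by simp
qed

lemma finite_multi_indices [simp]:
  assumes "finite S"
  shows "finite (multi_indices S m)"
proof -
  have "multi_indices S m \<subseteq> {\<alpha>. \<forall>i. (i \<in> S \<longrightarrow> \<alpha> i \<in> {..m}) \<and> (i \<notin> S \<longrightarrow> \<alpha> i = 0)}"
    using assms member_le_sum[of _ S] by (auto simp: multi_indices_def)
  then show ?thesis
    using finite_set_of_finite_funs[OF assms, of "{..m}" 0] finite_subset by blast
qed

definition exponents :: "nat set \<Rightarrow> ('n::finite \<Rightarrow> nat) set"
  where "exponents D = {\<alpha>. (\<Sum>i\<in>UNIV. \<alpha> i) \<in> D}"

lemma exponents_eq_Union: "exponents D = (\<Union>m\<in>D. multi_indices (UNIV :: 'n::finite set) m)"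
  by (auto simp: exponents_def multi_indices_def)

lemma finite_exponents [simp]: "finite D \<Longrightarrow> finite (exponents D :: ('n::finite \<Rightarrow> nat) set)"
  by (simp add: exponents_eq_Union)

lemma card_exponents:
  "card (exponents {..m} :: ('n::finite \<Rightarrow> nat) set) = (CARD('n) + m) choose CARD('n)"
proof -
  have "card (exponents {..m} :: ('n \<Rightarrow> nat) set) = (\<Sum>k\<le>m. card (multi_indices (UNIV :: 'n set) k))"
    unfolding exponents_eq_Union
    by (intro card_UN_disjoint ballI finite_multi_indices) (auto simp: multi_indices_def)
  also have "\<dots> = (\<Sum>k\<le>m. ((CARD('n) - 1) + k) choose k)"
    using zero_less_card_finite[where 'a='n]
    by (intro sum.cong refl) (simp add: card_multi_indices Nat.add_diff_assoc add.commute)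
  also have "\<dots> = (CARD('n) + m) choose m"
  proof -
    obtain r where "CARD('n) = Suc r"
      using zero_less_card_finite[where 'a='n] gr0_conv_Suc by blast
    then show ?thesis using sum_choose_lower[of r m] by simp
  qed
  also have "\<dots> = (CARD('n) + m) choose CARD('n)"
    using binomial_symmetric[of m "CARD('n) + m"] by simp
  finally show ?thesis .
qed

text \<open>Induction on the number of variables: freezing all variables but one leaves a polynomial
  in one variable with infinitely many roots. Only positive arguments are used, since barycentric
  coordinates are positive inside the simplex.\<close>

lemma monomials_independent_on_orthant:
  fixes c :: "('a \<Rightarrow> nat) \<Rightarrow> real"
  assumes "finite S" "finite A"
    and "\<And>\<alpha> \<beta>. \<alpha> \<in> A \<Longrightarrow> \<beta> \<in> A \<Longrightarrow> (\<forall>i\<in>S. \<alpha> i = \<beta> i) \<Longrightarrow> \<alpha> = \<beta>"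
    and "\<And>x :: 'a \<Rightarrow> real. (\<And>i. 0 < x i) \<Longrightarrow> (\<Sum>\<alpha>\<in>A. c \<alpha> * (\<Prod>i\<in>S. x i ^ \<alpha> i)) = 0"
    and "\<alpha> \<in> A"
  shows "c \<alpha> = 0"
  using assms(1-5)
proof (induction S arbitrary: A \<alpha> rule: finite_induct)
  case empty
  then have "A = {\<alpha>}" by auto
  then show ?case using empty.prems(3)[of "\<lambda>_. 1"] by simp
next
  case (insert k S)
  define m where "m = Max ((\<lambda>\<alpha>. \<alpha> k) ` A)"
  define B where "B d = {\<beta>\<in>A. \<beta> k = d}" for d
  have le_m: "\<beta> k \<le> m" if "\<beta> \<in> A" for \<beta>
    using that insert.prems(1) by (auto simp: m_def)
  have "(\<Sum>\<beta>\<in>B d. c \<beta> * (\<Prod>i\<in>S. x i ^ \<beta> i)) = 0"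
    if x: "\<And>i. 0 < x i" and d: "d \<le> m" for x :: "'a \<Rightarrow> real" and d
  proof -
    define e where "e d = (\<Sum>\<beta>\<in>B d. c \<beta> * (\<Prod>i\<in>S. x i ^ \<beta> i))" for d
    have "(\<Sum>d\<le>m. e d * t ^ d) = 0" if t: "0 < t" for t
    proof -
      have "(\<Sum>d\<le>m. e d * t ^ d) = (\<Sum>d\<le>m. \<Sum>\<beta>\<in>B d. c \<beta> * (\<Prod>i\<in>S. x i ^ \<beta> i) * t ^ \<beta> k)"
        by (simp add: e_def B_def sum_distrib_right)
      also have "\<dots> = (\<Sum>\<beta>\<in>A. c \<beta> * (\<Prod>i\<in>S. x i ^ \<beta> i) * t ^ \<beta> k)"
        unfolding B_def using insert.prems(1) le_m by (intro sum.group) auto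
      also have "\<dots> = (\<Sum>\<beta>\<in>A. c \<beta> * (\<Prod>i\<in>insert k S. (x(k := t)) i ^ \<beta> i))"
      proof (rule sum.cong)
        fix \<beta> 
        have "(\<Prod>i\<in>S. (x(k := t)) i ^ \<beta> i) = (\<Prod>i\<in>S. x i ^ \<beta> i)"
          using insert.hyps(2) by (intro prod.cong) auto
        then show "c \<beta> * (\<Prod>i\<in>S. x i ^ \<beta> i) * t ^ \<beta> k
            = c \<beta> * (\<Prod>i\<in>insert k S. (x(k := t)) i ^ \<beta> i)"
          using insert.hyps by simp
      qed simp
      also have "\<dots> = 0"
        using x t by (intro insert.prems(3)) auto
      finally show ?thesis .
    qed
    then have "{0<..} \<subseteq> {t. (\<Sum>d\<le>m. e d * t ^ d) = 0}" by auto
    then have "infinite {t. (\<Sum>d\<le>m. e d * t ^ d) = 0}"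
      using infinite_Ioi[of "0::real"] finite_subset by blast
    then have "e d = 0"
      using polyfun_finite_roots[of e m] d by auto
    then show ?thesis by (simp add: e_def)
  qed
  moreover have "finite (B (\<alpha> k))" "\<alpha> \<in> B (\<alpha> k)"
    using insert.prems by (auto simp: B_def)
  moreover have "\<beta> = \<gamma>" if "\<beta> \<in> B (\<alpha> k)" "\<gamma> \<in> B (\<alpha> k)" "\<forall>i\<in>S. \<beta> i = \<gamma> i" for \<beta> \<gamma>
    using that insert.prems(2)[of \<beta> \<gamma>] by (auto simp: B_def)
  ultimately show ?case
    using insert.IH[of "B (\<alpha> k)" \<alpha>] le_m[OF insert.prems(4)] by blast
qed

text \<open>The exponent of one variable is read off at the point where it is two and the others are one.\<close>

lemma inj_monomial_fun: "inj (monomial_fun :: ('n::finite \<Rightarrow> nat) \<Rightarrow> real^'n \<Rightarrow> real)"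
proof (rule injI)
  fix \<alpha> \<beta> :: "'n \<Rightarrow> nat" assume eq: "(monomial_fun \<alpha> :: real^'n \<Rightarrow> real) = monomial_fun \<beta>"
  show "\<alpha> = \<beta>"
  proof
    fix i
    have "monomial_fun \<gamma> (\<chi> j. if j = i then 2 else (1::real)) = 2 ^ \<gamma> i" for \<gamma> :: "'n \<Rightarrow> nat"
    proof -
      have "monomial_fun \<gamma> (\<chi> j. if j = i then 2 else (1::real))
          = (\<Prod>j\<in>UNIV. if j = i then 2 ^ \<gamma> i else 1)"
        unfolding monomial_fun_def by (intro prod.cong) auto
      then show ?thesis by simp
    qed
    then have "(2::real) ^ \<alpha> i = 2 ^ \<beta> i" using eq by metis
    then show "\<alpha> i = \<beta> i" by simp
  qed
qed

lemma sum_fun_apply: "(\<Sum>i\<in>I. f i) x = (\<Sum>i\<in>I. f i x)"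
  by (induction I rule: infinite_finite_induct) auto

lemma scaleR_fun_apply: "(c *\<^sub>R f) x = c *\<^sub>R f x"
  by (simp add: scaleR_fun_def)

lemma independent_monomials:
  "independent (range monomial_fun :: (real^'n::finite \<Rightarrow> real) set)"
  unfolding independent_explicit_module
proof (intro allI impI)
  fix t :: "(real^'n \<Rightarrow> real) set" and u v
  assume t: "finite t" "t \<subseteq> range monomial_fun" "(\<Sum>v\<in>t. u v *\<^sub>R v) = 0" "v \<in> t"
  define A where "A = monomial_fun -` t"
  have finA: "finite A"
    unfolding A_def using t(1) inj_monomial_fun by (rule finite_vimageI)
  have t_eq: "t = monomial_fun ` A"
    using t(2) by (auto simp: A_def)
  then obtain \<alpha> where \<alpha>: "\<alpha> \<in> A" "v = monomial_fun \<alpha>" using t(4) by auto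
  have "(\<Sum>\<beta>\<in>A. u (monomial_fun \<beta>) * (\<Prod>i\<in>UNIV. x i ^ \<beta> i)) = 0" for x :: "'n \<Rightarrow> real"
  proof -
    have "0 = (\<Sum>v\<in>t. u v *\<^sub>R v) (\<chi> i. x i)" using t(3) by simp
    also have "\<dots> = (\<Sum>v\<in>t. u v * v (\<chi> i. x i))"
      by (simp add: sum_fun_apply scaleR_fun_apply)
    also have "\<dots> = (\<Sum>\<beta>\<in>A. u (monomial_fun \<beta>) * monomial_fun \<beta> (\<chi> i. x i))"
      unfolding t_eq by (subst sum.reindex) (auto intro: inj_on_subset[OF inj_monomial_fun])
    finally show ?thesis by (simp add: monomial_fun_def)
  qed
  then have "u (monomial_fun \<alpha>) = 0"
    using monomials_independent_on_orthant[of UNIV A "\<lambda>\<beta>. u (monomial_fun \<beta>)" \<alpha>] finA \<alpha>(1)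
    by (auto simp: fun_eq_iff)
  then show "u v = 0" using \<alpha> by simp
qed

text \<open>The coefficient functionals are extended linearly, in an arbitrary way, from polynomials to all
  functions, so that they are linear without side conditions.\<close>

definition coef :: "('n::finite \<Rightarrow> nat) \<Rightarrow> (real^'n \<Rightarrow> real) \<Rightarrow> real"
  where "coef \<alpha> = (SOME f. linear f \<and> (\<forall>\<beta>. f (monomial_fun \<beta>) = (if \<alpha> = \<beta> then 1 else 0)))"

lemma coef_properties:
  fixes \<alpha> \<beta> :: "'n::finite \<Rightarrow> nat"
  shows "linear (coef \<alpha>)" "coef \<alpha> (monomial_fun \<beta>) = (if \<alpha> = \<beta> then 1 else 0)"
proof -
  obtain g :: "(real^'n \<Rightarrow> real) \<Rightarrow> real" where g: "linear g"
    "\<forall>x\<in>range monomial_fun. g x = (if x = monomial_fun \<alpha> then 1 else 0)"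
    using linear_independent_extend[OF independent_monomials, of "\<lambda>x. if x = monomial_fun \<alpha> then 1 else 0"]
    by blast
  have "g (monomial_fun \<beta>) = (if \<alpha> = \<beta> then 1 else 0)" for \<beta>
    using g(2) inj_eq[OF inj_monomial_fun, of \<beta> \<alpha>] by auto
  then have "\<exists>f. linear f \<and> (\<forall>\<beta>. f (monomial_fun \<beta> :: real^'n \<Rightarrow> real) = (if \<alpha> = \<beta> then 1 else 0 :: real))"
    using g(1) by blast
  from someI_ex[OF this, folded coef_def]
  show "linear (coef \<alpha>)" "coef \<alpha> (monomial_fun \<beta>) = (if \<alpha> = \<beta> then 1 else 0)" by auto
qed

lemma polys_eq_span: "polys D = span (monomial_fun ` exponents D)"
  unfolding polys_def exponents_def by (rule arg_cong[of _ _ span]) auto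

lemma subspace_polys [simp]: "subspace (polys D)"
  by (simp add: polys_eq_span)

lemma monomial_in_polys: "\<alpha> \<in> exponents D \<Longrightarrow> monomial_fun \<alpha> \<in> polys D"
  by (simp add: polys_eq_span span_base)

lemma polys_mono: "D \<subseteq> E \<Longrightarrow> polys D \<subseteq> polys E"
  unfolding polys_eq_span by (intro span_mono) (auto simp: exponents_def)

lemma polys_monomial_expansion:
  fixes p :: "real^'n \<Rightarrow> real"
  assumes "p \<in> polys D" "finite D"
  shows "p = (\<Sum>\<alpha>\<in>exponents D. coef \<alpha> p *\<^sub>R monomial_fun \<alpha>)"
proof (rule linear_eq_on[where f = "\<lambda>p. p" and B = "monomial_fun ` exponents D"])
  show "linear (\<lambda>p :: real^'n \<Rightarrow> real. p)" by (rule linear_id[unfolded id_def])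
  show "linear (\<lambda>p :: real^'n \<Rightarrow> real. \<Sum>\<alpha>\<in>exponents D. coef \<alpha> p *\<^sub>R monomial_fun \<alpha>)"
    by (intro linear_compose_sum ballI linearI)
      (simp_all add: linear_add[OF coef_properties(1)] linear_scale[OF coef_properties(1)] scaleR_add_left)
  show "p \<in> span (monomial_fun ` exponents D)" using assms by (simp add: polys_eq_span)
  fix b assume "b \<in> monomial_fun ` (exponents D :: ('n \<Rightarrow> nat) set)"
  then obtain \<beta> :: "'n \<Rightarrow> nat" where \<beta>: "\<beta> \<in> exponents D" "b = monomial_fun \<beta>" by auto
  have "(\<Sum>\<alpha>\<in>exponents D. coef \<alpha> b *\<^sub>R (monomial_fun \<alpha> :: real^'n \<Rightarrow> real))
      = (\<Sum>\<alpha>\<in>exponents D. if \<alpha> = \<beta> then monomial_fun \<alpha> else 0)"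
    unfolding \<beta>(2) coef_properties by (intro sum.cong) auto
  then show "b = (\<Sum>\<alpha>\<in>exponents D. coef \<alpha> b *\<^sub>R monomial_fun \<alpha>)"
    using \<beta> assms(2) by simp
qed

lemma coef_eq_0:
  assumes "p \<in> polys D" "\<alpha> \<notin> exponents D"
  shows "coef \<alpha> p = 0"
proof (rule linear_eq_on[where f = "coef \<alpha>" and g = "\<lambda>_. 0" and x = p and B = "monomial_fun ` exponents D"])
  show "p \<in> span (monomial_fun ` exponents D)" using assms by (simp add: polys_eq_span)
qed (use assms(2) in \<open>auto simp: coef_properties linear_zero\<close>)

section \<open>The number of degrees of freedom\<close>

lemma twice_choose_two: "2 * ((k + 1) choose 2) = k * (k + 1)"
  by (induction k) (simp_all add: numeral_2_eq_2)

text \<open>Doubling the weight of a face gives \<open>(n - l) * (n + l + 1) = n * (n + 1) - l * (l + 1)\<close>, and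
  \<open>l * (l + 1)\<close> is absorbed into the two binomial coefficients. What remains are two instances
  of Vandermonde's convolution.\<close>

lemma sum_face_weights:
  fixes n :: nat
  assumes "1 \<le> n"
  shows "(\<Sum>l<n. ((n + 1) choose (l + 1)) * ((((n + 1 - l) choose 2) + l * (n - l)) * (n choose l)))
      + ((n + 1) choose 2) * ((2 * n - 1) choose n)
    = ((n + 1) choose 2) * ((2 * n + 1) choose n)"
proof -
  define w where "w l = ((n + 1 - l) choose 2) + l * (n - l)" for l
  define b where "b l = ((n + 1) choose (l + 1)) * (n choose l)" for l
  have w: "2 * w l + l * (l + 1) = n * (n + 1)" if "l \<le> n" for l
  proof -
    define k where "k = n - l"
    then have k: "n = l + k" using that by simp
    have "n + 1 - l = k + 1" "n - l = k" using k by auto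
    then have "2 * w l = k * (k + 1) + 2 * (l * k)"
      using twice_choose_two[of k] by (simp only: w_def distrib_left)
    then show ?thesis by (simp add: k algebra_simps)
  qed
  have b1: "(\<Sum>l\<le>n. b l) = (2 * n + 1) choose n"
  proof -
    have "(\<Sum>l\<le>n. b l) = (\<Sum>l\<le>n. (n choose l) * ((n + 1) choose (n - l)))"
    proof (rule sum.cong)
      fix l assume "l \<in> {..n}"
      then show "b l = (n choose l) * ((n + 1) choose (n - l))"
        using binomial_symmetric[of "l + 1" "n + 1"] by (simp add: b_def)
    qed simp
    also have "\<dots> = (2 * n + 1) choose n"
      using vandermonde[of n "n + 1" n] by (simp add: mult_2)
    finally show ?thesis .
  qed
  have b2: "(\<Sum>l\<le>n. l * (l + 1) * b l) = n * (n + 1) * ((2 * n - 1) choose n)"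
  proof -
    have "l * (l + 1) * b l = n * (n + 1) * ((n choose l) * ((n - 1) choose (n - l)))"
      if "l \<le> n" for l
    proof (cases l)
      case 0
      then show ?thesis using assms by (simp add: binomial_eq_0)
    next
      case (Suc k)
      have "(l + 1) * ((n + 1) choose (l + 1)) = (n + 1) * (n choose l)"
        using Suc_times_binomial_eq[of n l] by (simp add: mult.commute)
      moreover have "l * (n choose l) = n * ((n - 1) choose (n - l))"
      proof -
        have "l * (n choose l) = n * ((n - 1) choose k)"
          using times_binomial_minus1_eq[of l n] Suc by simp
        also have "(n - 1) choose k = (n - 1) choose (n - l)"
          using binomial_symmetric[of k "n - 1"] Suc that by simp
        finally show ?thesis .
      qed
      ultimately have "(l * (n choose l)) * ((l + 1) * ((n + 1) choose (l + 1)))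
          = (n * ((n - 1) choose (n - l))) * ((n + 1) * (n choose l))" by simp
      then show ?thesis by (simp only: b_def mult_ac)
    qed
    then have "(\<Sum>l\<le>n. l * (l + 1) * b l)
        = n * (n + 1) * (\<Sum>l\<le>n. (n choose l) * ((n - 1) choose (n - l)))"
      unfolding sum_distrib_left by (intro sum.cong) auto
    also have "\<dots> = n * (n + 1) * ((2 * n - 1) choose n)"
      using vandermonde[of n "n - 1" n] assms by (simp add: mult_2)
    finally show ?thesis .
  qed
  have "2 * (\<Sum>l<n. w l * b l) = 2 * (\<Sum>l\<le>n. w l * b l)"
    by (simp add: lessThan_Suc_atMost[symmetric] w_def)
  then have "2 * (\<Sum>l<n. w l * b l) + (\<Sum>l\<le>n. l * (l + 1) * b l)
      = (\<Sum>l\<le>n. (2 * w l + l * (l + 1)) * b l)"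
    by (simp only: sum_distrib_left sum.distrib[symmetric] distrib_right mult.assoc)
  also have "\<dots> = n * (n + 1) * (\<Sum>l\<le>n. b l)"
    unfolding sum_distrib_left by (intro sum.cong) (simp_all only: w atMost_iff)
  finally have "2 * (\<Sum>l<n. w l * b l) + n * (n + 1) * ((2 * n - 1) choose n)
      = n * (n + 1) * ((2 * n + 1) choose n)"
    unfolding b1 b2 .
  moreover have "n * (n + 1) = 2 * ((n + 1) choose 2)"
    by (rule twice_choose_two[symmetric])
  moreover have "(\<Sum>l<n. w l * b l)
      = (\<Sum>l<n. ((n + 1) choose (l + 1)) * ((((n + 1 - l) choose 2) + l * (n - l)) * (n choose l)))"
    unfolding w_def b_def by (simp only: mult_ac)
  ultimately show ?thesis by (simp only: mult.assoc)
qed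

section \<open>Products and derivatives of polynomials\<close>

lemma zero_in_polys [simp]: "0 \<in> polys D" "(\<lambda>x. 0) \<in> polys D"
  using subspace_0[OF subspace_polys] by (simp_all add: zero_fun_def)

lemma polys_add: "p \<in> polys D \<Longrightarrow> q \<in> polys D \<Longrightarrow> (\<lambda>x. p x + q x) \<in> polys D"
  using subspace_add[OF subspace_polys, of p D q] by (simp add: plus_fun_def)

lemma polys_scale: "p \<in> polys D \<Longrightarrow> (\<lambda>x. c * p x) \<in> polys D"
  using subspace_scale[OF subspace_polys, of p D c] by (simp add: scaleR_fun_def)

lemma polys_sum: "(\<And>i. i \<in> I \<Longrightarrow> f i \<in> polys D) \<Longrightarrow> (\<lambda>x. \<Sum>i\<in>I. f i x) \<in> polys D"
  by (induction I rule: infinite_finite_induct) (auto intro: polys_add)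

lemma polys_const: "0 \<in> D \<Longrightarrow> (\<lambda>x :: real^'n. c) \<in> polys D"
proof -
  assume "0 \<in> D"
  then have "monomial_fun (\<lambda>_ :: 'n. 0) \<in> polys D"
    by (intro monomial_in_polys) (simp add: exponents_def)
  from polys_scale[OF this, of c] show ?thesis by (simp add: monomial_fun_def)
qed

lemma polys_component: "1 \<in> D \<Longrightarrow> (\<lambda>x :: real^'n. x $ i) \<in> polys D"
proof -
  assume "1 \<in> D"
  then have "monomial_fun (\<lambda>j. if j = i then 1 else 0) \<in> polys D"
    by (intro monomial_in_polys) (simp add: exponents_def)
  moreover have "monomial_fun (\<lambda>j. if j = i then 1 else 0) = (\<lambda>x :: real^'n. x $ i)"
  proof
    fix x :: "real^'n"
    have "monomial_fun (\<lambda>j. if j = i then 1 else 0) x = (\<Prod>j\<in>UNIV. if j = i then x $ i else 1)"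
      unfolding monomial_fun_def by (intro prod.cong) auto
    then show "monomial_fun (\<lambda>j. if j = i then 1 else 0) x = x $ i" by simp
  qed
  ultimately show ?thesis by simp
qed

lemma polys_affine: "(\<lambda>x :: real^'n. c + g \<bullet> x) \<in> polys {..1}"
  unfolding inner_vec_def inner_real_def
  by (intro polys_add polys_sum polys_scale polys_const polys_component) auto

lemma polys_le_mono: "p \<in> polys {..a} \<Longrightarrow> a \<le> b \<Longrightarrow> p \<in> polys {..b}"
  using polys_mono[of "{..a}" "{..b}"] by auto

lemma polys_induct [consumes 1, case_names monomial zero add scale]:
  assumes "p \<in> polys D" "\<And>\<alpha>. \<alpha> \<in> exponents D \<Longrightarrow> P (monomial_fun \<alpha>)"
    and "P (\<lambda>x. 0)" "\<And>p q. p \<in> polys D \<Longrightarrow> q \<in> polys D \<Longrightarrow> P p \<Longrightarrow> P q \<Longrightarrow> P (\<lambda>x. p x + q x)"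
    and "\<And>c p. p \<in> polys D \<Longrightarrow> P p \<Longrightarrow> P (\<lambda>x. c * p x)"
  shows "P p"
proof -
  have "subspace {p \<in> polys D. P p}"
    using assms(3-5) zero_in_polys[of D] polys_add[of _ D] polys_scale[of _ D]
    by (auto simp: subspace_def zero_fun_def plus_fun_def scaleR_fun_def)
  then have "span (monomial_fun ` exponents D) \<subseteq> {p \<in> polys D. P p}"
    using assms(2) monomial_in_polys by (intro span_minimal) auto
  then show ?thesis using assms(1) by (auto simp: polys_eq_span)
qed

lemma polys_mult:
  assumes "p \<in> polys {..a}" "q \<in> polys {..b}"
  shows "(\<lambda>x. p x * q x) \<in> polys {..a + b}"
  using assms(1)
proof (induction p rule: polys_induct)
  case (monomial \<alpha>)
  show ?case using assms(2)
  proof (induction q rule: polys_induct)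
    case (monomial \<beta>)
    have "(\<lambda>x. monomial_fun \<alpha> x * monomial_fun \<beta> x) = monomial_fun (\<lambda>i. \<alpha> i + \<beta> i)"
      by (simp add: monomial_fun_def power_add prod.distrib fun_eq_iff)
    moreover have "(\<lambda>i. \<alpha> i + \<beta> i) \<in> exponents {..a + b}"
      using monomial \<open>\<alpha> \<in> exponents {..a}\<close> by (simp add: exponents_def sum.distrib)
    ultimately show ?case by (simp add: monomial_in_polys)
  next
    case (add p q)
    then show ?case using polys_add by (simp add: distrib_left)
  next
    case (scale c p)
    then show ?case using polys_scale[of _ _ c] by (simp add: mult.left_commute)
  qed auto
next
  case (add p q)
  then show ?case using polys_add by (simp add: distrib_right)
next
  case (scale c p)
  then show ?case using polys_scale[of _ _ c] by (simp add: mult.assoc)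
qed auto

lemma polys_mult_le:
  "p \<in> polys {..a} \<Longrightarrow> q \<in> polys {..b} \<Longrightarrow> a + b \<le> m \<Longrightarrow> (\<lambda>x. p x * q x) \<in> polys {..m}"
  by (rule polys_le_mono[OF polys_mult])

lemma polys_prod_power_affine:
  assumes "\<And>v. v \<in> S \<Longrightarrow> f v \<in> polys {..1}"
  shows "(\<lambda>x. \<Prod>v\<in>S. f v x ^ \<alpha> v) \<in> polys {..sum \<alpha> S}"
  using assms
proof (induction S rule: infinite_finite_induct)
  case (insert v S)
  have "(\<lambda>x. f v x ^ k) \<in> polys {..k}" for k
  proof (induction k)
    case (Suc k)
    then show ?case using polys_mult_le[of "f v" 1 _ k "Suc k"] insert.prems by auto
  qed (simp add: polys_const)
  then show ?case using insert by (simp add: polys_mult)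
qed (simp_all add: polys_const)

definition dir_deriv :: "real^'n \<Rightarrow> (real^'n \<Rightarrow> real) \<Rightarrow> real^'n \<Rightarrow> real"
  where "dir_deriv t p x = frechet_derivative p (at x) t"

lemma dir_deriv_eqI: "(p has_derivative p') (at x) \<Longrightarrow> dir_deriv t p x = p' t"
  unfolding dir_deriv_def by (simp add: frechet_derivative_at[of p p' x, symmetric])

lemma has_derivative_monomial:
  "(monomial_fun \<alpha> has_derivative
    (\<lambda>h. \<Sum>i\<in>UNIV. h $ i * (real (\<alpha> i) * monomial_fun (\<alpha>(i := \<alpha> i - 1)) x))) (at (x :: real^'n))"
proof -
  have "((\<lambda>x. \<Prod>i\<in>UNIV. x $ i ^ \<alpha> i) has_derivative
    (\<lambda>h. \<Sum>i\<in>UNIV. (real (\<alpha> i) * h $ i * x $ i ^ (\<alpha> i - 1)) * (\<Prod>j\<in>UNIV - {i}. x $ j ^ \<alpha> j)))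
    (at (x :: real^'n))"
    by (intro has_derivative_prod has_derivative_power bounded_linear_imp_has_derivative
        bounded_linear_vec_nth)
  moreover have "monomial_fun (\<alpha>(i := \<alpha> i - 1)) x = x $ i ^ (\<alpha> i - 1) * (\<Prod>j\<in>UNIV - {i}. x $ j ^ \<alpha> j)"
    for i
  proof -
    have "(\<Prod>j\<in>UNIV - {i}. x $ j ^ (\<alpha>(i := \<alpha> i - 1)) j) = (\<Prod>j\<in>UNIV - {i}. x $ j ^ \<alpha> j)"
      by (intro prod.cong) auto
    then show ?thesis
      unfolding monomial_fun_def by (subst prod.remove[of UNIV i]) auto
  qed
  moreover have "monomial_fun \<alpha> = (\<lambda>x :: real^'n. \<Prod>i\<in>UNIV. x $ i ^ \<alpha> i)"
    by (simp add: monomial_fun_def fun_eq_iff)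
  ultimately show ?thesis by (simp add: mult_ac)
qed

lemma polys_differentiable: "p \<in> polys D \<Longrightarrow> p differentiable (at x)"
proof (induction p rule: polys_induct)
  case (monomial \<alpha>)
  then show ?case using has_derivative_monomial differentiable_def by blast
qed (simp_all add: differentiable_add differentiable_mult)

lemma polys_continuous: "p \<in> polys D \<Longrightarrow> continuous_on S p"
  unfolding continuous_on_eq_continuous_within
  using differentiable_imp_continuous_within[OF differentiable_at_withinI[OF polys_differentiable]]
  by blast

lemma dir_deriv_add:
  "p differentiable (at x) \<Longrightarrow> q differentiable (at x) \<Longrightarrow>
    dir_deriv t (\<lambda>x. p x + q x) x = dir_deriv t p x + dir_deriv t q x"
  using dir_deriv_eqI[OF has_derivative_add, of p _ x q _ t]
  by (simp add: frechet_derivative_works dir_deriv_def)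

lemma dir_deriv_mult:
  "p differentiable (at x) \<Longrightarrow> q differentiable (at x) \<Longrightarrow>
    dir_deriv t (\<lambda>x. p x * q x) x = dir_deriv t p x * q x + p x * dir_deriv t q x"
  using dir_deriv_eqI[OF has_derivative_mult, of p _ x q _ t]
  by (simp add: frechet_derivative_works dir_deriv_def)

lemma dir_deriv_const [simp]: "dir_deriv t (\<lambda>x. c) x = 0"
  by (subst dir_deriv_eqI[OF has_derivative_const]) simp

lemma dir_deriv_scale:
  "p differentiable (at x) \<Longrightarrow> dir_deriv t (\<lambda>x. c * p x) x = c * dir_deriv t p x"
  using dir_deriv_mult[of "\<lambda>_. c" x p t] by simp

lemma dir_deriv_sum:
  assumes "\<And>i. i \<in> I \<Longrightarrow> f i differentiable (at x)"
  shows "dir_deriv t (\<lambda>x. \<Sum>i\<in>I. f i x) x = (\<Sum>i\<in>I. dir_deriv t (f i) x)"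
  using assms
  by (induction I rule: infinite_finite_induct) (auto simp: dir_deriv_add)

lemma dir_deriv_components:
  assumes "p differentiable (at x)"
  shows "dir_deriv t p x = (\<Sum>j\<in>UNIV. t $ j * dir_deriv (axis j 1) p x)"
proof -
  have lin: "linear (frechet_derivative p (at x))"
    using assms by (rule linear_frechet_derivative)
  have "dir_deriv t p x = frechet_derivative p (at x) (\<Sum>j\<in>UNIV. t $ j *\<^sub>R axis j 1)"
    using basis_expansion[of t] by (simp add: dir_deriv_def scalar_mult_eq_scaleR)
  then show ?thesis
    by (simp add: linear_sum[OF lin] linear_scale[OF lin] dir_deriv_def)
qed

lemma polys_dir_deriv:
  assumes "p \<in> polys D" "\<And>d. d \<in> D \<Longrightarrow> 0 < d \<Longrightarrow> d - 1 \<in> E"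
  shows "dir_deriv t p \<in> polys E"
  using assms(1)
proof (induction p rule: polys_induct)
  case (monomial \<alpha>)
  have "dir_deriv t (monomial_fun \<alpha>)
      = (\<lambda>x. \<Sum>i\<in>UNIV. t $ i * (real (\<alpha> i) * monomial_fun (\<alpha>(i := \<alpha> i - 1)) x))"
    by (intro ext dir_deriv_eqI has_derivative_monomial)
  moreover have "(\<lambda>x. real (\<alpha> i) * monomial_fun (\<alpha>(i := \<alpha> i - 1)) x) \<in> polys E" for i
  proof (cases "\<alpha> i = 0")
    case False
    have "sum \<alpha> UNIV = \<alpha> i + sum \<alpha> (UNIV - {i})" by (simp add: sum.remove)
    moreover have "sum (\<alpha>(i := \<alpha> i - 1)) UNIV = (\<alpha> i - 1) + sum \<alpha> (UNIV - {i})"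
      by (subst sum.remove[of UNIV i]) (auto intro: sum.cong)
    ultimately have "sum (\<alpha>(i := \<alpha> i - 1)) UNIV = sum \<alpha> UNIV - 1" "0 < sum \<alpha> UNIV"
      using False by auto
    then have "\<alpha>(i := \<alpha> i - 1) \<in> exponents E"
      using monomial assms(2)[of "sum \<alpha> UNIV"] unfolding exponents_def mem_Collect_eq by metis
    then show ?thesis by (intro polys_scale monomial_in_polys)
  qed simp
  ultimately show ?case by (simp only: polys_sum polys_scale)
next
  case (add p q)
  then have "dir_deriv t (\<lambda>x. p x + q x) = (\<lambda>x. dir_deriv t p x + dir_deriv t q x)"
    by (intro ext dir_deriv_add polys_differentiable)
  then show ?case using add polys_add by simp
next
  case (scale c p)
  then have "dir_deriv t (\<lambda>x. c * p x) = (\<lambda>x. c * dir_deriv t p x)"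
    by (intro ext dir_deriv_scale polys_differentiable)
  then show ?case using scale polys_scale by simp
qed (simp add: dir_deriv_const[abs_def])

lemma polys_dir_deriv_le: "p \<in> polys {..m} \<Longrightarrow> dir_deriv t p \<in> polys {..m - 1}"
  by (rule polys_dir_deriv) auto

lemma dir_deriv_line:
  assumes "p \<in> polys D"
  shows "((\<lambda>s. p (x + s *\<^sub>R t)) has_real_derivative dir_deriv t p (x + s *\<^sub>R t)) (at s)"
proof -
  have "(p has_derivative frechet_derivative p (at (x + s *\<^sub>R t))) (at (x + s *\<^sub>R t))"
    using polys_differentiable[OF assms] frechet_derivative_works by blast
  moreover have "((\<lambda>s. x + s *\<^sub>R t) has_derivative (\<lambda>h. h *\<^sub>R t)) (at s)"
    by (auto intro!: derivative_eq_intros)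
  ultimately have "((\<lambda>s. p (x + s *\<^sub>R t)) has_derivative
      (\<lambda>h. frechet_derivative p (at (x + s *\<^sub>R t)) (h *\<^sub>R t))) (at s)"
    by (rule has_derivative_compose[rotated])
  moreover have "linear (frechet_derivative p (at (x + s *\<^sub>R t)))"
    using polys_differentiable[OF assms] by (rule linear_frechet_derivative)
  ultimately have "((\<lambda>s. p (x + s *\<^sub>R t)) has_derivative
      (\<lambda>h. h * dir_deriv t p (x + s *\<^sub>R t))) (at s)"
    by (simp add: dir_deriv_def linear_scale)
  moreover have "(\<lambda>h. h * dir_deriv t p (x + s *\<^sub>R t)) = (*) (dir_deriv t p (x + s *\<^sub>R t))"
    by (simp add: fun_eq_iff)
  ultimately show ?thesis
    by (simp add: has_field_derivative_def)
qed

lemma row_div_eq: "row_div \<tau> x $ i = (\<Sum>j\<in>UNIV. dir_deriv (axis j 1) (\<lambda>y. \<tau> y $ i $ j) x)"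
  by (simp add: row_div_def dir_deriv_def)

section \<open>Barycentric coordinates and divisibility by them\<close>

text \<open>\<open>C\<close> is the vertex set, \<open>lam v\<close> the barycentric coordinate of the vertex \<open>v\<close> and \<open>grd v\<close> its constant
  gradient, which is a normal vector of the facet opposite to \<open>v\<close>.\<close>

locale simplex_coords =
  fixes C :: "(real^'n) set" and lam :: "real^'n \<Rightarrow> real^'n \<Rightarrow> real" and grd :: "real^'n \<Rightarrow> real^'n"
  assumes finite_C [simp]: "finite C"
    and card_C: "card C = Suc CARD('n)"
    and affine_independent_C: "\<not> affine_dependent C"
    and lam_affine: "v \<in> C \<Longrightarrow> lam v x = lam v 0 + grd v \<bullet> x"
    and lam_vertex: "v \<in> C \<Longrightarrow> w \<in> C \<Longrightarrow> lam v w = (if v = w then 1 else 0)"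
    and lam_sum: "(\<Sum>v\<in>C. lam v x) = 1"
    and lam_point: "(\<Sum>v\<in>C. lam v x *\<^sub>R v) = x"

text \<open>The differences of the vertices to one of them form a basis of the space; its dual basis gives
  the gradients.\<close>

lemma simplex_coords_exist:
  fixes C :: "(real^'n) set"
  assumes indep: "\<not> affine_dependent C" and card: "card C = Suc CARD('n)"
  shows "\<exists>lam grd. simplex_coords C lam grd"
proof -
  have fin: "finite C" using card by (metis card.infinite nat.distinct(1))
  have "\<exists>h. \<forall>w\<in>C. fst h + snd h \<bullet> w = (if v = w then 1 else 0)" if v: "v \<in> C" for v
  proof -
    have "C \<noteq> {v}" using card zero_less_card_finite[where 'a='n] by auto
    then obtain a where a: "a \<in> C" "a \<noteq> v" using v by auto
    let ?B = "(\<lambda>x. - a + x) ` (C - {a})"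
    have "independent ?B" using indep affine_dependent_iff_dependent2[OF a(1)] by simp
    then obtain f :: "real^'n \<Rightarrow> real" where f: "linear f"
      "\<forall>b\<in>?B. f b = (if b = - a + v then 1 else 0)"
      using linear_independent_extend[of ?B "\<lambda>b. if b = - a + v then 1 else 0"] by blast
    have "- f a + adjoint f 1 \<bullet> w = (if v = w then 1 else 0)" if w: "w \<in> C" for w
    proof -
      have "adjoint f 1 \<bullet> w = f w"
        using adjoint_works[OF f(1), of w 1] by (simp add: inner_commute)
      then have "- f a + adjoint f 1 \<bullet> w = f (- a + w)"
        using linear_diff[OF f(1), of w a] by simp
      also have "\<dots> = (if v = w then 1 else 0)"
      proof (cases "w = a")
        case True
        then show ?thesis using a linear_0[OF f(1)] by simp
      next
        case False
        then show ?thesis using f(2) w by auto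
      qed
      finally show ?thesis .
    qed
    then show ?thesis by (intro exI[of _ "(- f a, adjoint f 1)"]) simp
  qed
  then have "\<forall>v\<in>C. \<exists>h. \<forall>w\<in>C. fst h + snd h \<bullet> w = (if v = w then 1 else 0 :: real)" by simp
  from bchoice[OF this] obtain h where h: "\<And>v w. v \<in> C \<Longrightarrow> w \<in> C \<Longrightarrow>
      fst (h v) + snd (h v) \<bullet> w = (if v = w then 1 else 0 :: real)"
    by auto
  define lam where "lam v x = fst (h v) + snd (h v) \<bullet> x" for v x
  have "simplex_coords C lam (\<lambda>v. snd (h v))"
  proof
    fix x :: "real^'n"
    have "x \<in> affine hull C"
      using affine_independent_span_eq[OF indep] card by simp
    then obtain u where u: "sum u C = 1" "(\<Sum>v\<in>C. u v *\<^sub>R v) = x"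
      by (auto simp: affine_hull_finite[OF fin])
    have "lam w x = u w" if w: "w \<in> C" for w
    proof -
      have "lam w x = (\<Sum>v\<in>C. u v * (fst (h w) + snd (h w) \<bullet> v))"
        unfolding lam_def using u
        by (simp add: distrib_left sum.distrib sum_distrib_right[symmetric] inner_sum_right flip: u(2))
      also have "\<dots> = (\<Sum>v\<in>C. if w = v then u v else 0)"
        using h w by (intro sum.cong) auto
      finally show ?thesis using fin w by simp
    qed
    then show "(\<Sum>v\<in>C. lam v x) = 1" "(\<Sum>v\<in>C. lam v x *\<^sub>R v) = x"
      using u by simp_all
  qed (use fin card indep h in \<open>auto simp: lam_def\<close>)
  then show ?thesis by blast
qed

context simplex_coords
begin

lemma finite_subset_C: "S \<subseteq> C \<Longrightarrow> finite S"
  by (rule finite_subset[OF _ finite_C])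

lemma lam_polys: "v \<in> C \<Longrightarrow> lam v \<in> polys {..1}"
proof -
  assume "v \<in> C"
  then have "lam v = (\<lambda>x. lam v 0 + grd v \<bullet> x)" by (intro ext lam_affine)
  then show ?thesis by (metis polys_affine)
qed

lemma lam_affine_combination:
  assumes "w \<in> C" "sum u S = 1"
  shows "lam w (\<Sum>v\<in>S. u v *\<^sub>R v) = (\<Sum>v\<in>S. u v * lam w v)"
proof -
  have "(\<Sum>v\<in>S. u v * lam w v) = (\<Sum>v\<in>S. u v * (lam w 0 + grd w \<bullet> v))"
    by (intro sum.cong refl arg_cong2[of _ _ _ _ "(*)"] lam_affine[OF assms(1)])
  also have "\<dots> = lam w 0 + grd w \<bullet> (\<Sum>v\<in>S. u v *\<^sub>R v)"
    using assms(2) by (simp add: distrib_left sum.distrib sum_distrib_right[symmetric] inner_sum_right)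
  also have "\<dots> = lam w (\<Sum>v\<in>S. u v *\<^sub>R v)"
    by (rule lam_affine[OF assms(1), symmetric])
  finally show ?thesis by (rule sym)
qed

lemma lam_vertex_combination:
  assumes "w \<in> C" "S \<subseteq> C" "sum u S = 1"
  shows "lam w (\<Sum>v\<in>S. u v *\<^sub>R v) = (if w \<in> S then u w else 0)"
proof -
  have "(\<Sum>v\<in>S. u v * lam w v) = (\<Sum>v\<in>S. if w = v then u v else 0)"
    using assms lam_vertex by (intro sum.cong) auto
  then show ?thesis
    using assms lam_affine_combination[OF assms(1,3)] finite_subset[OF assms(2)] by simp
qed

lemma sum_lam_subset:
  assumes "S \<subseteq> C" "\<forall>v\<in>C - S. lam v x = 0"
  shows "(\<Sum>v\<in>S. lam v x) = 1" "(\<Sum>v\<in>S. lam v x *\<^sub>R v) = x"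
proof -
  have "(\<Sum>v\<in>S. lam v x) = (\<Sum>v\<in>C. lam v x)"
    using assms by (intro sum.mono_neutral_left) auto
  then show "(\<Sum>v\<in>S. lam v x) = 1" by (simp add: lam_sum)
  have "(\<Sum>v\<in>S. lam v x *\<^sub>R v) = (\<Sum>v\<in>C. lam v x *\<^sub>R v)"
    using assms by (intro sum.mono_neutral_left) auto
  then show "(\<Sum>v\<in>S. lam v x *\<^sub>R v) = x" by (simp add: lam_point)
qed

lemma mem_hull_iff:
  assumes "S \<subseteq> C"
  shows "x \<in> convex hull S \<longleftrightarrow> (\<forall>v\<in>S. 0 \<le> lam v x) \<and> (\<forall>v\<in>C - S. lam v x = 0)"
proof
  assume "x \<in> convex hull S"
  then obtain u where u: "\<forall>v\<in>S. 0 \<le> u v" "sum u S = 1" "(\<Sum>v\<in>S. u v *\<^sub>R v) = x"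
    using finite_subset[OF assms] by (auto simp: convex_hull_finite)
  then show "(\<forall>v\<in>S. 0 \<le> lam v x) \<and> (\<forall>v\<in>C - S. lam v x = 0)"
    using lam_vertex_combination[OF _ assms u(2)] assms by auto
next
  assume x: "(\<forall>v\<in>S. 0 \<le> lam v x) \<and> (\<forall>v\<in>C - S. lam v x = 0)"
  then show "x \<in> convex hull S"
    using sum_lam_subset[OF assms, of x] finite_subset[OF assms] 
    by (auto simp: convex_hull_finite intro!: exI[of _ "\<lambda>v. lam v x"])
qed

abbreviation form_value :: "(real^'n) set \<Rightarrow> nat \<Rightarrow> ((real^'n \<Rightarrow> nat) \<Rightarrow> real) \<Rightarrow> real^'n \<Rightarrow> real"
  where "form_value S m c x \<equiv>
    (\<Sum>\<alpha>\<in>multi_indices S m. c \<alpha> * (\<Prod>v\<in>S. lam v x ^ \<alpha> v))"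

text \<open>The comparison is restricted to the plane of the face with the vertices \<open>S\<close>: there the
  coordinates in \<open>S\<close> add up to one, and so every polynomial of degree at most \<open>m\<close> can be made
  homogeneous of degree \<open>m\<close> in them.\<close>

definition is_form :: "(real^'n) set \<Rightarrow> nat \<Rightarrow> (real^'n \<Rightarrow> real) \<Rightarrow> bool"
  where "is_form S m p \<longleftrightarrow> (\<exists>c. \<forall>x. (\<forall>v\<in>C - S. lam v x = 0) \<longrightarrow>
    p x = form_value S m c x)"

lemma is_form_cong:
  "is_form S m p \<Longrightarrow> (\<And>x. \<forall>v\<in>C - S. lam v x = 0 \<Longrightarrow> p x = q x) \<Longrightarrow> is_form S m q"
  unfolding is_form_def by simp

lemma is_form_zero: "is_form S m (\<lambda>x. 0)"
  unfolding is_form_def by (intro exI[of _ "\<lambda>_. 0"]) simp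

lemma is_form_add:
  assumes "is_form S m p" "is_form S m q"
  shows "is_form S m (\<lambda>x. p x + q x)"
proof -
  obtain c d where
    "\<And>x. \<forall>v\<in>C - S. lam v x = 0 \<Longrightarrow> p x = form_value S m c x"
    "\<And>x. \<forall>v\<in>C - S. lam v x = 0 \<Longrightarrow> q x = form_value S m d x"
    using assms unfolding is_form_def by auto
  then show ?thesis
    unfolding is_form_def
    by (intro exI[of _ "\<lambda>\<alpha>. c \<alpha> + d \<alpha>"]) (simp add: distrib_right sum.distrib)
qed

lemma is_form_scale:
  assumes "is_form S m p"
  shows "is_form S m (\<lambda>x. a * p x)"
proof -
  obtain c where
    "\<And>x. \<forall>v\<in>C - S. lam v x = 0 \<Longrightarrow> p x = form_value S m c x"
    using assms unfolding is_form_def by auto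
  then show ?thesis
    unfolding is_form_def
    by (intro exI[of _ "\<lambda>\<alpha>. a * c \<alpha>"]) (simp add: sum_distrib_left mult.assoc)
qed

lemma is_form_sum:
  "(\<And>i. i \<in> I \<Longrightarrow> is_form S m (f i)) \<Longrightarrow> is_form S m (\<lambda>x. \<Sum>i\<in>I. f i x)"
  by (induction I rule: infinite_finite_induct) (simp_all add: is_form_zero is_form_add)

lemma is_form_monomial:
  assumes "S \<subseteq> C" "\<alpha> \<in> multi_indices S m"
  shows "is_form S m (\<lambda>x. \<Prod>v\<in>S. lam v x ^ \<alpha> v)"
proof -
  have "(\<Sum>\<beta>\<in>multi_indices S m. (if \<beta> = \<alpha> then 1 else 0) * (\<Prod>v\<in>S. lam v x ^ \<beta> v))
      = (\<Prod>v\<in>S. lam v x ^ \<alpha> v)" for x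
  proof -
    have "(\<Sum>\<beta>\<in>multi_indices S m. (if \<beta> = \<alpha> then 1 else 0) * (\<Prod>v\<in>S. lam v x ^ \<beta> v))
      = (\<Sum>\<beta>\<in>multi_indices S m. if \<beta> = \<alpha> then \<Prod>v\<in>S. lam v x ^ \<beta> v else 0)"
      by (intro sum.cong) auto
    then show ?thesis using assms finite_subset[OF assms(1)] by simp
  qed
  then show ?thesis
    unfolding is_form_def by (intro exI[of _ "\<lambda>\<beta>. if \<beta> = \<alpha> then 1 else 0"]) simp
qed

lemma is_form_mult:
  assumes "S \<subseteq> C" "is_form S a p" "is_form S b q"
  shows "is_form S (a + b) (\<lambda>x. p x * q x)"
proof -
  obtain c d where
    c: "\<And>x. \<forall>v\<in>C - S. lam v x = 0 \<Longrightarrow> p x = form_value S a c x"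
    and d: "\<And>x. \<forall>v\<in>C - S. lam v x = 0 \<Longrightarrow> q x = form_value S b d x"
    using assms(2,3) unfolding is_form_def by auto
  have "is_form S (a + b) (\<lambda>x. \<Sum>\<alpha>\<in>multi_indices S a. \<Sum>\<beta>\<in>multi_indices S b.
      (c \<alpha> * d \<beta>) * (\<Prod>v\<in>S. lam v x ^ (\<alpha> v + \<beta> v)))"
    by (intro is_form_sum is_form_scale is_form_monomial assms(1))
      (auto simp: multi_indices_def sum.distrib)
  then show ?thesis
  proof (rule is_form_cong)
    fix x assume "\<forall>v\<in>C - S. lam v x = 0"
    then show "(\<Sum>\<alpha>\<in>multi_indices S a. \<Sum>\<beta>\<in>multi_indices S b.
      (c \<alpha> * d \<beta>) * (\<Prod>v\<in>S. lam v x ^ (\<alpha> v + \<beta> v))) = p x * q x"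
      by (simp add: c d sum_product power_add prod.distrib mult_ac)
  qed
qed

lemma is_form_lam:
  assumes "S \<subseteq> C" "v \<in> S"
  shows "is_form S 1 (lam v)"
proof -
  have fin: "finite S" using assms(1) by (rule finite_subset_C)
  have "is_form S 1 (\<lambda>x. \<Prod>w\<in>S. lam w x ^ (if w = v then 1 else 0))"
    using assms fin by (intro is_form_monomial) (auto simp: multi_indices_def)
  moreover have "(\<Prod>w\<in>S. lam w x ^ (if w = v then 1 else 0)) = lam v x" for x
  proof -
    have "(\<Prod>w\<in>S. lam w x ^ (if w = v then 1 else 0)) = (\<Prod>w\<in>S. if w = v then lam w x else 1)"
      by (intro prod.cong) auto
    then show ?thesis using fin assms by simp
  qed
  ultimately show ?thesis by simp
qed

text \<open>A form is raised in degree by multiplication with the sum of the coordinates, which is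
  one.\<close>

lemma is_form_one:
  assumes "S \<subseteq> C"
  shows "is_form S m (\<lambda>x. 1)"
proof (induction m)
  case 0
  have "is_form S 0 (\<lambda>x. \<Prod>v\<in>S. lam v x ^ 0)"
    using assms by (intro is_form_monomial) (auto simp: multi_indices_def)
  then show ?case by simp
next
  case (Suc m)
  have "is_form S 1 (\<lambda>x. \<Sum>v\<in>S. lam v x)"
    using assms by (intro is_form_sum is_form_lam)
  then have "is_form S 1 (\<lambda>x. 1)"
    by (rule is_form_cong) (use sum_lam_subset[OF assms] in auto)
  from is_form_mult[OF assms this Suc] show ?case by simp
qed

text \<open>Each Cartesian coordinate is a linear form in the barycentric coordinates; so a monomial is a
  form of its own degree, which is then raised to \<open>m\<close>.\<close>

lemma polys_is_form:
  assumes "S \<subseteq> C" "p \<in> polys {..m}"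
  shows "is_form S m p"
  using assms(2)
proof (induction p rule: polys_induct)
  case (monomial \<alpha>)
  have comp: "is_form S 1 (\<lambda>x. x $ i)" for i
  proof -
    have "is_form S 1 (\<lambda>x. \<Sum>v\<in>S. v $ i * lam v x)"
      using assms(1) by (intro is_form_sum is_form_scale is_form_lam)
    then show ?thesis
    proof (rule is_form_cong)
      fix x assume "\<forall>v\<in>C - S. lam v x = 0"
      then have "x $ i = (\<Sum>v\<in>S. lam v x *\<^sub>R v) $ i"
        using sum_lam_subset(2)[OF assms(1)] by simp
      then show "(\<Sum>v\<in>S. v $ i * lam v x) = x $ i" by (simp add: mult.commute)
    qed
  qed
  have pow: "is_form S k (\<lambda>x. x $ i ^ k)" for i k
  proof (induction k)
    case (Suc k)
    from is_form_mult[OF assms(1) comp Suc] show ?case by simp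
  qed (simp add: is_form_one assms)
  have "is_form S (sum \<alpha> I) (\<lambda>x. \<Prod>i\<in>I. x $ i ^ \<alpha> i)" if "finite I" for I
    using that
  proof (induction I rule: finite_induct)
    case (insert i I)
    then show ?case using is_form_mult[OF assms(1) pow insert.IH] by simp
  qed (simp add: is_form_one assms)
  from this[of UNIV] have "is_form S (sum \<alpha> UNIV) (monomial_fun \<alpha>)"
    by (simp add: monomial_fun_def[abs_def])
  from is_form_mult[OF assms(1) this is_form_one[OF assms(1), of "m - sum \<alpha> UNIV"]]
  show ?case using monomial by (simp add: exponents_def)
qed (simp_all add: is_form_zero is_form_add is_form_scale)

text \<open>A positive vector \<open>y\<close>, divided by the sum \<open>s\<close> of its entries, is the vector of barycentric
  coordinates of a point inside the face. By homogeneity the value of the form there is its value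
  at \<open>y\<close> divided by \<open>s ^ m\<close>, so the form vanishes on the whole positive orthant.\<close>

lemma form_coefficients_eq_0:
  assumes "S \<subseteq> C" "S \<noteq> {}" "\<alpha> \<in> multi_indices S m"
    and "\<And>x. (\<forall>v\<in>S. 0 < lam v x) \<Longrightarrow> (\<forall>v\<in>C - S. lam v x = 0) \<Longrightarrow>
      form_value S m c x = 0"
  shows "c \<alpha> = 0"
proof -
  have fin: "finite S" using assms(1) by (rule finite_subset_C)
  show ?thesis
  proof (rule monomials_independent_on_orthant[OF fin finite_multi_indices[OF fin] _ _ assms(3)])
    fix \<alpha> \<beta> assume "\<alpha> \<in> multi_indices S m" "\<beta> \<in> multi_indices S m" "\<forall>i\<in>S. \<alpha> i = \<beta> i"
    then have "\<alpha> i = \<beta> i" for i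
      by (cases "i \<in> S") (auto simp: multi_indices_def)
    then show "\<alpha> = \<beta>" by (rule ext)
  next
    fix y :: "real^'n \<Rightarrow> real" assume y: "\<And>i. 0 < y i"
    define s where "s = sum y S"
    define u where "u v = y v / s" for v
    define x where "x = (\<Sum>v\<in>S. u v *\<^sub>R v)"
    have s: "0 < s" unfolding s_def using fin assms(2) y by (intro sum_pos) auto
    then have "sum u S = 1" by (simp add: u_def s_def sum_divide_distrib[symmetric])
    then have lx: "lam w x = (if w \<in> S then u w else 0)" if "w \<in> C" for w
      unfolding x_def using that assms(1) by (intro lam_vertex_combination)
    have "form_value S m c x = 0"
      using assms(1) lx y s by (intro assms(4)) (auto simp: u_def)
    moreover have "(\<Prod>v\<in>S. lam v x ^ \<alpha> v) = (\<Prod>v\<in>S. y v ^ \<alpha> v) / s ^ m"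
      if "\<alpha> \<in> multi_indices S m" for \<alpha>
    proof -
      have "(\<Prod>v\<in>S. lam v x ^ \<alpha> v) = (\<Prod>v\<in>S. y v ^ \<alpha> v / s ^ \<alpha> v)"
        using assms(1) lx by (intro prod.cong) (auto simp: u_def power_divide)
      also have "\<dots> = (\<Prod>v\<in>S. y v ^ \<alpha> v) / s ^ m"
        using that by (simp add: prod_dividef multi_indices_def power_sum[symmetric])
      finally show ?thesis .
    qed
    ultimately have "(\<Sum>\<alpha>\<in>multi_indices S m. c \<alpha> * (\<Prod>v\<in>S. y v ^ \<alpha> v)) / s ^ m = 0"
      by (simp add: sum_divide_distrib)
    then show "(\<Sum>\<alpha>\<in>multi_indices S m. c \<alpha> * (\<Prod>v\<in>S. y v ^ \<alpha> v)) = 0"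
      using s by simp
  qed
qed

lemma polys_eq_0_on_face:
  assumes "S \<subseteq> C" "S \<noteq> {}" "p \<in> polys {..m}"
    and "\<And>x. (\<forall>v\<in>S. 0 < lam v x) \<Longrightarrow> (\<forall>v\<in>C - S. lam v x = 0) \<Longrightarrow> p x = 0"
    and "\<forall>v\<in>C - S. lam v x = 0"
  shows "p x = 0"
proof -
  obtain c where
    c: "\<And>x. \<forall>v\<in>C - S. lam v x = 0 \<Longrightarrow> p x = form_value S m c x"
    using polys_is_form[OF assms(1,3)] unfolding is_form_def by auto
  have "c \<alpha> = 0" if "\<alpha> \<in> multi_indices S m" for \<alpha>
  proof (rule form_coefficients_eq_0[OF assms(1,2) that])
    fix x assume "\<forall>v\<in>S. 0 < lam v x" "\<forall>v\<in>C - S. lam v x = 0"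
    then show "form_value S m c x = 0"
      using c[of x] assms(4)[of x] by simp
  qed
  then show ?thesis using c[OF assms(5)] by simp
qed

text \<open>On the facet opposite to \<open>v\<close> the coordinate \<open>lam v\<close> is zero, and only the monomials that do not
  contain it survive. If \<open>p\<close> vanishes there, these monomials are absent. Hence every monomial of the
  form contains all \<open>lam v\<close> with \<open>v\<close> in \<open>R\<close>, and all of them are split off at once. The degree \<open>m\<close> is
  positive because the facets of a single vertex are empty and impose nothing on a constant.\<close>

lemma polys_divisible_on_face:
  assumes S: "S \<subseteq> C" "S \<noteq> {}" and R: "R \<subseteq> S" and p: "p \<in> polys {..m}" and "0 < m"
    and zero: "\<And>v x. v \<in> R \<Longrightarrow> x \<in> convex hull (S - {v}) \<Longrightarrow> p x = 0"
  shows "\<exists>q\<in>polys {..m - card R}. \<forall>x. (\<forall>v\<in>C - S. lam v x = 0) \<longrightarrow> p x = (\<Prod>v\<in>R. lam v x) * q x"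
proof -
  have fin: "finite S" "finite R" using S R finite_subset_C by blast+
  obtain c where
    c: "\<And>x. \<forall>v\<in>C - S. lam v x = 0 \<Longrightarrow> p x = form_value S m c x"
    using polys_is_form[OF S(1) p] unfolding is_form_def by auto
  have c0: "c \<alpha> = 0" if \<alpha>: "\<alpha> \<in> multi_indices S m" "v \<in> R" "\<alpha> v = 0" for \<alpha> v
  proof (rule form_coefficients_eq_0[of "S - {v}" \<alpha> m])
    have "\<exists>w\<in>S. \<alpha> w \<noteq> 0" 
    proof (rule ccontr)
      assume "\<not> (\<exists>w\<in>S. \<alpha> w \<noteq> 0)"
      then have "sum \<alpha> S = 0" by (intro sum.neutral) auto
      then show False using \<alpha>(1) \<open>0 < m\<close> by (simp add: multi_indices_def)
    qed
    then show "S - {v} \<noteq> {}" using \<alpha>(3) by auto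
    have eq: "multi_indices (S - {v}) m = {\<beta> \<in> multi_indices S m. \<beta> v = 0}"
      using \<alpha>(2) R fin(1) by (auto simp: multi_indices_def sum.remove[of S v])
    then show "\<alpha> \<in> multi_indices (S - {v}) m" using \<alpha> by simp
    fix x assume x: "\<forall>w\<in>S - {v}. 0 < lam w x" "\<forall>w\<in>C - (S - {v}). lam w x = 0"
    have "S - {v} \<subseteq> C" using S(1) by auto
    then have "p x = 0"
      using x by (intro zero[OF \<alpha>(2)]) (simp add: mem_hull_iff less_imp_le)
    then have "0 = form_value S m c x"
      using c x by auto
    also have "\<dots> = (\<Sum>\<beta>\<in>multi_indices (S - {v}) m. c \<beta> * (\<Prod>w\<in>S. lam w x ^ \<beta> w))"
    proof (rule sum.mono_neutral_right)
      show "\<forall>\<beta>\<in>multi_indices S m - multi_indices (S - {v}) m. c \<beta> * (\<Prod>w\<in>S. lam w x ^ \<beta> w) = 0"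
      proof
        fix \<beta> assume "\<beta> \<in> multi_indices S m - multi_indices (S - {v}) m"
        then have "\<beta> v \<noteq> 0" using eq by auto
        then have "\<exists>w\<in>S. lam w x ^ \<beta> w = 0"
          using x(2) \<alpha>(2) R S(1) by (intro bexI[of _ v]) auto
        then show "c \<beta> * (\<Prod>w\<in>S. lam w x ^ \<beta> w) = 0" using fin(1) by auto
      qed
    qed (use fin eq in auto)
    also have "\<dots> = (\<Sum>\<beta>\<in>multi_indices (S - {v}) m. c \<beta> * (\<Prod>w\<in>S - {v}. lam w x ^ \<beta> w))"
      using \<alpha>(2) R fin(1) by (intro sum.cong) (auto simp: eq prod.remove[of S v])
    finally show "(\<Sum>\<beta>\<in>multi_indices (S - {v}) m. c \<beta> * (\<Prod>w\<in>S - {v}. lam w x ^ \<beta> w)) = 0" by simp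
  qed (use S in auto)
  define A where "A = {\<alpha> \<in> multi_indices S m. \<forall>v\<in>R. 0 < \<alpha> v}"
  define q where "q x = (\<Sum>\<alpha>\<in>A. c \<alpha> * (\<Prod>v\<in>S. lam v x ^ (\<alpha> v - (if v \<in> R then 1 else 0))))" for x
  have "q \<in> polys {..m - card R}"
    unfolding q_def
  proof (intro polys_sum polys_scale)
    fix \<alpha> assume \<alpha>: "\<alpha> \<in> A"
    have "(\<Sum>v\<in>S. \<alpha> v - (if v \<in> R then 1 else 0)) = (\<Sum>v\<in>S. \<alpha> v) - (\<Sum>v\<in>S. if v \<in> R then 1 else 0)"
      using \<alpha> by (intro sum_subtractf_nat) (auto simp: A_def)
    also have "\<dots> = m - card R"
      using \<alpha> R fin by (simp add: A_def multi_indices_def sum.If_cases Int_absorb1)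
    finally show "(\<lambda>x. \<Prod>v\<in>S. lam v x ^ (\<alpha> v - (if v \<in> R then 1 else 0))) \<in> polys {..m - card R}"
      using polys_prod_power_affine[of S lam "\<lambda>v. \<alpha> v - (if v \<in> R then 1 else 0)"] lam_polys S(1) by auto
  qed
  moreover have "p x = (\<Prod>v\<in>R. lam v x) * q x" if x: "\<forall>v\<in>C - S. lam v x = 0" for x
  proof -
    have "p x = (\<Sum>\<alpha>\<in>A. c \<alpha> * (\<Prod>v\<in>S. lam v x ^ \<alpha> v))"
      unfolding c[OF x] A_def using c0 fin by (intro sum.mono_neutral_right) auto
    also have "\<dots> = (\<Sum>\<alpha>\<in>A. (\<Prod>v\<in>R. lam v x) * (c \<alpha> * (\<Prod>v\<in>S. lam v x ^ (\<alpha> v - (if v \<in> R then 1 else 0)))))"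
    proof (rule sum.cong)
      fix \<alpha> assume \<alpha>: "\<alpha> \<in> A"
      have "(\<Prod>v\<in>S. lam v x ^ \<alpha> v)
          = (\<Prod>v\<in>S. (if v \<in> R then lam v x else 1) * lam v x ^ (\<alpha> v - (if v \<in> R then 1 else 0)))"
        using \<alpha> by (intro prod.cong) (auto simp: A_def power_eq_if)
      also have "\<dots> = (\<Prod>v\<in>R. lam v x) * (\<Prod>v\<in>S. lam v x ^ (\<alpha> v - (if v \<in> R then 1 else 0)))"
        using fin R by (simp add: prod.distrib prod.If_cases Int_absorb1)
      finally show "c \<alpha> * (\<Prod>v\<in>S. lam v x ^ \<alpha> v)
        = (\<Prod>v\<in>R. lam v x) * (c \<alpha> * (\<Prod>v\<in>S. lam v x ^ (\<alpha> v - (if v \<in> R then 1 else 0))))"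
        by (simp add: mult_ac)
    qed simp
    also have "\<dots> = (\<Prod>v\<in>R. lam v x) * q x"
      by (simp add: q_def sum_distrib_left)
    finally show ?thesis .
  qed
  ultimately show ?thesis by blast
qed

text \<open>The restrictions of the forms of degree \<open>m\<close> span the polynomials on the face. There are as many
  monomials of degree \<open>m\<close> in the \<open>l + 1\<close> barycentric coordinates as monomials of degree at most \<open>m\<close>
  in \<open>l\<close> variables.\<close>

lemma polys_on_face_span:
  assumes "S \<subseteq> C" "S \<noteq> {}"
  shows "\<exists>B. finite B \<and> card B \<le> (m + (card S - 1)) choose (card S - 1)
    \<and> polys_on m (convex hull S) \<subseteq> span B"
proof -
  have fin: "finite S" using assms(1) by (rule finite_subset_C)
  define b where "b \<alpha> x = (if x \<in> convex hull S then \<Prod>v\<in>S. lam v x ^ \<alpha> v else 0)" for \<alpha> x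
  let ?B = "b ` multi_indices S m"
  have "card ?B \<le> card (multi_indices S m)"
    using fin by (intro card_image_le) auto
  also have "\<dots> = (m + (card S - 1)) choose m"
    using fin assms(2) by (simp add: card_multi_indices Suc_le_eq card_gt_0_iff)
  also have "\<dots> = (m + (card S - 1)) choose (card S - 1)"
    using binomial_symmetric[of m "m + (card S - 1)"] by simp
  finally have "card ?B \<le> (m + (card S - 1)) choose (card S - 1)" .
  moreover have "polys_on m (convex hull S) \<subseteq> span ?B"
  proof
    fix g assume "g \<in> polys_on m (convex hull S)"
    then obtain p where p: "p \<in> polys {..m}" "g = (\<lambda>x. if x \<in> convex hull S then p x else 0)"
      by (auto simp: polys_on_def)
    obtain c where
      c: "\<And>x. \<forall>v\<in>C - S. lam v x = 0 \<Longrightarrow> p x = form_value S m c x"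
      using polys_is_form[OF assms(1) p(1)] unfolding is_form_def by auto
    have "g = (\<Sum>\<alpha>\<in>multi_indices S m. c \<alpha> *\<^sub>R b \<alpha>)"
    proof
      fix x
      show "g x = (\<Sum>\<alpha>\<in>multi_indices S m. c \<alpha> *\<^sub>R b \<alpha>) x"
        using c[of x] mem_hull_iff[OF assms(1), of x]
        by (cases "x \<in> convex hull S") (simp_all add: p(2) b_def sum_fun_apply scaleR_fun_apply)
    qed
    also have "\<dots> \<in> span ?B"
      by (intro span_sum span_scale span_base imageI)
    finally show "g \<in> span ?B" .
  qed
  moreover have "finite ?B" using fin by simp
  ultimately show ?thesis by (intro exI[of _ ?B] conjI)
qed

end

section \<open>Integration over faces\<close>

lemma integrable_continuous_compact_finite:
  fixes f :: "'a::euclidean_space \<Rightarrow> real"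
  assumes "sets M = sets borel" "compact F" "emeasure M F < \<infinity>" "continuous_on F f"
  shows "set_integrable M F f"
proof -
  obtain b where b: "\<And>x. x \<in> F \<Longrightarrow> norm (f x) \<le> b"
    using compact_imp_bounded[OF compact_continuous_image[OF assms(4,2)]]
    unfolding bounded_iff by auto
  have "(\<lambda>x. indicator F x *\<^sub>R f x) \<in> borel_measurable borel"
    using assms(2,4) by (intro borel_measurable_continuous_on_indicator borel_compact)
  then have "(\<lambda>x. indicator F x *\<^sub>R f x) \<in> borel_measurable M"
    by (subst measurable_cong_sets[OF assms(1) refl])
  moreover have "F \<in> sets M" unfolding assms(1) using assms(2) by (rule borel_compact)
  ultimately show ?thesis
    unfolding set_integrable_def using assms(3) b
    by (intro integrableI_bounded_set[where A = F and B = b]) auto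
qed

text \<open>This is used for the Lebesgue measure on the simplex and for the measures on its faces; what
  they share is that neighbourhoods of inner points have positive measure.\<close>

lemma integral_nonneg_eq_0_imp_eq_0:
  fixes f :: "'a::euclidean_space \<Rightarrow> real"
  assumes M: "sets M = sets borel" and F: "compact F" "emeasure M F < \<infinity>"
    and f: "continuous_on F f" "\<And>y. y \<in> F \<Longrightarrow> 0 \<le> f y" "(LINT y:F|M. f y) = 0"
    and x: "x \<in> F" "\<And>e. 0 < e \<Longrightarrow> emeasure M (ball x e \<inter> F) \<noteq> 0"
  shows "f x = 0"
proof (rule ccontr)
  assume "f x \<noteq> 0"
  then have pos: "0 < f x" using f(2)[OF x(1)] by simp
  obtain e where e: "0 < e" "\<And>y. y \<in> F \<Longrightarrow> dist y x < e \<Longrightarrow> dist (f y) (f x) < f x / 2"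
    using f(1)[unfolded continuous_on_iff, rule_format, OF x(1), of "f x / 2"] pos by auto
  define A where "A = ball x e \<inter> F"
  have FM: "F \<in> sets M" unfolding M using F(1) by (rule borel_compact)
  then have A: "A \<in> sets M" unfolding A_def by (intro sets.Int) (simp_all add: M)
  have fin: "emeasure M A < \<infinity>"
    using emeasure_mono[of A F M] F(2) FM by (auto simp: A_def)
  then have mpos: "0 < measure M A"
    using x(2)[OF e(1)] by (simp add: A_def measure_def enn2real_positive_iff zero_less_iff_neq_zero)
  have "measure M A * (f x / 2) = (\<integral>y. indicator A y * (f x / 2) \<partial>M)"
    using A by simp
  also have "\<dots> \<le> (\<integral>y. indicator F y *\<^sub>R f y \<partial>M)"
  proof (rule integral_mono)
    show "integrable M (\<lambda>y. indicator A y * (f x / 2))"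
      using A fin by (intro integrable_mult_left integrable_real_indicator)
    show "integrable M (\<lambda>y. indicator F y *\<^sub>R f y)"
      using integrable_continuous_compact_finite[OF M F f(1)] by (simp add: set_integrable_def)
    fix y
    have "f x / 2 \<le> f y" if "y \<in> A"
      using e(2)[of y] that pos by (auto simp: A_def dist_commute dist_real_def abs_if split: if_splits)
    then show "indicator A y * (f x / 2) \<le> indicator F y *\<^sub>R f y"
      using f(2)[of y] by (auto simp: indicator_def A_def)
  qed
  also have "\<dots> = 0" using f(3) by (simp add: set_lebesgue_integral_def)
  finally show False using mpos pos by (simp add: mult_le_0_iff)
qed

lemma flat_measure_parametrization:
  fixes F :: "(real^'n) set"
  assumes "F \<noteq> {}"
  shows "\<exists>B a. finite B \<and> pairwise orthogonal B \<and> (\<forall>b\<in>B. norm b = 1) \<and> span B = tangent_vectors F \<and> a \<in> F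
    \<and> flat_measure F = distr (\<Pi>\<^sub>M b\<in>B. lborel) borel (\<lambda>y. a + (\<Sum>b\<in>B. y b *\<^sub>R b))"
proof -
  define B where "B = (SOME B. pairwise orthogonal B \<and> (\<forall>b\<in>B. norm b = 1) \<and> span B = tangent_vectors F)"
  define a where "a = (SOME a. a \<in> F)"
  have "subspace (tangent_vectors F)" by (simp add: tangent_vectors_def)
  then obtain B0 where "B0 \<subseteq> tangent_vectors F" "pairwise orthogonal B0" "\<And>x. x \<in> B0 \<Longrightarrow> norm x = 1"
      "independent B0" "card B0 = dim (tangent_vectors F)" "span B0 = tangent_vectors F"
    by (rule orthonormal_basis_subspace) (rule that)
  then have "\<exists>B. pairwise orthogonal B \<and> (\<forall>b\<in>B. norm b = 1) \<and> span B = tangent_vectors F"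
    by (intro exI[of _ B0]) simp
  from someI_ex[OF this, folded B_def]
  have B: "pairwise orthogonal B" "\<forall>b\<in>B. norm b = 1" "span B = tangent_vectors F" by auto
  have "independent B"
    using B by (intro pairwise_orthogonal_independent) auto
  then have "finite B" by (rule independent_imp_finite)
  moreover have "a \<in> F" unfolding a_def using assms by (simp add: some_in_eq)
  moreover have "flat_measure F = distr (\<Pi>\<^sub>M b\<in>B. lborel) borel (\<lambda>y. a + (\<Sum>b\<in>B. y b *\<^sub>R b))"
    by (simp add: flat_measure_def B_def a_def Let_def)
  ultimately show ?thesis using B by (intro exI[of _ B] exI[of _ a]) simp
qed

lemma measurable_flat_parametrization:
  fixes B :: "(real^'n) set"
  shows "(\<lambda>y. a + (\<Sum>b\<in>B. y b *\<^sub>R b)) \<in> (\<Pi>\<^sub>M b\<in>B. lborel) \<rightarrow>\<^sub>M borel"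
proof -
  have "(\<lambda>y. y b) \<in> (\<Pi>\<^sub>M b\<in>B. lborel) \<rightarrow>\<^sub>M (borel :: real measure)" if "b \<in> B" for b
    using measurable_component_singleton[OF that, of "\<lambda>_. lborel :: real measure"] by simp
  then show ?thesis
    by (intro borel_measurable_add borel_measurable_sum borel_measurable_scaleR) auto
qed

lemma sets_flat_measure [simp]: "sets (flat_measure F) = sets borel"
  by (simp add: flat_measure_def Let_def)

lemma flat_measure_bounded_finite:
  fixes F :: "(real^'n) set"
  assumes "F \<noteq> {}" "bounded F" "F \<in> sets borel"
  shows "emeasure (flat_measure F) F < \<infinity>"
proof -
  obtain B a where B: "finite B" "pairwise orthogonal B" "\<forall>b\<in>B. norm b = 1" and a: "a \<in> F"
    and fm: "flat_measure F = distr (\<Pi>\<^sub>M b\<in>B. lborel) borel (\<lambda>y. a + (\<Sum>b\<in>B. y b *\<^sub>R b))"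
    using flat_measure_parametrization[OF assms(1)] by (elim exE conjE)
  obtain R where R: "\<And>x. x \<in> F \<Longrightarrow> norm (x - a) \<le> R"
    using assms(2) bounded_minus_comp[of "\<lambda>x. x" F "\<lambda>_. a"] unfolding bounded_iff by auto
  interpret P: product_sigma_finite "\<lambda>_ :: real^'n. lborel :: real measure" ..
  let ?M = "\<Pi>\<^sub>M b\<in>B. lborel :: real measure"
  let ?f = "\<lambda>y. a + (\<Sum>b\<in>B. y b *\<^sub>R b)"
  have coord: "(\<Sum>b\<in>B. y b *\<^sub>R b) \<bullet> c = y c" if "c \<in> B" for y :: "real^'n \<Rightarrow> real" and c
  proof -
    have "(\<Sum>b\<in>B. y b *\<^sub>R b) \<bullet> c = (\<Sum>b\<in>B. if b = c then y b else 0)"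
      unfolding inner_sum_left
      using B that by (intro sum.cong) (auto simp: pairwise_def orthogonal_def norm_eq_1)
    then show ?thesis using B(1) that by simp
  qed
  have "?f -` F \<inter> space ?M \<subseteq> PiE B (\<lambda>_. {-R..R})"
  proof
    fix y assume y: "y \<in> ?f -` F \<inter> space ?M"
    have "y c \<in> {-R..R}" if "c \<in> B" for c
    proof -
      have "\<bar>y c\<bar> \<le> norm (\<Sum>b\<in>B. y b *\<^sub>R b) * norm c"
        using Cauchy_Schwarz_ineq2[of "\<Sum>b\<in>B. y b *\<^sub>R b" c] coord[OF that, of y] by simp
      also have "\<dots> \<le> R" using R[of "?f y"] y B(3) that by simp
      finally show ?thesis by (auto simp: abs_le_iff)
    qed
    then show "y \<in> PiE B (\<lambda>_. {-R..R})"
      using y by (auto simp: space_PiM PiE_def)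
  qed
  moreover have "PiE B (\<lambda>_. {-R..R}) \<in> sets ?M"
    using B(1) by (intro sets_PiM_I_finite) auto
  ultimately have "emeasure ?M (?f -` F \<inter> space ?M) \<le> emeasure ?M (PiE B (\<lambda>_. {-R..R}))"
    by (intro emeasure_mono)
  also have "\<dots> = (\<Prod>b\<in>B. emeasure lborel {-R..R})"
    using B(1) by (intro P.emeasure_PiM) auto
  also have "\<dots> < \<infinity>"
    using B(1) by (auto simp: ennreal_prod_eq_top emeasure_lborel_Icc_eq less_top[symmetric] power_eq_top_ennreal)
  finally show ?thesis
    unfolding fm using assms(3) measurable_flat_parametrization[of a B]
    by (subst emeasure_distr) auto
qed

text \<open>A small cube around the coordinates of \<open>x\<close> in the orthonormal parametrization is mapped into \<open>A\<close>.\<close>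

lemma flat_measure_neighbourhood_nonzero:
  fixes F :: "(real^'n) set"
  assumes "x \<in> F" "0 < e" "A \<in> sets borel"
    and nbhd: "\<And>z. z - x \<in> tangent_vectors F \<Longrightarrow> norm (z - x) < e \<Longrightarrow> z \<in> A"
  shows "emeasure (flat_measure F) A \<noteq> 0"
proof -
  have "F \<noteq> {}" using assms(1) by auto
  from flat_measure_parametrization[OF this]
  obtain B a where B: "finite B" "pairwise orthogonal B" "\<forall>b\<in>B. norm b = 1"
      "span B = tangent_vectors F" and a: "a \<in> F"
    and fm: "flat_measure F = distr (\<Pi>\<^sub>M b\<in>B. lborel) borel (\<lambda>y. a + (\<Sum>b\<in>B. y b *\<^sub>R b))"
    by (elim exE conjE)
  interpret P: product_sigma_finite "\<lambda>_ :: real^'n. lborel :: real measure" ..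
  let ?M = "\<Pi>\<^sub>M b\<in>B. lborel :: real measure"
  let ?f = "\<lambda>y. a + (\<Sum>b\<in>B. y b *\<^sub>R b)"
  define \<delta> where "\<delta> = e / (real (card B) + 1)"
  have \<delta>: "0 < \<delta>" using assms(2) by (simp add: \<delta>_def)
  define c where "c b = (x - a) \<bullet> b" for b
  let ?Q = "PiE B (\<lambda>b. {c b - \<delta><..<c b + \<delta>})"
  have "x - a \<in> span B"
    unfolding B(4) tangent_vectors_def using assms(1) a by (intro span_base) auto
  then have xa: "(\<Sum>b\<in>B. c b *\<^sub>R b) = x - a"
    unfolding c_def using B by (intro orthonormal_basis_expand) auto
  have "?Q \<subseteq> ?f -` A \<inter> space ?M"
  proof
    fix y assume y: "y \<in> ?Q"
    have eq: "?f y - x = (\<Sum>b\<in>B. (y b - c b) *\<^sub>R b)"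
      using xa by (simp add: scaleR_diff_left sum_subtractf algebra_simps)
    have "norm (?f y - x) \<le> (\<Sum>b\<in>B. \<bar>y b - c b\<bar>)"
      unfolding eq using B(3) by (intro sum_norm_le) auto
    also have "\<dots> \<le> (\<Sum>b\<in>B. \<delta>)"
      using y by (intro sum_mono) (fastforce simp: PiE_def Pi_def abs_le_iff)
    also have "\<dots> < e" using assms(2) by (simp add: \<delta>_def field_simps)
    finally have "norm (?f y - x) < e" .
    moreover have "?f y - x \<in> tangent_vectors F"
      unfolding eq B(4)[symmetric] by (intro span_sum span_scale span_base)
    ultimately show "y \<in> ?f -` A \<inter> space ?M"
      using y nbhd by (auto simp: space_PiM PiE_def)
  qed
  moreover have "?f -` A \<inter> space ?M \<in> sets ?M"
    using measurable_flat_parametrization[of a B] assms(3) by (rule measurable_sets)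
  ultimately have "emeasure ?M ?Q \<le> emeasure ?M (?f -` A \<inter> space ?M)"
    by (intro emeasure_mono)
  also have "\<dots> = emeasure (flat_measure F) A"
    unfolding fm using assms(3) measurable_flat_parametrization[of a B]
    by (subst emeasure_distr) auto
  finally have "emeasure ?M ?Q \<le> emeasure (flat_measure F) A" .
  moreover have "emeasure ?M ?Q = (\<Prod>b\<in>B. emeasure lborel {c b - \<delta><..<c b + \<delta>})"
    using B(1) by (intro P.emeasure_PiM) auto
  moreover have "(\<Prod>b\<in>B. emeasure lborel {c b - \<delta><..<c b + \<delta>}) \<noteq> 0"
    using \<delta> by (simp add: prod_zero_iff B(1))
  ultimately show ?thesis by auto
qed

section \<open>Integration by parts for edge bubbles\<close>

lemma lborel_integral_translate:
  fixes f :: "real^'n \<Rightarrow> real"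
  assumes "f \<in> borel_measurable borel"
  shows "(\<integral>x. f (c + x) \<partial>lborel) = (\<integral>x. f x \<partial>lborel)"
    and "integrable lborel f \<Longrightarrow> integrable lborel (\<lambda>x. f (c + x))"
proof -
  have m: "(+) c \<in> lborel \<rightarrow>\<^sub>M (borel :: (real^'n) measure)" by simp
  show "(\<integral>x. f (c + x) \<partial>lborel) = (\<integral>x. f x \<partial>lborel)"
    using integral_distr[OF m assms] by (simp add: lborel_distr_plus)
  show "integrable lborel f \<Longrightarrow> integrable lborel (\<lambda>x. f (c + x))"
    using integrable_distr_eq[OF m assms] by (simp add: lborel_distr_plus)
qed

lemma AE_not_in_convex_frontier:
  fixes K :: "(real^'n) set"
  assumes "convex K"
  shows "AE x in lborel. x \<notin> frontier K"
proof -
  have "frontier K \<in> null_sets lborel"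
    using negligible_convex_frontier[OF assms]
    by (auto simp: negligible_iff_null_sets null_sets_completion_iff)
  then show ?thesis by (rule AE_not_in)
qed

context simplex_coords
begin

lemma lam_along_edge:
  assumes "v \<in> C" "u \<in> C" "w \<in> C"
  shows "lam v (x + s *\<^sub>R (u - w))
    = lam v x + s * ((if v = u then 1 else 0) - (if v = w then 1 else 0))"
proof -
  have "lam v (x + s *\<^sub>R (u - w)) = lam v 0 + grd v \<bullet> (x + s *\<^sub>R (u - w))"
    by (rule lam_affine[OF assms(1)])
  also have "\<dots> = (lam v 0 + grd v \<bullet> x) + s * ((lam v 0 + grd v \<bullet> u) - (lam v 0 + grd v \<bullet> w))"
    by (simp add: inner_add_right inner_diff_right algebra_simps)
  also have "\<dots> = lam v x + s * (lam v u - lam v w)"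
    by (simp only: lam_affine[OF assms(1), symmetric])
  finally show ?thesis using assms by (simp add: lam_vertex)
qed

lemma compact_hull_C [simp]: "compact (convex hull C)"
  by (simp add: finite_imp_compact_convex_hull)

text \<open>Let \<open>G\<close> be the extension by zero of \<open>g = lam u * lam w * p\<close>. Its difference quotients in
  the direction of the edge from \<open>w\<close> to \<open>u\<close> have integral zero by translation invariance. They are
  bounded: inside the simplex by the derivative of \<open>g\<close>, and for a step that crosses the boundary
  because one of \<open>lam u\<close>, \<open>lam w\<close> is then at most the size of the step. So dominated convergence
  applies.\<close>

lemma integral_dir_deriv_edge_bubble:
  assumes u: "u \<in> C" and w: "w \<in> C" and "u \<noteq> w" and p: "p \<in> polys {..m}"
  shows "(LINT x:convex hull C|lborel. dir_deriv (u - w) (\<lambda>x. lam u x * lam w x * p x) x) = 0"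
proof -
  define K where "K = convex hull C"
  define t where "t = u - w"
  define g where "g x = lam u x * lam w x * p x" for x
  define G where "G x = indicator K x *\<^sub>R g x" for x
  define h where "h k = 1 / (real k + 1)" for k
  define \<Delta> where "\<Delta> k x = (G (h k *\<^sub>R t + x) - G x) / h k" for k x
  have K: "compact K" "convex K" "K \<in> sets borel" "closed K"
    unfolding K_def by (simp_all add: compact_imp_closed borel_compact)
  have memK: "x \<in> K \<longleftrightarrow> (\<forall>v\<in>C. 0 \<le> lam v x)" for x
    by (simp add: K_def mem_hull_iff)
  have le1: "lam v x \<le> 1" if "x \<in> K" "v \<in> C" for v x
    using member_le_sum[of v C "\<lambda>v. lam v x"] that memK[of x] by (simp add: lam_sum)
  have h: "0 < h k" "h k \<le> 1" for k by (auto simp: h_def)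
  have g: "g \<in> polys {..2 + m}"
    unfolding g_def using polys_mult[OF polys_mult[OF lam_polys[OF u] lam_polys[OF w]] p]
    by (simp add: numeral_2_eq_2)
  have cont: "continuous_on S g" "continuous_on S p" "continuous_on S (dir_deriv t g)" for S
    using g p polys_dir_deriv_le[OF g] by (auto intro: polys_continuous)
  obtain M1 where M1: "\<And>x. x \<in> K \<Longrightarrow> \<bar>dir_deriv t g x\<bar> \<le> M1"
    using compact_imp_bounded[OF compact_continuous_image[OF cont(3) K(1)]]
    unfolding bounded_iff by auto
  obtain M2 where M2: "\<And>x. x \<in> K \<Longrightarrow> \<bar>p x\<bar> \<le> M2"
    using compact_imp_bounded[OF compact_continuous_image[OF cont(2) K(1)]]
    unfolding bounded_iff by auto
  define M where "M = max 0 (max M1 M2)"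
  have small: "\<bar>g x\<bar> \<le> M * s" if x: "x \<in> K" and s: "lam u x \<le> s \<or> lam w x \<le> s" and "0 \<le> s" for x s
  proof -
    have "0 \<le> lam u x" "lam u x \<le> 1" "0 \<le> lam w x" "lam w x \<le> 1"
      using x u w memK le1 by auto
    then have "lam u x * lam w x \<le> s"
      using s \<open>0 \<le> s\<close> mult_left_le[of "lam u x" "lam w x"] mult_left_le[of "lam w x" "lam u x"]
      by (auto simp: mult.commute)
    moreover have "\<bar>p x\<bar> \<le> M" using M2[OF x] by (simp add: M_def)
    ultimately have "(lam u x * lam w x) * \<bar>p x\<bar> \<le> s * M"
      using \<open>0 \<le> lam u x\<close> \<open>0 \<le> lam w x\<close> \<open>0 \<le> s\<close> by (intro mult_mono) auto
    then show ?thesis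
      using \<open>0 \<le> lam u x\<close> \<open>0 \<le> lam w x\<close> by (simp add: g_def abs_mult mult.commute)
  qed
  have lip: "\<bar>G (s *\<^sub>R t + x) - G x\<bar> \<le> M * s" if s: "0 < s" for s x
  proof -
    let ?y = "s *\<^sub>R t + x"
    have lamy: "lam v ?y = lam v x + s * ((if v = u then 1 else 0) - (if v = w then 1 else 0))"
      if "v \<in> C" for v
      using lam_along_edge[OF that u w, of x s] by (simp add: t_def add.commute)
    consider "x \<in> K" "?y \<in> K" | "x \<in> K" "?y \<notin> K" | "x \<notin> K" "?y \<in> K" | "x \<notin> K" "?y \<notin> K" by blast
    then show ?thesis
    proof cases
      case 1
      have "\<exists>z>0. z < s \<and> g (x + s *\<^sub>R t) - g (x + 0 *\<^sub>R t) = (s - 0) * dir_deriv t g (x + z *\<^sub>R t)"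
        by (rule MVT2[OF s]) (rule dir_deriv_line[OF g])
      then obtain z where z: "0 < z" "z < s" "g ?y - g x = s * dir_deriv t g (x + z *\<^sub>R t)"
        by (auto simp: add.commute)
      \<comment> \<open>the intermediate point lies in the simplex by convexity\<close>
      have "x + z *\<^sub>R t = (1 - z / s) *\<^sub>R x + (z / s) *\<^sub>R ?y"
        using s by (simp add: algebra_simps)
      also have "\<dots> \<in> K"
        using K(2) 1 z(1,2) s by (intro convexD_alt) auto
      finally have "\<bar>dir_deriv t g (x + z *\<^sub>R t)\<bar> \<le> M" using M1 by (force simp: M_def)
      then show ?thesis using 1 z(3) s by (simp add: G_def abs_mult mult.commute)
    next
      case 2
      then obtain v where v: "v \<in> C" "lam v ?y < 0" using memK by force
      \<comment> \<open>moving in direction \<open>t\<close>, only \<open>lam w\<close> decreases, so it is \<open>lam w\<close> that has become negative\<close>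
      then have "lam v x - s < 0 \<and> v = w"
        using lamy[OF v(1)] s 2 memK[of x] by (auto split: if_splits)
      then have "\<bar>g x\<bar> \<le> M * s" using 2 s by (intro small) auto
      then show ?thesis using 2 by (simp add: G_def)
    next
      case 3
      then obtain v where v: "v \<in> C" "lam v x < 0" using memK by force
      then have "v = u \<and> lam u ?y \<le> s"
        using lamy[OF v(1)] lamy[OF u] s 3 memK[of ?y] \<open>u \<noteq> w\<close> by (auto split: if_splits)
      then have "\<bar>g ?y\<bar> \<le> M * s" using 3 s by (intro small) auto
      then show ?thesis using 3 by (simp add: G_def)
    next
      case 4
      then show ?thesis using s by (simp add: G_def M_def)
    qed
  qed
  have Gmeas: "G \<in> borel_measurable borel"
    unfolding G_def using K cont by (intro borel_measurable_continuous_on_indicator) auto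
  have Gint: "integrable lborel G"
    unfolding G_def using K cont by (intro borel_integrable_compact)
  obtain R where R: "\<And>x. x \<in> K \<Longrightarrow> norm x \<le> R"
    using compact_imp_bounded[OF K(1)] unfolding bounded_iff by auto
  define D where "D = cball (0 :: real^'n) (R + norm t)"
  have supp: "G x = 0 \<and> G (h k *\<^sub>R t + x) = 0" if "x \<notin> D" for k x
  proof -
    have n: "R + norm t < norm x" using that by (simp add: D_def)
    moreover have "0 \<le> norm t" by simp
    moreover have "norm x \<le> norm (h k *\<^sub>R t + x) + norm t"
    proof -
      have "norm x = norm ((h k *\<^sub>R t + x) - h k *\<^sub>R t)" by simp
      also have "\<dots> \<le> norm (h k *\<^sub>R t + x) + norm (h k *\<^sub>R t)" by (rule norm_triangle_ineq4)
      also have "norm (h k *\<^sub>R t) \<le> norm t"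
        using h[of k] by (simp add: mult_left_le_one_le)
      finally show ?thesis by simp
    qed
    ultimately have "x \<notin> K" "h k *\<^sub>R t + x \<notin> K"
      using R[of x] R[of "h k *\<^sub>R t + x"] by linarith+
    then show ?thesis by (simp add: G_def)
  qed
  have int0: "(\<integral>x. \<Delta> k x \<partial>lborel) = 0" for k
    unfolding \<Delta>_def
    using lborel_integral_translate[OF Gmeas, of "h k *\<^sub>R t"] Gint by simp
  have "(\<lambda>k. \<integral>x. \<Delta> k x \<partial>lborel) \<longlonglongrightarrow> (\<integral>x. indicator K x *\<^sub>R dir_deriv t g x \<partial>lborel)"
  proof (rule integral_dominated_convergence)
    show "(\<lambda>x. indicator K x *\<^sub>R dir_deriv t g x) \<in> borel_measurable lborel"
      using borel_measurable_continuous_on_indicator[OF K(3) cont(3)] by simp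
    show "\<Delta> k \<in> borel_measurable lborel" for k
      unfolding \<Delta>_def using Gmeas by measurable
    show "integrable lborel (\<lambda>x. indicator D x *\<^sub>R M)"
      by (intro borel_integrable_compact) (auto simp: D_def)
    show "AE x in lborel. norm (\<Delta> k x) \<le> indicator D x *\<^sub>R M" for k
    proof (rule AE_I2)
      fix x
      show "norm (\<Delta> k x) \<le> indicator D x *\<^sub>R M"
      proof (cases "x \<in> D")
        case True
        have "\<bar>\<Delta> k x\<bar> = \<bar>G (h k *\<^sub>R t + x) - G x\<bar> / h k"
          using h(1)[of k] by (simp add: \<Delta>_def)
        also have "\<dots> \<le> M"
          using lip[OF h(1)[of k], of x] h(1)[of k] by (simp add: pos_divide_le_eq)
        finally show ?thesis using True by simp
      next
        case False
        then show ?thesis using supp[OF False, of k] by (simp add: \<Delta>_def)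
      qed
    qed
    have hlim: "h \<longlonglongrightarrow> 0"
      unfolding h_def using LIMSEQ_inverse_real_of_nat by (simp add: inverse_eq_divide add.commute)
    then have shift: "(\<lambda>k. h k *\<^sub>R t + x) \<longlonglongrightarrow> x" for x
      by (auto intro!: tendsto_eq_intros)
    show "AE x in lborel. (\<lambda>k. \<Delta> k x) \<longlonglongrightarrow> indicator K x *\<^sub>R dir_deriv t g x"
      using AE_not_in_convex_frontier[OF K(2)]
    proof (rule AE_mp, intro AE_I2 impI)
      fix x assume "x \<notin> frontier K"
      then consider "x \<in> interior K" | "x \<notin> K"
        using K(4) by (auto simp: frontier_def closure_closed)
      then show "(\<lambda>k. \<Delta> k x) \<longlonglongrightarrow> indicator K x *\<^sub>R dir_deriv t g x"
      proof cases
        case 1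
        have "((\<lambda>s. g (x + s *\<^sub>R t)) has_real_derivative dir_deriv t g x) (at 0)"
          using dir_deriv_line[OF g, of x t 0] by simp
        then have "((\<lambda>s. (g (x + s *\<^sub>R t) - g x) / s) \<longlongrightarrow> dir_deriv t g x) (at 0)"
          by (simp add: has_field_derivative_iff)
        moreover have "filterlim h (at 0) sequentially"
          using hlim h(1) by (auto simp: filterlim_at intro!: always_eventually) (metis less_irrefl)
        ultimately have "(\<lambda>k. (g (x + h k *\<^sub>R t) - g x) / h k) \<longlonglongrightarrow> dir_deriv t g x"
          by (rule filterlim_compose)
        moreover have "\<forall>\<^sub>F k in sequentially. (g (x + h k *\<^sub>R t) - g x) / h k = \<Delta> k x"
        proof -
          have "\<forall>\<^sub>F k in sequentially. h k *\<^sub>R t + x \<in> interior K"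
            using shift[of x] 1 open_interior topological_tendstoD by blast
          then show ?thesis
          proof eventually_elim
            case (elim k)
            then have "h k *\<^sub>R t + x \<in> K" "x \<in> K" using 1 interior_subset by auto
            then show ?case by (simp add: \<Delta>_def G_def add.commute)
          qed
        qed
        ultimately have "(\<lambda>k. \<Delta> k x) \<longlonglongrightarrow> dir_deriv t g x"
          by (rule Lim_transform_eventually)
        moreover have "x \<in> K" using 1 interior_subset by auto
        ultimately show ?thesis by simp
      next
        case 2
        have "\<forall>\<^sub>F k in sequentially. h k *\<^sub>R t + x \<in> - K"
          using shift[of x] 2 K(4) topological_tendstoD[of _ x sequentially "- K"] by (auto simp: open_Compl)
        then have "\<forall>\<^sub>F k in sequentially. 0 = \<Delta> k x"
        proof eventually_elim
          case (elim k)
          then show ?case using 2 by (simp add: \<Delta>_def G_def)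
        qed
        then show ?thesis using 2 by (simp add: tendsto_eventually eventually_mono)
      qed
    qed
  qed
  then have "(\<lambda>k :: nat. 0) \<longlonglongrightarrow> (\<integral>x. indicator K x *\<^sub>R dir_deriv t g x \<partial>lborel)"
    by (simp only: int0)
  then have "(\<integral>x. indicator K x *\<^sub>R dir_deriv t g x \<partial>lborel) = 0"
    by (simp add: LIMSEQ_const_iff)
  then show ?thesis
    unfolding set_lebesgue_integral_def K_def t_def g_def[abs_def] .
qed

end

section \<open>Symmetric matrices and the edges of the simplex\<close>

lemma strict_unordered_pairs_exist:
  assumes "finite N"
  shows "\<exists>P \<subseteq> N \<times> N. card P = card N choose 2
    \<and> (\<forall>a\<in>N. \<forall>b\<in>N. a \<noteq> b \<longrightarrow> (a, b) \<in> P \<or> (b, a) \<in> P)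
    \<and> (\<forall>a b. (a, b) \<in> P \<longrightarrow> (b, a) \<notin> P)"
proof -
  from unordered_pairs_exist[OF assms]
  obtain P where P: "P \<subseteq> N \<times> N" "card P = (card N + 1) choose 2"
    "\<forall>a\<in>N. \<forall>b\<in>N. (a, b) \<in> P \<or> (b, a) \<in> P" "\<forall>a b. (a, b) \<in> P \<and> (b, a) \<in> P \<longrightarrow> a = b"
    by (elim exE conjE)
  let ?D = "(\<lambda>a. (a, a)) ` N"
  have D: "?D \<subseteq> P" using P(3) by auto
  have "finite P" using P(1) assms by (simp add: finite_subset)
  then have "card (P - ?D) = card P - card ?D"
    using D assms by (simp add: card_Diff_subset)
  also have "card ?D = card N" by (simp add: card_image inj_on_def)
  finally have "card (P - ?D) = card N choose 2"
    using P(2) by (simp add: numeral_2_eq_2)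
  then show ?thesis
    using P(1,3,4) by (intro exI[of _ "P - ?D"]) auto
qed

context simplex_coords
begin

lemma grd_inner: "v \<in> C \<Longrightarrow> grd v \<bullet> x = lam v x - lam v 0"
  using lam_affine[of v x] by simp

lemma grd_inner_diff: "v \<in> C \<Longrightarrow> grd v \<bullet> (x - y) = lam v x - lam v y"
  by (simp add: inner_diff_right grd_inner)

lemma sum_grd: "(\<Sum>v\<in>C. grd v \<bullet> y) = 0"
  by (simp add: grd_inner sum_subtractf lam_sum)

lemma grd_expand: "(\<Sum>v\<in>C. (grd v \<bullet> y) *\<^sub>R v) = y"
  by (simp add: grd_inner scaleR_diff_left sum_subtractf lam_point)

text \<open>The vertices and the gradients are dual frames: this is the transpose of \<open>grd_expand\<close>.\<close>

lemma vertex_expand: "(\<Sum>v\<in>C. (v \<bullet> y) *\<^sub>R grd v) = y"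
proof -
  have "(\<Sum>v\<in>C. (v \<bullet> y) *\<^sub>R grd v) \<bullet> z = y \<bullet> z" for z
  proof -
    have "(\<Sum>v\<in>C. (v \<bullet> y) *\<^sub>R grd v) \<bullet> z = y \<bullet> (\<Sum>v\<in>C. (grd v \<bullet> z) *\<^sub>R v)"
      by (simp add: inner_sum_left inner_sum_right inner_commute mult.commute)
    then show ?thesis by (simp add: grd_expand)
  qed
  then show ?thesis using vector_eq_rdot by blast
qed

definition edges :: "((real^'n) \<times> (real^'n)) set"
  where "edges = (SOME P. P \<subseteq> C \<times> C \<and> card P = card C choose 2
    \<and> (\<forall>a\<in>C. \<forall>b\<in>C. a \<noteq> b \<longrightarrow> (a, b) \<in> P \<or> (b, a) \<in> P)
    \<and> (\<forall>a b. (a, b) \<in> P \<longrightarrow> (b, a) \<notin> P))"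

lemma edges: "edges \<subseteq> C \<times> C" "card edges = (CARD('n) + 1) choose 2"
  "u \<in> C \<Longrightarrow> w \<in> C \<Longrightarrow> u \<noteq> w \<Longrightarrow> (u, w) \<in> edges \<or> (w, u) \<in> edges"
  "(u, w) \<in> edges \<Longrightarrow> (w, u) \<notin> edges"
proof -
  have *: "edges \<subseteq> C \<times> C \<and> card edges = card C choose 2
    \<and> (\<forall>a\<in>C. \<forall>b\<in>C. a \<noteq> b \<longrightarrow> (a, b) \<in> edges \<or> (b, a) \<in> edges)
    \<and> (\<forall>a b. (a, b) \<in> edges \<longrightarrow> (b, a) \<notin> edges)"
    using someI_ex[OF strict_unordered_pairs_exist[OF finite_C], folded edges_def] .
  then show "edges \<subseteq> C \<times> C" "card edges = (CARD('n) + 1) choose 2" by (auto simp: card_C)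
  show "u \<in> C \<Longrightarrow> w \<in> C \<Longrightarrow> u \<noteq> w \<Longrightarrow> (u, w) \<in> edges \<or> (w, u) \<in> edges" using * by simp
  show "(u, w) \<in> edges \<Longrightarrow> (w, u) \<notin> edges" using * by simp
qed

lemma finite_edges [simp]: "finite edges"
  by (rule finite_subset[OF edges(1)]) simp

lemma edge_endpoints: "(u, w) \<in> edges \<Longrightarrow> u \<in> C \<and> w \<in> C \<and> u \<noteq> w"
  using edges(1) edges(4)[of u w] by auto

text \<open>Summation by parts: since the rows of \<open>a\<close> sum to zero, \<open>b\<close> may be replaced by its second
  differences along the edges.\<close>

lemma sum_by_edges:
  fixes a b :: "real^'n \<Rightarrow> real^'n \<Rightarrow> real"
  assumes sym: "\<And>u w. u \<in> C \<Longrightarrow> w \<in> C \<Longrightarrow> a u w = a w u"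
    and row: "\<And>u. u \<in> C \<Longrightarrow> (\<Sum>w\<in>C. a u w) = 0"
  shows "(\<Sum>u\<in>C. \<Sum>w\<in>C. a u w * b u w)
    = - (\<Sum>(u, w)\<in>edges. a u w * (b u u - b u w - b w u + b w w))"
proof -
  define f where "f = (\<lambda>(u, w). a u w * (b u u - b u w - b w u + b w w))"
  have fsym: "f (u, w) = f (w, u)" if "u \<in> C" "w \<in> C" for u w
    using sym[OF that] by (simp add: f_def)
  have eq: "C \<times> C = (edges \<union> prod.swap ` edges) \<union> (\<lambda>a. (a, a)) ` C"
  proof
    show "C \<times> C \<subseteq> (edges \<union> prod.swap ` edges) \<union> (\<lambda>a. (a, a)) ` C"
    proof
      fix e assume "e \<in> C \<times> C"
      then obtain u w where e: "e = (u, w)" "u \<in> C" "w \<in> C" by auto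
      show "e \<in> (edges \<union> prod.swap ` edges) \<union> (\<lambda>a. (a, a)) ` C"
      proof (cases "u = w")
        case False
        then show ?thesis
          using edges(3)[OF e(2,3) False] e(1) image_eqI[of "(u, w)" prod.swap "(w, u)" edges] by auto
      qed (use e in auto)
    qed
  qed (use edges(1) in auto)
  have "(\<Sum>e\<in>C \<times> C. f e) = (\<Sum>e\<in>edges \<union> prod.swap ` edges. f e) + (\<Sum>e\<in>(\<lambda>a. (a, a)) ` C. f e)"
    unfolding eq using edge_endpoints by (intro sum.union_disjoint) auto
  also have "(\<Sum>e\<in>(\<lambda>a. (a, a)) ` C. f e) = 0"
    by (intro sum.neutral) (auto simp: f_def)
  also have "(\<Sum>e\<in>edges \<union> prod.swap ` edges. f e) = (\<Sum>e\<in>edges. f e) + (\<Sum>e\<in>prod.swap ` edges. f e)"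
    using edges(4) by (intro sum.union_disjoint) auto
  also have "(\<Sum>e\<in>prod.swap ` edges. f e) = (\<Sum>e\<in>edges. f (prod.swap e))"
    by (subst sum.reindex) (auto simp: inj_on_def)
  also have "\<dots> = (\<Sum>e\<in>edges. f e)"
    using fsym edge_endpoints by (intro sum.cong) auto
  finally have 1: "(\<Sum>u\<in>C. \<Sum>w\<in>C. f (u, w)) = 2 * (\<Sum>e\<in>edges. f e)"
    by (simp add: sum.cartesian_product)
  have 2: "(\<Sum>u\<in>C. \<Sum>w\<in>C. a u w * b u u) = 0"
    by (simp add: sum_distrib_right[symmetric] row)
  have 3: "(\<Sum>u\<in>C. \<Sum>w\<in>C. a u w * b w w) = 0"
  proof -
    have "(\<Sum>u\<in>C. \<Sum>w\<in>C. a u w * b w w) = (\<Sum>w\<in>C. \<Sum>u\<in>C. a w u * b w w)"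
      by (subst sum.swap) (intro sum.cong refl, use sym in simp)
    then show ?thesis by (simp add: sum_distrib_right[symmetric] row)
  qed
  have 4: "(\<Sum>u\<in>C. \<Sum>w\<in>C. a u w * b w u) = (\<Sum>u\<in>C. \<Sum>w\<in>C. a u w * b u w)"
    by (subst sum.swap) (intro sum.cong refl, use sym in simp)
  have "(\<Sum>u\<in>C. \<Sum>w\<in>C. f (u, w)) = (\<Sum>u\<in>C. \<Sum>w\<in>C. a u w * b u u)
      - (\<Sum>u\<in>C. \<Sum>w\<in>C. a u w * b u w) - (\<Sum>u\<in>C. \<Sum>w\<in>C. a u w * b w u)
      + (\<Sum>u\<in>C. \<Sum>w\<in>C. a u w * b w w)"
    unfolding f_def by (simp add: algebra_simps sum.distrib sum_subtractf)
  then have "2 * (\<Sum>e\<in>edges. f e) = - 2 * (\<Sum>u\<in>C. \<Sum>w\<in>C. a u w * b u w)"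
    unfolding 1 2 3 4 by simp
  then show ?thesis by (simp add: f_def)
qed

text \<open>The matrices \<open>t t\<^sup>T\<close> with \<open>t\<close> an edge form a basis of the symmetric matrices. The coefficients
  come from summation by parts, applied to the expansion of \<open>A\<close> in the gradients, whose
  coefficient matrix has zero row sums because the gradients add up to zero.\<close>

lemma symmetric_matrix_edge_expansion:
  fixes A :: "real^'n^'n"
  assumes "transpose A = A"
  shows "A $ i $ j = (\<Sum>(u, w)\<in>edges. - (grd u \<bullet> (A *v grd w)) * ((u - w) $ i * (u - w) $ j))"
proof -
  define a where "a u w = grd u \<bullet> (A *v grd w)" for u w
  have sym: "a u w = a w u" for u w
    unfolding a_def using assms by (metis dot_lmul_matrix inner_commute vector_transpose_matrix)
  have row: "(\<Sum>w\<in>C. a u w) = 0" for u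
  proof -
    have "(\<Sum>w\<in>C. a u w) = (\<Sum>w\<in>C. grd w \<bullet> (A *v grd u))"
      by (subst sym) (simp add: a_def)
    then show ?thesis by (simp add: sum_grd)
  qed
  have comp: "(\<Sum>w\<in>C. w $ k *\<^sub>R grd w) = axis k 1" for k
    using vertex_expand[of "axis k 1"] by (simp add: inner_axis)
  have "A $ i $ j = axis i 1 \<bullet> (A *v axis j 1)"
    by (simp add: inner_axis' matrix_vector_mul_component inner_axis)
  also have "\<dots> = (\<Sum>u\<in>C. u $ i *\<^sub>R grd u) \<bullet> (A *v (\<Sum>w\<in>C. w $ j *\<^sub>R grd w))"
    by (simp add: comp)
  also have "A *v (\<Sum>w\<in>C. w $ j *\<^sub>R grd w) = (\<Sum>w\<in>C. w $ j *\<^sub>R (A *v grd w))"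
    by (simp add: linear_sum[OF matrix_vector_mul_linear] linear_scale[OF matrix_vector_mul_linear])
  also have "(\<Sum>u\<in>C. u $ i *\<^sub>R grd u) \<bullet> \<dots> = (\<Sum>u\<in>C. \<Sum>w\<in>C. a u w * (u $ i * w $ j))"
    unfolding inner_sum_left inner_sum_right
    by (simp add: a_def) (rule trans[OF sum.swap], simp add: mult_ac)
  also have "\<dots> = - (\<Sum>(u, w)\<in>edges. a u w * (u $ i * u $ j - u $ i * w $ j - w $ i * u $ j + w $ i * w $ j))"
    by (rule sum_by_edges) (use sym row in auto)
  also have "\<dots> = (\<Sum>(u, w)\<in>edges. - a u w * ((u - w) $ i * (u - w) $ j))"
    by (simp add: sum_negf[symmetric] case_prod_unfold algebra_simps)
  finally show ?thesis by (simp add: a_def)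
qed

section \<open>Bubble fields\<close>

text \<open>The field \<open>\<Sum>e. p e t\<^sub>e t\<^sub>e\<^sup>T\<close>, where \<open>t\<^sub>e\<close> is the direction of the edge \<open>e\<close>.\<close>

definition edge_field :: "((real^'n) \<times> (real^'n) \<Rightarrow> real^'n \<Rightarrow> real) \<Rightarrow> real^'n \<Rightarrow> real^'n^'n"
  where "edge_field p x = (\<chi> i j. \<Sum>e\<in>edges. p e x * ((fst e - snd e) $ i * (fst e - snd e) $ j))"

text \<open>The normal vector of each facet is represented by the gradient of the opposite vertex.\<close>

definition bubbles :: "(real^'n \<Rightarrow> real^'n^'n) set"
  where "bubbles = {\<tau> \<in> sym_polys {..CARD('n) + 1}.
    \<forall>u\<in>C. \<forall>x\<in>convex hull (C - {u}). \<tau> x *v grd u = 0}"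

definition edge_bubble :: "(real^'n) \<times> (real^'n) \<Rightarrow> real^'n \<Rightarrow> real"
  where "edge_bubble e x = lam (fst e) x * lam (snd e) x"

lemma edge_bubble_polys: "e \<in> edges \<Longrightarrow> edge_bubble e \<in> polys {..2}"
  using polys_mult[OF lam_polys lam_polys, of "fst e" "snd e"] edge_endpoints[of "fst e" "snd e"]
  by (simp add: edge_bubble_def[abs_def] numeral_2_eq_2)

text \<open>The coefficient of \<open>\<tau>\<close> at the edge from \<open>w\<close> to \<open>u\<close> is \<open>- grd u \<bullet> (\<tau> *v grd w)\<close>. It vanishes on
  the two facets opposite to \<open>u\<close> and \<open>w\<close> and is therefore divisible by \<open>lam u * lam w\<close>.\<close>

lemma bubbles_representation:
  assumes "\<tau> \<in> bubbles"
  shows "\<exists>q. (\<forall>e\<in>edges. q e \<in> polys {..CARD('n) - 1})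
    \<and> \<tau> = edge_field (\<lambda>e x. edge_bubble e x * q e x)"
proof -
  have \<tau>: "\<And>x. transpose (\<tau> x) = \<tau> x" "\<And>i j. (\<lambda>x. \<tau> x $ i $ j) \<in> polys {..CARD('n) + 1}"
    and bdry: "\<And>u x. u \<in> C \<Longrightarrow> x \<in> convex hull (C - {u}) \<Longrightarrow> \<tau> x *v grd u = 0"
    using assms by (auto simp: bubbles_def sym_polys_def)
  define p where "p e x = - (grd (fst e) \<bullet> (\<tau> x *v grd (snd e)))" for e x
  have p: "p e \<in> polys {..CARD('n) + 1}" for e
  proof -
    have "p e = (\<lambda>x. -1 * (\<Sum>i\<in>UNIV. grd (fst e) $ i * (\<Sum>j\<in>UNIV. grd (snd e) $ j * \<tau> x $ i $ j)))"
      by (simp add: p_def[abs_def] inner_vec_def matrix_vector_mult_def mult.commute)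
    also have "\<dots> \<in> polys {..CARD('n) + 1}"
      by (intro polys_scale polys_sum \<tau>(2))
    finally show ?thesis .
  qed
  have "\<exists>q\<in>polys {..CARD('n) - 1}. \<forall>x. p e x = edge_bubble e x * q x" if e: "e \<in> edges" for e
  proof -
    obtain u w where uw: "e = (u, w)" "u \<in> C" "w \<in> C" "u \<noteq> w"
      using edge_endpoints[of "fst e" "snd e"] e by (cases e) auto
    have "\<exists>q\<in>polys {..CARD('n) + 1 - card {u, w}}. \<forall>x. (\<forall>v\<in>C - C. lam v x = 0) \<longrightarrow>
        p e x = (\<Prod>v\<in>{u, w}. lam v x) * q x"
    proof (rule polys_divisible_on_face)
      fix v x assume v: "v \<in> {u, w}" and x: "x \<in> convex hull (C - {v})"
      have "\<tau> x *v grd v = 0" using v x uw by (intro bdry) auto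
      moreover have "grd u \<bullet> (\<tau> x *v grd w) = grd w \<bullet> (\<tau> x *v grd u)"
        using \<tau>(1)[of x] by (metis dot_lmul_matrix inner_commute vector_transpose_matrix)
      ultimately show "p e x = 0" using v uw by (auto simp: p_def)
    qed (use p uw card_C in auto)
    then show ?thesis using uw by (simp add: edge_bubble_def)
  qed
  then have "\<forall>e\<in>edges. \<exists>q. q \<in> polys {..CARD('n) - 1} \<and> (\<forall>x. p e x = edge_bubble e x * q x)" by blast
  from bchoice[OF this] obtain q where
    q: "\<forall>e\<in>edges. q e \<in> polys {..CARD('n) - 1} \<and> (\<forall>x. p e x = edge_bubble e x * q e x)"
    by (elim exE)
  have "\<tau> = edge_field (\<lambda>e x. edge_bubble e x * q e x)"
  proof (intro ext)
    fix x
    have "\<tau> x $ i $ j = edge_field (\<lambda>e x. edge_bubble e x * q e x) x $ i $ j" for i j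
    proof -
      have "\<tau> x $ i $ j = (\<Sum>e\<in>edges. p e x * ((fst e - snd e) $ i * (fst e - snd e) $ j))"
        unfolding symmetric_matrix_edge_expansion[OF \<tau>(1), of x i j] p_def case_prod_unfold ..
      then show ?thesis using q by (simp add: edge_field_def)
    qed
    then show "\<tau> x = edge_field (\<lambda>e x. edge_bubble e x * q e x) x"
      by (simp add: vec_eq_iff)
  qed
  then show ?thesis using q by (intro exI[of _ q]) simp
qed

text \<open>On the facet opposite to \<open>v\<close>, either the edge contains \<open>v\<close> and its bubble function vanishes, or
  the edge is parallel to the facet and its direction is orthogonal to \<open>grd v\<close>.\<close>

lemma edge_field_in_bubbles:
  assumes "\<And>e. e \<in> edges \<Longrightarrow> q e \<in> polys {..CARD('n) - 1}"
  shows "edge_field (\<lambda>e x. edge_bubble e x * q e x) \<in> bubbles"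
proof -
  let ?\<tau> = "edge_field (\<lambda>e x. edge_bubble e x * q e x)"
  have "transpose (?\<tau> x) = ?\<tau> x" for x
    by (simp add: vec_eq_iff transpose_def edge_field_def mult.commute mult.left_commute)
  moreover have "(\<lambda>x. ?\<tau> x $ i $ j) \<in> polys {..CARD('n) + 1}" for i j
  proof -
    have "(\<lambda>x. edge_bubble e x * q e x) \<in> polys {..CARD('n) + 1}" if "e \<in> edges" for e
      using edge_bubble_polys[OF that] assms[OF that] by (rule polys_mult_le) simp
    then have "(\<lambda>x. \<Sum>e\<in>edges. ((fst e - snd e) $ i * (fst e - snd e) $ j) * (edge_bubble e x * q e x))
        \<in> polys {..CARD('n) + 1}"
      by (intro polys_sum polys_scale)
    then show ?thesis by (simp add: edge_field_def mult.commute)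
  qed
  moreover have "?\<tau> x *v grd v = 0" if v: "v \<in> C" and x: "x \<in> convex hull (C - {v})" for v x
  proof -
    have lv: "lam v x = 0" using x v mem_hull_iff[of "C - {v}" x] by auto
    have "(?\<tau> x *v grd v) $ i = 0" for i
    proof -
      have "(?\<tau> x *v grd v) $ i = (\<Sum>j\<in>UNIV. \<Sum>e\<in>edges.
          edge_bubble e x * q e x * ((fst e - snd e) $ i * (fst e - snd e) $ j) * grd v $ j)"
        by (simp add: matrix_vector_mult_def edge_field_def sum_distrib_right)
      also have "\<dots> = (\<Sum>e\<in>edges. \<Sum>j\<in>UNIV.
          edge_bubble e x * q e x * ((fst e - snd e) $ i * (fst e - snd e) $ j) * grd v $ j)"
        by (rule sum.swap)
      also have "\<dots> = (\<Sum>e\<in>edges. edge_bubble e x * q e x * (fst e - snd e) $ i * (grd v \<bullet> (fst e - snd e)))"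
        by (simp add: inner_vec_def sum_distrib_left mult_ac)
      also have "\<dots> = 0"
      proof (intro sum.neutral ballI)
        fix e assume "e \<in> edges"
        then have e: "fst e \<in> C" "snd e \<in> C" "fst e \<noteq> snd e"
          using edge_endpoints[of "fst e" "snd e"] by auto
        show "edge_bubble e x * q e x * (fst e - snd e) $ i * (grd v \<bullet> (fst e - snd e)) = 0"
        proof (cases "v = fst e \<or> v = snd e")
          case True
          then show ?thesis using lv by (auto simp: edge_bubble_def)
        next
          case False
          then show ?thesis using e v by (simp add: grd_inner_diff lam_vertex)
        qed
      qed
      finally show ?thesis .
    qed
    then show ?thesis by (simp add: vec_eq_iff)
  qed
  ultimately show ?thesis by (simp add: bubbles_def sym_polys_def)
qed

text \<open>The divergence of \<open>p t t\<^sup>T\<close> is the derivative of \<open>p\<close> in the direction \<open>t\<close>, times \<open>t\<close>.\<close>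

lemma row_div_edge_field:
  assumes p: "\<And>e. e \<in> edges \<Longrightarrow> p e \<in> polys {..m}"
  shows "row_div (edge_field p) x \<bullet> s
    = (\<Sum>e\<in>edges. dir_deriv (fst e - snd e) (p e) x * ((fst e - snd e) \<bullet> s))"
proof -
  have d: "p e differentiable (at x)" if "e \<in> edges" for e
    using p[OF that] by (rule polys_differentiable)
  have comp: "row_div (edge_field p) x $ i
      = (\<Sum>e\<in>edges. dir_deriv (fst e - snd e) (p e) x * (fst e - snd e) $ i)" for i
  proof -
    have "dir_deriv (axis j 1) (\<lambda>y. edge_field p y $ i $ j) x
      = (\<Sum>e\<in>edges. ((fst e - snd e) $ i * (fst e - snd e) $ j) * dir_deriv (axis j 1) (p e) x)" for j
    proof -
      have "(\<lambda>y. edge_field p y $ i $ j)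
          = (\<lambda>y. \<Sum>e\<in>edges. ((fst e - snd e) $ i * (fst e - snd e) $ j) * p e y)"
        by (simp add: edge_field_def mult.commute)
      moreover have "(\<lambda>y. ((fst e - snd e) $ i * (fst e - snd e) $ j) * p e y) differentiable (at x)"
        if "e \<in> edges" for e
        using p[OF that] polys_differentiable polys_scale by blast
      ultimately show ?thesis
        using d by (simp add: dir_deriv_sum dir_deriv_scale)
    qed
    then have "row_div (edge_field p) x $ i = (\<Sum>j\<in>UNIV. \<Sum>e\<in>edges.
        ((fst e - snd e) $ i * (fst e - snd e) $ j) * dir_deriv (axis j 1) (p e) x)"
      by (simp add: row_div_eq)
    also have "\<dots> = (\<Sum>e\<in>edges. \<Sum>j\<in>UNIV.
        ((fst e - snd e) $ i * (fst e - snd e) $ j) * dir_deriv (axis j 1) (p e) x)"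
      by (rule sum.swap)
    also have "\<dots> = (\<Sum>e\<in>edges. dir_deriv (fst e - snd e) (p e) x * (fst e - snd e) $ i)"
    proof (rule sum.cong)
      fix e assume "e \<in> edges"
      from dir_deriv_components[OF d[OF this], of "fst e - snd e"]
      show "(\<Sum>j\<in>UNIV. ((fst e - snd e) $ i * (fst e - snd e) $ j) * dir_deriv (axis j 1) (p e) x)
        = dir_deriv (fst e - snd e) (p e) x * (fst e - snd e) $ i"
        by (simp add: sum_distrib_left sum_distrib_right mult_ac)
    qed simp
    finally show ?thesis .
  qed
  have "row_div (edge_field p) x \<bullet> s
      = (\<Sum>i\<in>UNIV. \<Sum>e\<in>edges. dir_deriv (fst e - snd e) (p e) x * (fst e - snd e) $ i * s $ i)"
    by (simp add: inner_vec_def comp sum_distrib_right)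
  also have "\<dots> = (\<Sum>e\<in>edges. \<Sum>i\<in>UNIV. dir_deriv (fst e - snd e) (p e) x * (fst e - snd e) $ i * s $ i)"
    by (rule sum.swap)
  also have "\<dots> = (\<Sum>e\<in>edges. dir_deriv (fst e - snd e) (p e) x * ((fst e - snd e) \<bullet> s))"
    by (simp add: inner_vec_def sum_distrib_left mult_ac)
  finally show ?thesis .
qed

end

section \<open>Spaces of polynomial fields\<close>

definition vec_polys :: "nat set \<Rightarrow> (real^'n \<Rightarrow> real^'n) set"
  where "vec_polys D = {v. \<forall>i. (\<lambda>x. v x $ i) \<in> polys D}"

lemma subspace_vec_polys [simp]: "subspace (vec_polys D)"
  by (auto simp: subspace_def vec_polys_def scaleR_fun_apply polys_add polys_scale)

lemma subspace_sym_polys [simp]: "subspace (sym_polys D)"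
  by (auto simp: subspace_def sym_polys_def scaleR_fun_apply polys_add polys_scale
      transpose_def vec_eq_iff)

lemma sym_polys_mono: "D \<subseteq> E \<Longrightarrow> sym_polys D \<subseteq> sym_polys E"
  using polys_mono unfolding sym_polys_def by blast

lemma fin_dim_polynomial_maps:
  fixes V :: "(real^'n \<Rightarrow> 'b::euclidean_space) set"
  assumes "finite D" "\<And>f b. f \<in> V \<Longrightarrow> b \<in> Basis \<Longrightarrow> (\<lambda>x. f x \<bullet> b) \<in> polys D"
  shows "fin_dim V"
proof -
  define m where "m = (\<lambda>(b :: 'b, \<alpha>) (x :: real^'n). monomial_fun \<alpha> x *\<^sub>R b)"
  have "V \<subseteq> span (m ` (Basis \<times> (exponents D :: ('n \<Rightarrow> nat) set)))"
  proof
    fix f assume f: "f \<in> V"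
    have "f = (\<Sum>b\<in>Basis. \<Sum>\<alpha>\<in>exponents D. coef \<alpha> (\<lambda>x. f x \<bullet> b) *\<^sub>R m (b, \<alpha>))"
    proof
      fix x
      have "f x = (\<Sum>b\<in>Basis. (f x \<bullet> b) *\<^sub>R b)" by (simp add: euclidean_representation)
      also have "\<dots> = (\<Sum>b\<in>Basis. \<Sum>\<alpha>\<in>exponents D. coef \<alpha> (\<lambda>x. f x \<bullet> b) *\<^sub>R m (b, \<alpha>) x)"
      proof (rule sum.cong)
        fix b :: 'b assume "b \<in> Basis"
        from polys_monomial_expansion[OF assms(2)[OF f this] assms(1), THEN fun_cong, of x]
        show "(f x \<bullet> b) *\<^sub>R b = (\<Sum>\<alpha>\<in>exponents D. coef \<alpha> (\<lambda>x. f x \<bullet> b) *\<^sub>R m (b, \<alpha>) x)"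
          by (simp add: sum_fun_apply scaleR_fun_apply m_def scaleR_sum_left)
      qed simp
      finally show "f x = (\<Sum>b\<in>Basis. \<Sum>\<alpha>\<in>exponents D. coef \<alpha> (\<lambda>x. f x \<bullet> b) *\<^sub>R m (b, \<alpha>)) x"
        by (simp add: sum_fun_apply scaleR_fun_apply)
    qed
    also have "\<dots> \<in> span (m ` (Basis \<times> exponents D))"
      by (intro span_sum span_scale span_base imageI) auto
    finally show "f \<in> span (m ` (Basis \<times> exponents D))" .
  qed
  then show ?thesis using assms(1) by (intro fin_dimI) auto
qed

lemma fin_dim_sym_polys [simp]: "finite D \<Longrightarrow> fin_dim (sym_polys D)"
  by (rule fin_dim_polynomial_maps) (auto simp: sym_polys_def Basis_vec_def inner_axis)

lemma fin_dim_vec_polys [simp]: "finite D \<Longrightarrow> fin_dim (vec_polys D)"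
  by (rule fin_dim_polynomial_maps) (auto simp: vec_polys_def Basis_vec_def inner_axis)

lemma linear_coef_component:
  fixes L :: "'b::real_vector \<Rightarrow> real"
  assumes "linear L"
  shows "linear (\<lambda>v :: real^'n \<Rightarrow> 'b. coef \<alpha> (\<lambda>x. L (v x)))"
proof (rule linearI)
  fix u v :: "real^'n \<Rightarrow> 'b" and c
  have "(\<lambda>x. L ((u + v) x)) = (\<lambda>x. L (u x)) + (\<lambda>x. L (v x))"
    using assms by (simp add: fun_eq_iff linear_add)
  then show "coef \<alpha> (\<lambda>x. L ((u + v) x)) = coef \<alpha> (\<lambda>x. L (u x)) + coef \<alpha> (\<lambda>x. L (v x))"
    by (simp only: linear_add[OF coef_properties(1)])
  have "(\<lambda>x. L ((c *\<^sub>R u) x)) = c *\<^sub>R (\<lambda>x. L (u x))"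
    using assms by (simp add: fun_eq_iff linear_scale scaleR_fun_apply)
  then show "coef \<alpha> (\<lambda>x. L ((c *\<^sub>R u) x)) = c *\<^sub>R coef \<alpha> (\<lambda>x. L (u x))"
    by (simp only: linear_scale[OF coef_properties(1)])
qed

lemma linear_entries:
  "linear (\<lambda>v :: real^'n. v $ i)" "linear (\<lambda>A :: real^'n^'m. A $ k $ l)"
  by (auto intro!: linearI)

lemma dim_vec_polys_ge:
  assumes "finite D"
  shows "CARD('n) * card (exponents D :: ('n \<Rightarrow> nat) set) \<le> dim (vec_polys D :: (real^'n \<Rightarrow> real^'n) set)"
proof -
  define m where "m = (\<lambda>(i, \<alpha>) (x :: real^'n). (\<chi> k. if k = i then monomial_fun \<alpha> x else 0) :: real^'n)"
  define \<phi> where "\<phi> = (\<lambda>(i, \<alpha>) (v :: real^'n \<Rightarrow> real^'n). coef \<alpha> (\<lambda>x. v x $ i))"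
  have "card ((UNIV :: 'n set) \<times> (exponents D :: ('n \<Rightarrow> nat) set)) \<le> dim (vec_polys D :: (real^'n \<Rightarrow> real^'n) set)"
  proof (rule card_le_dim_biorthogonal[where \<phi> = \<phi> and v = m])
    show "m e \<in> vec_polys D" if e: "e \<in> UNIV \<times> exponents D" for e
    proof -
      have "(\<lambda>x. m e x $ i) \<in> polys D" for i
        using e monomial_in_polys[of "snd e" D] by (cases e; cases "i = fst e") (auto simp: m_def)
      then show ?thesis by (simp add: vec_polys_def)
    qed
    show "linear (\<phi> e)" for e
    proof (cases e)
      case (Pair i \<alpha>)
      show ?thesis unfolding Pair \<phi>_def prod.case
        by (rule linear_coef_component[OF linear_entries(1)])
    qed
    show "\<phi> e (m e') = (if e = e' then 1 else 0)" for e e'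
    proof (cases e; cases e')
      fix i \<alpha> j \<beta> assume e: "e = (i, \<alpha>)" "e' = (j, \<beta>)"
      show ?thesis
        using linear_0[OF coef_properties(1)[of \<alpha>]] unfolding e \<phi>_def m_def
        by (cases "i = j") (auto simp: coef_properties(2) zero_fun_def)
    qed
  qed (use assms in auto)
  then show ?thesis by (simp add: card_cartesian_product)
qed

lemma dim_sym_polys_ge:
  assumes "finite D"
  shows "((CARD('n) + 1) choose 2) * card (exponents D :: ('n \<Rightarrow> nat) set)
    \<le> dim (sym_polys D :: (real^'n \<Rightarrow> real^'n^'n) set)"
proof -
  obtain P :: "('n \<times> 'n) set" where P: "card P = (CARD('n) + 1) choose 2"
    "\<forall>a b. (a, b) \<in> P \<and> (b, a) \<in> P \<longrightarrow> a = b"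
    using unordered_pairs_exist[OF finite[of "UNIV :: 'n set"]] by (elim exE conjE)
  define m where "m = (\<lambda>((i, j), \<alpha>) (x :: real^'n). (\<chi> k l. if (k, l) = (i, j) \<or> (k, l) = (j, i)
    then monomial_fun \<alpha> x else 0) :: real^'n^'n)"
  define \<phi> where "\<phi> = (\<lambda>((i, j), \<alpha>) (\<tau> :: real^'n \<Rightarrow> real^'n^'n). coef \<alpha> (\<lambda>x. \<tau> x $ i $ j))"
  have "card (P \<times> (exponents D :: ('n \<Rightarrow> nat) set)) \<le> dim (sym_polys D :: (real^'n \<Rightarrow> real^'n^'n) set)"
  proof (rule card_le_dim_biorthogonal[where \<phi> = \<phi> and v = m])
    show "m e \<in> sym_polys D" if "e \<in> P \<times> exponents D" for e
    proof -
      obtain i j \<alpha> where e: "e = ((i, j), \<alpha>)" "\<alpha> \<in> exponents D" using \<open>e \<in> _\<close> by auto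
      have "(\<lambda>x. m e x $ k $ l) \<in> polys D" for k l
        using monomial_in_polys[OF e(2)] by (cases "(k, l) = (i, j) \<or> (k, l) = (j, i)") (auto simp: m_def e(1))
      moreover have "transpose (m e x) = m e x" for x
        by (auto simp: transpose_def vec_eq_iff m_def e(1))
      ultimately show ?thesis by (simp add: sym_polys_def)
    qed
    show "linear (\<phi> e)" for e
    proof (cases e)
      case (Pair ij \<alpha>)
      then show ?thesis unfolding \<phi>_def
        by (cases ij) (simp add: linear_coef_component[OF linear_entries(2)])
    qed
    show "\<phi> e (m e') = (if e = e' then 1 else 0)" if ee: "e \<in> P \<times> exponents D" "e' \<in> P \<times> exponents D" for e e'
    proof -
      obtain i j \<alpha> k l \<beta> where e: "e = ((i, j), \<alpha>)" "e' = ((k, l), \<beta>)" "(i, j) \<in> P" "(k, l) \<in> P"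
        using ee by (cases e, cases e', cases "fst e", cases "fst e'") auto
      have "(i, j) = (k, l) \<or> (i, j) = (l, k) \<longleftrightarrow> (i, j) = (k, l)"
        using e(3,4) P(2)[rule_format, of k l] by auto
      then have "(\<lambda>x. m e' x $ i $ j) = (if (i, j) = (k, l) then monomial_fun \<beta> else 0)"
        unfolding m_def e(2) prod.case by (auto simp: fun_eq_iff)
      then have "\<phi> e (m e') = coef \<alpha> (if (i, j) = (k, l) then monomial_fun \<beta> else 0)"
        unfolding \<phi>_def e(1) prod.case by (rule arg_cong)
      then show ?thesis
        using linear_0[OF coef_properties(1)[of \<alpha>]] unfolding e(1,2)
        by (simp add: coef_properties(2))
    qed
  qed (use assms P finite_subset[of P UNIV] in auto)
  then show ?thesis by (simp add: card_cartesian_product P(1))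
qed

lemma row_div_in_vec_polys:
  assumes "\<tau> \<in> sym_polys D" "\<And>d. d \<in> D \<Longrightarrow> 0 < d \<Longrightarrow> d - 1 \<in> E"
  shows "row_div \<tau> \<in> vec_polys E"
proof -
  have "(\<lambda>x. dir_deriv (axis j 1) (\<lambda>y. \<tau> y $ i $ j) x) \<in> polys E" for i j
    using assms polys_dir_deriv[of "\<lambda>y. \<tau> y $ i $ j" D E] by (simp add: sym_polys_def)
  then have "(\<lambda>x. row_div \<tau> x $ i) \<in> polys E" for i
    unfolding row_div_eq by (intro polys_sum)
  then show ?thesis by (simp add: vec_polys_def)
qed

lemma row_div_add:
  fixes \<sigma> \<tau> :: "real^'n \<Rightarrow> real^'n^'n"
  assumes "\<sigma> \<in> sym_polys D" "\<tau> \<in> sym_polys D"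
  shows "row_div (\<sigma> + \<tau>) = row_div \<sigma> + row_div \<tau>"
proof
  fix x
  have d: "(\<lambda>y. \<rho> y $ i $ j) differentiable (at x)" if "\<rho> \<in> sym_polys D" for \<rho> :: "real^'n \<Rightarrow> real^'n^'n" and i j
    using that polys_differentiable unfolding sym_polys_def by blast
  show "row_div (\<sigma> + \<tau>) x = (row_div \<sigma> + row_div \<tau>) x"
    by (simp add: vec_eq_iff row_div_eq dir_deriv_add[OF d[OF assms(1)] d[OF assms(2)]] sum.distrib)
qed

lemma row_div_scale:
  fixes \<tau> :: "real^'n \<Rightarrow> real^'n^'n"
  assumes "\<tau> \<in> sym_polys D"
  shows "row_div (c *\<^sub>R \<tau>) = c *\<^sub>R row_div \<tau>"
proof
  fix x
  have d: "(\<lambda>y. \<tau> y $ i $ j) differentiable (at x)" for i j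
    using assms polys_differentiable unfolding sym_polys_def by blast
  show "row_div (c *\<^sub>R \<tau>) x = (c *\<^sub>R row_div \<tau>) x"
    by (simp add: vec_eq_iff row_div_eq scaleR_fun_apply dir_deriv_scale[OF d] sum_distrib_left)
qed

lemma linear_on_row_div: "linear_on (sym_polys D) row_div"
  by (rule linear_onI) (rule row_div_add row_div_scale; assumption)+

lemma Sigma_DF_subspace: "subspace (Sigma_DF (K :: (real^'n) set))"
proof -
  let ?V = "sym_polys {3..CARD('n) + 1} :: (real^'n \<Rightarrow> real^'n^'n) set"
  have "\<sigma> + \<tau> \<in> Sigma_DF K" if "\<sigma> \<in> Sigma_DF K" "\<tau> \<in> Sigma_DF K" for \<sigma> \<tau>
  proof -
    have V: "\<sigma> \<in> ?V" "\<tau> \<in> ?V" using that by (auto simp: Sigma_DF_def)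
    then have "\<sigma> + \<tau> \<in> ?V" by (rule subspace_add[OF subspace_sym_polys])
    then show ?thesis using that row_div_add[OF V] by (simp add: Sigma_DF_def)
  qed
  moreover have "c *\<^sub>R \<tau> \<in> Sigma_DF K" if "\<tau> \<in> Sigma_DF K" for c \<tau>
  proof -
    have V: "\<tau> \<in> ?V" using that by (auto simp: Sigma_DF_def)
    then have "c *\<^sub>R \<tau> \<in> ?V" by (rule subspace_scale[OF subspace_sym_polys])
    then show ?thesis using that row_div_scale[OF V] by (simp add: Sigma_DF_def scaleR_fun_apply)
  qed
  moreover have "row_div (0 :: real^'n \<Rightarrow> real^'n^'n) = 0"
    by (rule linear_on_zero[OF linear_on_row_div subspace_sym_polys])
  then have "0 \<in> Sigma_DF K"
    by (simp add: Sigma_DF_def subspace_0)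
  ultimately show ?thesis by (simp add: subspace_def)
qed

lemma subspace_P2star [simp]: "subspace (P2star K)"
  using subspace_sums[OF subspace_sym_polys[of "{..2}"] Sigma_DF_subspace[of K]] by (simp add: P2star_def)

lemma P2star_subset: "P2star (K :: (real^'n) set) \<subseteq> sym_polys {..CARD('n) + 1}"
proof -
  have "1 \<le> CARD('n)" using zero_less_card_finite[where 'a='n] by linarith
  then have s: "sym_polys {..2} \<subseteq> (sym_polys {..CARD('n) + 1} :: (real^'n \<Rightarrow> real^'n^'n) set)"
    by (intro sym_polys_mono) auto
  have "sym_polys {3..CARD('n) + 1} \<subseteq> (sym_polys {..CARD('n) + 1} :: (real^'n \<Rightarrow> real^'n^'n) set)"
    by (intro sym_polys_mono) auto
  then have "Sigma_DF K \<subseteq> sym_polys {..CARD('n) + 1}"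
    by (auto simp: Sigma_DF_def)
  then show ?thesis
    unfolding P2star_def using s by (auto intro!: subspace_add[OF subspace_sym_polys])
qed

lemma fin_dim_P2star [simp]: "fin_dim (P2star K)"
  using fin_dim_subset[OF fin_dim_sym_polys P2star_subset] by blast

text \<open>A field of degree at most \<open>n + 1\<close> belongs to \<open>P2star\<close> as soon as the coefficients of degree
  \<open>2, \<dots>, n\<close> of its divergence vanish, because these are the coefficients of the divergence of
  its part of degree at least three.\<close>

lemma dim_P2star_ge:
  fixes K :: "(real^'n) set" and n :: nat
  assumes n: "n = CARD('n)"
  shows "((n + 1) choose 2) * ((2 * n + 1) choose n) + n * (n + 1)
    \<le> dim (P2star K) + n * ((2 * n) choose n)"
proof -
  have n1: "1 \<le> n" using n zero_less_card_finite[where 'a='n] by linarith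
  let ?V = "sym_polys {..n + 1} :: (real^'n \<Rightarrow> real^'n^'n) set"
  let ?I = "UNIV \<times> exponents {2..n} :: ('n \<times> ('n \<Rightarrow> nat)) set"
  define \<phi> where "\<phi> = (\<lambda>(i, \<alpha>) (\<tau> :: real^'n \<Rightarrow> real^'n^'n). coef \<alpha> (\<lambda>x. row_div \<tau> x $ i))"
  have lin: "linear_on ?V (\<phi> e)" for e
  proof (cases e)
    case (Pair i \<alpha>)
    note lin = linear_coef_component[OF linear_entries(1), of \<alpha> i]
    show ?thesis
    proof (rule linear_onI)
      fix \<sigma> \<tau> :: "real^'n \<Rightarrow> real^'n^'n" and c
      assume V: "\<sigma> \<in> ?V" "\<tau> \<in> ?V"
      show "\<phi> e (\<sigma> + \<tau>) = \<phi> e \<sigma> + \<phi> e \<tau>"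
        using linear_add[OF lin, of "row_div \<sigma>" "row_div \<tau>"] by (simp only: \<phi>_def Pair prod.case row_div_add[OF V])
    next
      fix c and \<tau> :: "real^'n \<Rightarrow> real^'n^'n" assume V: "\<tau> \<in> ?V"
      show "\<phi> e (c *\<^sub>R \<tau>) = c *\<^sub>R \<phi> e \<tau>"
        using linear_scale[OF lin, of c "row_div \<tau>"] by (simp only: \<phi>_def Pair prod.case row_div_scale[OF V])
    qed
  qed
  have ker: "{\<tau> \<in> ?V. \<forall>e\<in>?I. \<phi> e \<tau> = 0} \<subseteq> P2star K"
  proof
    fix \<tau> assume "\<tau> \<in> {\<tau> \<in> ?V. \<forall>e\<in>?I. \<phi> e \<tau> = 0}"
    then have \<tau>: "\<tau> \<in> ?V" and zero: "\<And>i \<alpha>. \<alpha> \<in> exponents {2..n} \<Longrightarrow> coef \<alpha> (\<lambda>x. row_div \<tau> x $ i) = 0"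
      by (auto simp: \<phi>_def)
    define part where "part D p x = (\<Sum>\<alpha>\<in>exponents D. coef \<alpha> p * monomial_fun \<alpha> x)"
      for D and p :: "real^'n \<Rightarrow> real" and x
    have part: "part D p \<in> polys D" for D p
      unfolding part_def by (intro polys_sum polys_scale monomial_in_polys)
    have split: "p x = part {..2} p x + part {3..n + 1} p x" if "p \<in> polys {..n + 1}" for p x
    proof -
      have "exponents {..n + 1} = exponents {..2} \<union> (exponents {3..n + 1} :: ('n \<Rightarrow> nat) set)"
        using n1 by (auto simp: exponents_def)
      moreover have "exponents {..2} \<inter> (exponents {3..n + 1} :: ('n \<Rightarrow> nat) set) = {}"
        by (auto simp: exponents_def)
      moreover have "p x = (\<Sum>\<alpha>\<in>exponents {..n + 1}. coef \<alpha> p * monomial_fun \<alpha> x)"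
        using polys_monomial_expansion[OF that, THEN fun_cong, of x]
        by (simp add: sum_fun_apply scaleR_fun_apply)
      ultimately show ?thesis by (simp add: part_def sum.union_disjoint)
    qed
    define field where "field D x = (\<chi> i j. part D (\<lambda>x. \<tau> x $ i $ j) x)" for D x
    have tr: "(\<lambda>x. \<tau> x $ i $ j) = (\<lambda>x. \<tau> x $ j $ i)" for i j
      using \<tau> by (auto simp: sym_polys_def transpose_def vec_eq_iff)
    have field: "field D \<in> sym_polys D" for D
      using part by (simp add: field_def sym_polys_def transpose_def vec_eq_iff tr)
    \<comment> \<open>the splitting of \<open>\<tau>\<close> that shows its membership in \<open>P2star\<close>\<close>
    have \<tau>eq: "\<tau> = field {..2} + field {3..n + 1}"
      using split \<tau> by (simp add: fun_eq_iff vec_eq_iff field_def sym_polys_def)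
    have "row_div (field {3..n + 1}) x $ i = 0" for x i
    proof -
      let ?r = "\<lambda>D x. row_div (field D) x $ i"
      have r3: "?r {3..n + 1} \<in> polys {2..n}"
        using row_div_in_vec_polys[OF field, of "{3..n + 1}" "{2..n}"] by (force simp: vec_polys_def)
      have r2: "?r {..2} \<in> polys {..1}"
        using row_div_in_vec_polys[OF field, of "{..2}" "{..1}"] by (force simp: vec_polys_def)
      have big: "field {..2} \<in> sym_polys {..n + 1}" "field {3..n + 1} \<in> sym_polys {..n + 1}"
        using field sym_polys_mono[of "{..2}" "{..n + 1}"] sym_polys_mono[of "{3..n + 1}" "{..n + 1}"] n1
        by auto
      have "coef \<alpha> (?r {3..n + 1}) = 0" if \<alpha>: "\<alpha> \<in> exponents {2..n}" for \<alpha>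
      proof -
        have "(\<lambda>x. row_div \<tau> x $ i) = ?r {..2} + ?r {3..n + 1}"
          unfolding \<tau>eq row_div_add[OF big] by (simp add: fun_eq_iff)
        then have "coef \<alpha> (?r {..2}) + coef \<alpha> (?r {3..n + 1}) = 0"
          using zero[OF \<alpha>, of i] linear_add[OF coef_properties(1)[of \<alpha>]] by simp
        moreover have "coef \<alpha> (?r {..2}) = 0"
          using \<alpha> by (intro coef_eq_0[OF r2]) (auto simp: exponents_def)
        ultimately show ?thesis by simp
      qed
      then show ?thesis
        using polys_monomial_expansion[OF r3, THEN fun_cong, of x]
        by (simp add: sum_fun_apply scaleR_fun_apply)
    qed
    then have "field {3..n + 1} \<in> Sigma_DF K"
      using field[of "{3..n + 1}"] by (simp add: Sigma_DF_def n vec_eq_iff)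
    then show "\<tau> \<in> P2star K" unfolding P2star_def using \<tau>eq field[of "{..2}"] by blast
  qed
  have "dim ?V \<le> dim {\<tau> \<in> ?V. \<forall>e\<in>?I. \<phi> e \<tau> = 0} + card ?I"
    by (rule dim_le_dim_kernel_functionals) (use lin in auto)
  also have "dim {\<tau> \<in> ?V. \<forall>e\<in>?I. \<phi> e \<tau> = 0} \<le> dim (P2star K)"
    by (rule dim_mono_fin[OF fin_dim_P2star ker])
  finally have 1: "dim ?V \<le> dim (P2star K) + card ?I" by simp
  have e1: "card (exponents {..1} :: ('n \<Rightarrow> nat) set) = n + 1"
    using card_exponents[where 'n='n, of 1] by (simp add: n)
  have "exponents {..n} = exponents {..1} \<union> (exponents {2..n} :: ('n \<Rightarrow> nat) set)"
    using n1 by (auto simp: exponents_def)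
  moreover have "exponents {..1} \<inter> (exponents {2..n} :: ('n \<Rightarrow> nat) set) = {}"
    by (auto simp: exponents_def)
  ultimately have "card (exponents {..n} :: ('n \<Rightarrow> nat) set) = n + 1 + card (exponents {2..n} :: ('n \<Rightarrow> nat) set)"
    using e1 by (simp add: card_Un_disjoint)
  then have "n + 1 + card (exponents {2..n} :: ('n \<Rightarrow> nat) set) = (2 * n) choose n"
    using card_exponents[where 'n='n, of n] by (simp add: n mult_2)
  then have "n * (n + 1 + card (exponents {2..n} :: ('n \<Rightarrow> nat) set)) = n * ((2 * n) choose n)"
    by (rule arg_cong)
  then have "n * (n + 1) + card ?I = n * ((2 * n) choose n)"
    by (simp only: card_cartesian_product distrib_left n)
  moreover have "((n + 1) choose 2) * ((2 * n + 1) choose n) \<le> dim ?V"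
    using dim_sym_polys_ge[where 'n='n, of "{..n + 1}"] card_exponents[where 'n='n, of "n + 1"]
    by (simp add: n mult_2)
  ultimately show ?thesis using 1 by linarith
qed

section \<open>The dimension of the divergence-free bubble fields\<close>

context simplex_coords
begin

definition intK :: "(real^'n \<Rightarrow> real) \<Rightarrow> real"
  where "intK f = (LINT x:convex hull C|lborel. f x)"

lemma set_integrable_hull:
  fixes f :: "real^'n \<Rightarrow> 'b::{banach, second_countable_topology}"
  assumes "continuous_on UNIV f"
  shows "set_integrable lborel (convex hull C) f"
  unfolding set_integrable_def
  using compact_hull_C continuous_on_subset[OF assms subset_UNIV] by (rule borel_integrable_compact)

lemma intK_add:
  assumes "continuous_on UNIV f" "continuous_on UNIV g"
  shows "intK (\<lambda>x. f x + g x) = intK f + intK g"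
  unfolding intK_def using assms by (intro set_integral_add set_integrable_hull)

lemma intK_scale: "intK (\<lambda>x. c * f x) = c * intK f"
  by (simp add: intK_def)

lemma intK_zero [simp]: "intK (\<lambda>x. 0) = 0"
  by (simp add: intK_def)

lemma intK_sum:
  assumes "\<And>i. i \<in> I \<Longrightarrow> continuous_on UNIV (f i)"
  shows "intK (\<lambda>x. \<Sum>i\<in>I. f i x) = (\<Sum>i\<in>I. intK (f i))"
  using assms
proof (induction I rule: infinite_finite_induct)
  case (insert i I)
  then have "continuous_on UNIV (\<lambda>x. \<Sum>i\<in>I. f i x)" by (intro continuous_on_sum) auto
  then show ?case using insert by (simp add: intK_add)
qed simp_all

lemma emeasure_neighbourhood_hull_nonzero:
  assumes "\<forall>v\<in>C. 0 < lam v x" "0 < e"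
  shows "emeasure lborel (ball x e \<inter> convex hull C) \<noteq> 0"
proof
  assume 0: "emeasure lborel (ball x e \<inter> convex hull C) = 0"
  define U where "U = ball x e \<inter> (\<Inter>v\<in>C. {y. 0 < lam v y})"
  have "open {y. 0 < lam v y}" if "v \<in> C" for v
    using polys_continuous[OF lam_polys[OF that]] by (intro open_Collect_less) auto
  then have "open U" unfolding U_def by (intro open_Int open_INT) auto
  moreover have "x \<in> U" using assms by (simp add: U_def)
  then have "U \<noteq> {}" by blast
  ultimately have "\<not> negligible U" by (rule open_not_negligible)
  moreover have "U \<subseteq> ball x e \<inter> convex hull C"
    by (auto simp: U_def mem_hull_iff less_imp_le)
  moreover have "ball x e \<inter> convex hull C \<in> sets borel"
    by (intro sets.Int borel_compact[OF compact_hull_C]) simp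
  then have "ball x e \<inter> convex hull C \<in> null_sets lborel"
    using 0 by (simp add: null_sets_def)
  then have "negligible (ball x e \<inter> convex hull C)"
    by (simp add: negligible_iff_null_sets null_sets_completionI)
  ultimately show False using negligible_subset by blast
qed

lemma intK_nonneg_eq_0:
  assumes "continuous_on UNIV f" "\<And>y. y \<in> convex hull C \<Longrightarrow> 0 \<le> f y" "intK f = 0"
    and "\<forall>v\<in>C. 0 < lam v x"
  shows "f x = 0"
proof (rule integral_nonneg_eq_0_imp_eq_0[of lborel "convex hull C"])
  show "emeasure lborel (convex hull C) < \<infinity>"
    using emeasure_bounded_finite[OF compact_imp_bounded[OF compact_hull_C]] by simp
  show "continuous_on (convex hull C) f" using assms(1) continuous_on_subset by blast
  show "(LINT y:convex hull C|lborel. f y) = 0" using assms(3) by (simp add: intK_def)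
  show "x \<in> convex hull C" using assms(4) by (simp add: mem_hull_iff less_imp_le)
  show "emeasure lborel (ball x e \<inter> convex hull C) \<noteq> 0" if "0 < e" for e
    using assms(4) that by (rule emeasure_neighbourhood_hull_nonzero)
qed (use assms in auto)

lemma C_nonempty: "C \<noteq> {}"
  using card_C by auto

lemma polys_eq_0_everywhere:
  assumes "p \<in> polys {..m}" "\<And>x. \<forall>v\<in>C. 0 < lam v x \<Longrightarrow> p x = 0"
  shows "p x = 0"
  using polys_eq_0_on_face[OF order_refl C_nonempty assms(1)] assms(2) by auto

lemma inner_vec_polys:
  assumes "v \<in> vec_polys D"
  shows "(\<lambda>x. v x \<bullet> s) \<in> polys D"
proof -
  have "(\<lambda>x. \<Sum>i\<in>UNIV. s $ i * v x $ i) \<in> polys D"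
    using assms by (intro polys_sum polys_scale) (simp add: vec_polys_def)
  then show ?thesis by (simp add: inner_vec_def mult.commute)
qed

lemma continuous_vec_polys:
  assumes "v \<in> vec_polys D"
  shows "continuous_on S v"
proof -
  have "continuous_on S (\<lambda>x. \<chi> i. v x $ i)"
    using assms polys_continuous by (intro continuous_on_vec_lambda) (auto simp: vec_polys_def)
  then show ?thesis by simp
qed

text \<open>There are no boundary terms, since each edge bubble vanishes where its edge leaves the simplex.
  On the right the strain \<open>t \<bullet> Dv t\<close> of \<open>v\<close> along the edge \<open>t\<close> appears as a directional derivative.\<close>

lemma integration_by_parts:
  assumes q: "\<And>e. e \<in> edges \<Longrightarrow> q e \<in> polys {..k}" and v: "v \<in> vec_polys {..m}"
  shows "intK (\<lambda>x. row_div (edge_field (\<lambda>e x. edge_bubble e x * q e x)) x \<bullet> v x)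
    = - (\<Sum>e\<in>edges. intK (\<lambda>x. edge_bubble e x * q e x *
        dir_deriv (fst e - snd e) (\<lambda>y. v y \<bullet> (fst e - snd e)) x))"
proof -
  let ?t = "\<lambda>e. fst e - snd e :: real^'n"
  let ?p = "\<lambda>e x. edge_bubble e x * q e x"
  let ?w = "\<lambda>e x. v x \<bullet> ?t e"
  have p: "?p e \<in> polys {..2 + k}" if "e \<in> edges" for e
    using edge_bubble_polys[OF that] q[OF that] by (rule polys_mult)
  have w: "?w e \<in> polys {..m}" for e using v by (rule inner_vec_polys)
  have c1: "continuous_on UNIV (\<lambda>x. dir_deriv (?t e) (?p e) x * ?w e x)" if "e \<in> edges" for e
    using polys_continuous[OF polys_dir_deriv_le[OF p[OF that]]] polys_continuous[OF w]
    by (intro continuous_on_mult)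
  have c2: "continuous_on UNIV (\<lambda>x. ?p e x * dir_deriv (?t e) (?w e) x)" if "e \<in> edges" for e
    using polys_continuous[OF p[OF that]] polys_continuous[OF polys_dir_deriv_le[OF w]]
    by (rule continuous_on_mult)
  have parts: "intK (\<lambda>x. dir_deriv (?t e) (?p e) x * ?w e x)
      = - intK (\<lambda>x. ?p e x * dir_deriv (?t e) (?w e) x)" if e: "e \<in> edges" for e
  proof -
    have ends: "fst e \<in> C" "snd e \<in> C" "fst e \<noteq> snd e"
      using edge_endpoints[of "fst e" "snd e"] e by auto
    have "0 = intK (dir_deriv (?t e) (\<lambda>x. lam (fst e) x * lam (snd e) x * (q e x * ?w e x)))"
      unfolding intK_def
      using integral_dir_deriv_edge_bubble[OF ends polys_mult[OF q[OF e] w]] by simp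
    also have "(\<lambda>x. lam (fst e) x * lam (snd e) x * (q e x * ?w e x)) = (\<lambda>x. ?p e x * ?w e x)"
      by (simp add: edge_bubble_def mult.assoc)
    also have "dir_deriv (?t e) \<dots> = (\<lambda>x. dir_deriv (?t e) (?p e) x * ?w e x + ?p e x * dir_deriv (?t e) (?w e) x)"
      by (intro ext dir_deriv_mult polys_differentiable[OF p[OF e]] polys_differentiable[OF w])
    also have "intK \<dots> = intK (\<lambda>x. dir_deriv (?t e) (?p e) x * ?w e x)
        + intK (\<lambda>x. ?p e x * dir_deriv (?t e) (?w e) x)"
      by (rule intK_add[OF c1[OF e] c2[OF e]])
    finally show ?thesis by simp
  qed
  have "(\<lambda>x. row_div (edge_field ?p) x \<bullet> v x)
      = (\<lambda>x. \<Sum>e\<in>edges. dir_deriv (?t e) (?p e) x * ?w e x)"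
    using row_div_edge_field[of ?p "2 + k"] p by (simp add: inner_commute)
  then have "intK (\<lambda>x. row_div (edge_field ?p) x \<bullet> v x)
      = (\<Sum>e\<in>edges. intK (\<lambda>x. dir_deriv (?t e) (?p e) x * ?w e x))"
    using c1 by (simp only: intK_sum)
  also have "\<dots> = (\<Sum>e\<in>edges. - intK (\<lambda>x. ?p e x * dir_deriv (?t e) (?w e) x))"
    by (intro sum.cong refl parts)
  finally show ?thesis by (simp only: sum_negf)
qed

lemma subspace_bubbles [simp]: "subspace bubbles"
  using subspace_sym_polys[of "{..CARD('n) + 1}"]
  by (auto simp: subspace_def bubbles_def matrix_vector_mult_add_rdistrib scaleR_fun_apply
      scaleR_matrix_vector_assoc[symmetric])

lemma bubbles_subset: "bubbles \<subseteq> sym_polys {..CARD('n) + 1}"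
  by (auto simp: bubbles_def)

lemma fin_dim_bubbles [simp]: "fin_dim bubbles"
  using fin_dim_subset[OF fin_dim_sym_polys bubbles_subset] by blast

text \<open>By the representation with edge bubbles, a bubble field is given by one polynomial of degree at
  most \<open>n - 1\<close> for each edge.\<close>

lemma dim_bubbles_le:
  "dim bubbles \<le> ((CARD('n) + 1) choose 2) * ((2 * CARD('n) - 1) choose CARD('n))"
proof -
  let ?D = "{..CARD('n) - 1}"
  define m where "m = (\<lambda>(e, \<alpha>). edge_field (\<lambda>e' x. if e' = e then edge_bubble e x * monomial_fun \<alpha> x else 0))"
  let ?I = "edges \<times> (exponents ?D :: ('n \<Rightarrow> nat) set)"
  have "bubbles \<subseteq> span (m ` ?I)"
  proof
    fix \<tau> assume "\<tau> \<in> bubbles"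
    then obtain q where q: "\<forall>e\<in>edges. q e \<in> polys ?D" "\<tau> = edge_field (\<lambda>e x. edge_bubble e x * q e x)"
      using bubbles_representation by blast
    have "\<tau> = (\<Sum>e\<in>edges. \<Sum>\<alpha>\<in>exponents ?D. coef \<alpha> (q e) *\<^sub>R m (e, \<alpha>))"
    proof
      fix x
      have m: "m (e, \<alpha>) x $ i $ j
          = edge_bubble e x * monomial_fun \<alpha> x * ((fst e - snd e) $ i * (fst e - snd e) $ j)"
        if "e \<in> edges" for e \<alpha> i j
      proof -
        have "m (e, \<alpha>) x $ i $ j = (\<Sum>e'\<in>edges. if e' = e then
            edge_bubble e x * monomial_fun \<alpha> x * ((fst e - snd e) $ i * (fst e - snd e) $ j) else 0)"
          unfolding m_def edge_field_def prod.case vec_lambda_beta by (intro sum.cong) simp_all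
        then show ?thesis using that by simp
      qed
      have qx: "q e x = (\<Sum>\<alpha>\<in>exponents ?D. coef \<alpha> (q e) * monomial_fun \<alpha> x)" if "e \<in> edges" for e
        using polys_monomial_expansion[of "q e" ?D, THEN fun_cong, of x] q(1) that
        by (simp add: sum_fun_apply scaleR_fun_apply)
      have "\<tau> x $ i $ j = (\<Sum>e\<in>edges. \<Sum>\<alpha>\<in>exponents ?D. coef \<alpha> (q e) * m (e, \<alpha>) x $ i $ j)" for i j
        unfolding q(2) edge_field_def
        by (simp add: qx m sum_distrib_left sum_distrib_right mult_ac)
      then show "\<tau> x = (\<Sum>e\<in>edges. \<Sum>\<alpha>\<in>exponents ?D. coef \<alpha> (q e) *\<^sub>R m (e, \<alpha>)) x"
        by (simp add: vec_eq_iff sum_fun_apply scaleR_fun_apply)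
    qed
    also have "\<dots> \<in> span (m ` ?I)"
      by (intro span_sum span_scale span_base imageI) auto
    finally show "\<tau> \<in> span (m ` ?I)" .
  qed
  then have "dim bubbles \<le> card (m ` ?I)" by (intro dim_le_card) auto
  also have "\<dots> \<le> card ?I" by (intro card_image_le) auto
  also have "\<dots> = ((CARD('n) + 1) choose 2) * ((CARD('n) + (CARD('n) - 1)) choose CARD('n))"
    by (simp only: card_cartesian_product card_exponents edges(2))
  also have "CARD('n) + (CARD('n) - 1) = 2 * CARD('n) - 1"
    using zero_less_card_finite[where 'a='n] by linarith
  finally show ?thesis .
qed

text \<open>The squares of the edges span the symmetric matrices, so the strain \<open>t \<bullet> Dv t\<close> vanishes in all
  directions \<open>t\<close>. Integration along the segment from \<open>y\<close> to \<open>x\<close> gives the claim, which says that \<open>v\<close>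
  is an infinitesimal rigid motion.\<close>

lemma rigid_if_edge_strains_vanish:
  assumes v: "v \<in> vec_polys {..m}"
    and zero: "\<And>e x. e \<in> edges \<Longrightarrow> dir_deriv (fst e - snd e) (\<lambda>y. v y \<bullet> (fst e - snd e)) x = 0"
  shows "(v x - v y) \<bullet> (x - y) = 0"
proof -
  define b where "b z u w = dir_deriv u (\<lambda>y. v y \<bullet> w) z" for z u w
  have diff: "(\<lambda>y. v y \<bullet> w) differentiable (at z)" for w z
    using inner_vec_polys[OF v] polys_differentiable by blast
  have b_right: "b z u (\<Sum>i\<in>I. c i *\<^sub>R w i) = (\<Sum>i\<in>I. c i * b z u (w i))"
    for z u c I and w :: "real^'n \<Rightarrow> real^'n"
  proof -
    have "b z u (\<Sum>i\<in>I. c i *\<^sub>R w i) = dir_deriv u (\<lambda>y. \<Sum>i\<in>I. c i * (v y \<bullet> w i)) z"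
      by (simp add: b_def inner_sum_right)
    also have "\<dots> = (\<Sum>i\<in>I. dir_deriv u (\<lambda>y. c i * (v y \<bullet> w i)) z)"
      by (rule dir_deriv_sum) (intro differentiable_mult differentiable_const diff)
    also have "\<dots> = (\<Sum>i\<in>I. c i * b z u (w i))"
      by (simp add: dir_deriv_scale[OF diff] b_def)
    finally show ?thesis .
  qed
  have linl: "linear (\<lambda>u. b z u w)" for z w
    unfolding b_def dir_deriv_def using linear_frechet_derivative[OF diff] .
  have b_diff_right: "b z u (w - w') = b z u w - b z u w'" for z u w w'
  proof -
    have "b z u (w - w') = dir_deriv u (\<lambda>y. (v y \<bullet> w) + -1 * (v y \<bullet> w')) z"
      by (simp add: b_def inner_diff_right)
    also have "\<dots> = b z u w + -1 * b z u w'"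
    proof -
      have "(\<lambda>y. -1 * (v y \<bullet> w')) differentiable (at z)"
        by (intro differentiable_mult differentiable_const diff)
      from dir_deriv_add[OF diff[of w] this, of u] dir_deriv_scale[OF diff[of w' z], of u "-1"]
      show ?thesis by (simp only: b_def)
    qed
    finally show ?thesis by simp
  qed
  have strain: "b z t t = 0" for z t
  proof -
    define g where "g u = grd u \<bullet> t" for u
    have t: "t = (\<Sum>u\<in>C. g u *\<^sub>R u)" by (simp add: g_def grd_expand)
    have "b z t t = (\<Sum>w\<in>C. g w * b z t w)" by (subst (2) t) (rule b_right)
    also have "\<dots> = (\<Sum>w\<in>C. g w * (\<Sum>u\<in>C. g u * b z u w))"
      by (subst t) (simp add: linear_sum[OF linl] linear_scale[OF linl])
    also have "\<dots> = (\<Sum>w\<in>C. \<Sum>u\<in>C. (g w * g u) * b z u w)"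
      by (simp add: sum_distrib_left mult.assoc)
    also have "\<dots> = - (\<Sum>(w, u)\<in>edges. (g w * g u) * (b z w w - b z u w - b z w u + b z u u))"
    proof (rule sum_by_edges)
      show "g u * g w = g w * g u" for u w by simp
      show "(\<Sum>w\<in>C. g u * g w) = 0" for u
        by (simp add: sum_distrib_left[symmetric] g_def sum_grd)
    qed
    also have "\<dots> = - (\<Sum>(w, u)\<in>edges. (g w * g u) * b z (w - u) (w - u))"
      by (simp add: linear_diff[OF linl] b_diff_right algebra_simps)
    also have "\<dots> = 0"
      using zero[of _ z] by (auto simp: b_def split: prod.splits intro!: sum.neutral)
    finally show ?thesis .
  qed
  let ?t = "x - y"
  define \<phi> where "\<phi> s = v (y + s *\<^sub>R ?t) \<bullet> ?t" for s
  have "DERIV \<phi> s :> 0" for s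
    using dir_deriv_line[OF inner_vec_polys[OF v, of ?t], of y ?t s] strain[of "y + s *\<^sub>R ?t" ?t]
    by (simp add: \<phi>_def[abs_def] b_def)
  then have "\<phi> 1 = \<phi> 0" using DERIV_isconst_all[of \<phi> 1 0] by blast
  then show ?thesis by (simp add: \<phi>_def inner_diff_left)
qed

end

text \<open>The difference \<open>w = v - v 0\<close> satisfies \<open>w x \<bullet> y = - (w y \<bullet> x)\<close>, so its value at any \<open>x\<close> is determined by
  its values at the unit vectors, which are the columns of a skew-symmetric matrix. The functionals
  at the diagonal pairs, where this matrix is zero, are the components of \<open>v 0\<close>.\<close>

lemma dim_rigid_le:
  fixes W :: "(real^'n \<Rightarrow> real^'n) set"
  assumes "subspace W" "fin_dim W" and rigid: "\<And>v x y. v \<in> W \<Longrightarrow> (v x - v y) \<bullet> (x - y) = 0"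
  shows "dim W \<le> (CARD('n) + 1) choose 2"
proof -
  obtain P :: "('n \<times> 'n) set" where P: "card P = (CARD('n) + 1) choose 2"
    "\<forall>a\<in>UNIV. \<forall>b\<in>UNIV. (a, b) \<in> P \<or> (b, a) \<in> P"
    using unordered_pairs_exist[OF finite[of "UNIV :: 'n set"]] by (elim exE conjE)
  define \<phi> where "\<phi> = (\<lambda>(i, j) (v :: real^'n \<Rightarrow> real^'n).
    if i = j then v 0 $ i else (v (axis j 1) - v 0) $ i)"
  have "dim W \<le> card P"
  proof (rule dim_le_card_separating_functionals[where \<phi> = \<phi>])
    show "linear_on W (\<phi> e)" for e
      by (rule linear_onI) (cases e; simp add: \<phi>_def scaleR_fun_apply algebra_simps)+
    fix v assume v: "v \<in> W" "\<forall>e\<in>P. \<phi> e v = 0"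
    define w where "w x = v x - v 0" for x
    have self: "w x \<bullet> x = 0" for x using rigid[OF v(1), of x 0] by (simp add: w_def)
    have skew: "w x \<bullet> y = - (w y \<bullet> x)" for x y
      using rigid[OF v(1), of x y] self[of x] self[of y]
      by (simp add: w_def inner_diff_left inner_diff_right algebra_simps)
    have v0: "v 0 $ i = 0" for i using v(2) P(2)[rule_format, of i i] by (auto simp: \<phi>_def)
    have wax: "w (axis j 1) $ i = - w (axis i 1) $ j" for i j
      using skew[of "axis j 1" "axis i 1"] by (simp add: inner_axis)
    have we: "w (axis j 1) $ i = 0" for i j
    proof (cases "i = j")
      case True
      then show ?thesis using wax[of j j] by simp
    next
      case False
      then show ?thesis
        using v(2) P(2)[rule_format, of i j] wax[of j i] by (auto simp: \<phi>_def w_def)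
    qed
    have "w x $ i = 0" for x i
    proof -
      have "w (axis i 1) = 0" using we by (simp add: vec_eq_iff)
      then show ?thesis using skew[of x "axis i 1"] by (simp add: inner_axis)
    qed
    then show "v = 0" using v0 by (simp add: fun_eq_iff vec_eq_iff w_def)
  qed (use assms finite_subset[of P UNIV] in auto)
  then show ?thesis using P(1) by simp
qed

context simplex_coords
begin

text \<open>The test field is the bubble field on one edge whose coefficient is the strain of \<open>v\<close> along this
  edge. Integration by parts shows that the square of the strain has a vanishing weighted integral.\<close>

lemma orthogonal_to_div_bubbles_rigid:
  assumes v: "v \<in> vec_polys {..CARD('n)}"
    and orth: "\<And>\<tau>. \<tau> \<in> bubbles \<Longrightarrow> intK (\<lambda>x. row_div \<tau> x \<bullet> v x) = 0"
  shows "(v x - v y) \<bullet> (x - y) = 0"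
proof (rule rigid_if_edge_strains_vanish[OF v])
  fix e x assume e: "e \<in> edges"
  define s where "s e = dir_deriv (fst e - snd e) (\<lambda>y. v y \<bullet> (fst e - snd e))" for e
  have s: "s e \<in> polys {..CARD('n) - 1}" for e
    unfolding s_def by (intro polys_dir_deriv_le inner_vec_polys[OF v])
  define q where "q e' = (if e' = e then s e else (\<lambda>_. 0))" for e'
  have q: "q e' \<in> polys {..CARD('n) - 1}" for e' using s by (simp add: q_def)
  have "0 = - intK (\<lambda>x. row_div (edge_field (\<lambda>e x. edge_bubble e x * q e x)) x \<bullet> v x)"
    using orth[OF edge_field_in_bubbles[OF q]] by simp
  also have "\<dots> = (\<Sum>e'\<in>edges. intK (\<lambda>x. edge_bubble e' x * q e' x * s e' x))"
    by (simp add: integration_by_parts[OF q v] s_def)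
  also have "\<dots> = (\<Sum>e'\<in>edges. if e' = e then intK (\<lambda>x. edge_bubble e x * s e x * s e x) else 0)"
    by (intro sum.cong) (auto simp: q_def)
  finally have int0: "intK (\<lambda>x. edge_bubble e x * s e x * s e x) = 0" using e by simp
  have ends: "fst e \<in> C" "snd e \<in> C"
    using edge_endpoints[of "fst e" "snd e"] e by auto
  have "s e x = 0"
  proof (rule polys_eq_0_everywhere[OF s])
    fix x assume pos: "\<forall>v\<in>C. 0 < lam v x"
    have "edge_bubble e x * s e x * s e x = 0"
    proof (rule intK_nonneg_eq_0[OF _ _ int0 pos])
      show "continuous_on UNIV (\<lambda>x. edge_bubble e x * s e x * s e x)"
        using polys_continuous[OF edge_bubble_polys[OF e]] polys_continuous[OF s]
        by (intro continuous_on_mult)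
      show "0 \<le> edge_bubble e y * s e y * s e y" if "y \<in> convex hull C" for y
        using that ends by (simp add: edge_bubble_def mem_hull_iff mult.assoc)
    qed
    moreover have "0 < edge_bubble e x" using pos ends by (simp add: edge_bubble_def)
    ultimately show "s e x = 0" by simp
  qed
  then show "dir_deriv (fst e - snd e) (\<lambda>y. v y \<bullet> (fst e - snd e)) x = 0" by (simp add: s_def)
qed

text \<open>In the space of vector polynomials of degree at most \<open>n\<close>, the orthogonal complement of the
  divergences of bubble fields consists of infinitesimal rigid motions.\<close>

lemma dim_div_bubbles_ge:
  "CARD('n) * ((2 * CARD('n)) choose CARD('n)) \<le> dim (row_div ` bubbles) + ((CARD('n) + 1) choose 2)"
proof -
  let ?Y = "vec_polys {..CARD('n)} :: (real^'n \<Rightarrow> real^'n) set"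
  have lin: "linear_on bubbles row_div"
    using linear_on_row_div bubbles_subset by (rule linear_on_subset)
  have imY: "row_div ` bubbles \<subseteq> ?Y"
  proof
    fix r assume "r \<in> row_div ` bubbles"
    then obtain \<tau> where \<tau>: "\<tau> \<in> sym_polys {..CARD('n) + 1}" "r = row_div \<tau>"
      using bubbles_subset by blast
    show "r \<in> ?Y" unfolding \<tau>(2) by (rule row_div_in_vec_polys[OF \<tau>(1)]) auto
  qed
  have "fin_dim (row_div ` bubbles)"
    using fin_dim_bubbles subspace_bubbles lin by (rule fin_dim_image)
  from fin_dim_basis[OF this] obtain B where B: "finite B" "B \<subseteq> row_div ` bubbles"
    "row_div ` bubbles \<subseteq> span B" "card B = dim (row_div ` bubbles)" by blast
  define \<phi> where "\<phi> b v = intK (\<lambda>x. b x \<bullet> v x)" for b v :: "real^'n \<Rightarrow> real^'n"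
  have cont: "continuous_on UNIV (\<lambda>x. f x \<bullet> g x)" if "f \<in> ?Y" "g \<in> ?Y" for f g
    using that continuous_vec_polys by (intro continuous_on_inner)
  have add: "intK (\<lambda>x. f x \<bullet> (g x + h x)) = intK (\<lambda>x. f x \<bullet> g x) + intK (\<lambda>x. f x \<bullet> h x)"
    if "f \<in> ?Y" "g \<in> ?Y" "h \<in> ?Y" for f g h
    unfolding inner_add_right using cont that by (intro intK_add)
  have lin\<phi>: "linear_on ?Y (\<phi> b)" if "b \<in> B" for b
    using that B(2) imY by (intro linear_onI)
      (auto simp: \<phi>_def scaleR_fun_apply intK_scale intro!: add)
  let ?W = "{v \<in> ?Y. \<forall>b\<in>B. \<phi> b v = 0}"
  have "subspace ?W"
  proof -
    have "?W = ?Y \<inter> (\<Inter>b\<in>B. {v \<in> ?Y. \<phi> b v = 0})" by auto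
    also have "subspace \<dots>"
      using lin\<phi> by (intro subspace_inter subspace_Inter) (auto intro!: subspace_kernel_on)
    finally show ?thesis .
  qed
  have "dim ?W \<le> (CARD('n) + 1) choose 2"
  proof (rule dim_rigid_le[OF \<open>subspace ?W\<close>])
    show "fin_dim ?W" by (rule fin_dim_subset[of ?Y]) auto
    fix v x y assume v: "v \<in> ?W"
    have "span B \<subseteq> {b \<in> ?Y. \<phi> b v = 0}"
    proof (rule span_minimal)
      show "B \<subseteq> {b \<in> ?Y. \<phi> b v = 0}" using v B(2) imY by auto
      have "linear_on ?Y (\<lambda>b. \<phi> b v)"
        using v by (intro linear_onI)
          (auto simp: \<phi>_def scaleR_fun_apply intK_scale inner_commute[of _ "v _"] intro!: add)
      then show "subspace {b \<in> ?Y. \<phi> b v = 0}" by (rule subspace_kernel_on) simp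
    qed
    then have "intK (\<lambda>x. row_div \<tau> x \<bullet> v x) = 0" if "\<tau> \<in> bubbles" for \<tau>
      using that B(3) by (auto simp: \<phi>_def)
    then show "(v x - v y) \<bullet> (x - y) = 0"
      using v by (intro orthogonal_to_div_bubbles_rigid) auto
  qed
  moreover have "dim ?Y \<le> dim ?W + card B"
    using B(1) lin\<phi> by (intro dim_le_dim_kernel_functionals) auto
  moreover have "CARD('n) * ((2 * CARD('n)) choose CARD('n)) \<le> dim ?Y"
    using dim_vec_polys_ge[where 'n='n, of "{..CARD('n)}"] card_exponents[where 'n='n, of "CARD('n)"]
    by (simp add: mult_2)
  ultimately show ?thesis using B(4) by linarith
qed

lemma hull_facet:
  assumes "u \<in> C"
  shows "convex hull (C - {u}) facet_of convex hull C"
    and "grd u \<in> normal_vectors (convex hull (C - {u}))"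
proof -
  have "C - {u} \<noteq> {}"
    using assms card_C card_Suc_Diff1[OF finite_C assms] zero_less_card_finite[where 'a='n] by force
  then show "convex hull (C - {u}) facet_of convex hull C"
    using assms by (auto simp: facet_of_convex_hull_affine_independent[OF affine_independent_C])
  have lu: "lam u x = 0" if "x \<in> convex hull (C - {u})" for x
    using that assms mem_hull_iff[of "C - {u}" x] by auto
  have "grd u \<bullet> y = 0" if "y \<in> tangent_vectors (convex hull (C - {u}))" for y
    using that unfolding tangent_vectors_def
  proof (induction rule: span_induct_alt)
    case (step c z y)
    then obtain a b where "z = a - b" "a \<in> convex hull (C - {u})" "b \<in> convex hull (C - {u})" by auto
    then show ?case using step lu grd_inner_diff[OF assms, of a b] by (simp add: inner_add_right)
  qed simp
  then show "grd u \<in> normal_vectors (convex hull (C - {u}))"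
    by (auto simp: normal_vectors_def orthogonal_comp_def orthogonal_def inner_commute)
qed

lemma row_div_eq_0_everywhere:
  assumes "\<tau> \<in> sym_polys {..m}" "\<And>x. \<forall>v\<in>C. 0 < lam v x \<Longrightarrow> row_div \<tau> x = 0"
  shows "row_div \<tau> = 0"
proof -
  have "row_div \<tau> \<in> vec_polys {..m}"
    by (rule row_div_in_vec_polys[OF assms(1)]) auto
  then have "(\<lambda>x. row_div \<tau> x $ i) \<in> polys {..m}" for i by (simp add: vec_polys_def)
  then have "row_div \<tau> x $ i = 0" for x i
    by (rule polys_eq_0_everywhere) (simp add: assms(2))
  then show ?thesis by (simp add: fun_eq_iff vec_eq_iff)
qed

lemma M2_subset_bubbles: "M2 (convex hull C) \<subseteq> {\<tau> \<in> bubbles. row_div \<tau> = 0}"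
proof
  fix \<tau> assume \<tau>: "\<tau> \<in> M2 (convex hull C)"
  then have s: "\<tau> \<in> sym_polys {..CARD('n) + 1}"
    using P2star_subset by (auto simp: M2_def)
  have "row_div \<tau> = 0"
    using \<tau> by (intro row_div_eq_0_everywhere[OF s]) (auto simp: M2_def mem_hull_iff less_imp_le)
  moreover have "\<tau> x *v grd u = 0" if "u \<in> C" "x \<in> convex hull (C - {u})" for u x
    using \<tau> that hull_facet[OF that(1)] by (auto simp: M2_def)
  ultimately show "\<tau> \<in> {\<tau> \<in> bubbles. row_div \<tau> = 0}" using s by (simp add: bubbles_def)
qed

lemma fin_dim_M2: "fin_dim (M2 (convex hull C))"
  using fin_dim_subset[OF fin_dim_bubbles] M2_subset_bubbles by blast

text \<open>Rank and nullity of the divergence on the bubble fields.\<close>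

lemma dim_M2_le:
  "dim (M2 (convex hull C)) + CARD('n) * ((2 * CARD('n)) choose CARD('n))
    \<le> ((CARD('n) + 1) choose 2) * ((2 * CARD('n) - 1) choose CARD('n)) + ((CARD('n) + 1) choose 2)"
proof -
  have lin: "linear_on bubbles row_div"
    using linear_on_row_div bubbles_subset by (rule linear_on_subset)
  have "dim (M2 (convex hull C)) \<le> dim {\<tau> \<in> bubbles. row_div \<tau> = 0}"
    by (rule dim_mono_fin[OF _ M2_subset_bubbles]) (rule fin_dim_subset[OF fin_dim_bubbles], auto)
  moreover have "dim {\<tau> \<in> bubbles. row_div \<tau> = 0} + dim (row_div ` bubbles) \<le> dim bubbles"
    by (rule dim_kernel_add_dim_image_le[OF fin_dim_bubbles subspace_bubbles lin])
  ultimately show ?thesis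
    using dim_div_bubbles_ge dim_bubbles_le by linarith
qed

end

section \<open>Vanishing degrees of freedom\<close>

lemma polys_degree_0_const: "p \<in> polys {..0} \<Longrightarrow> p x = p y"
proof (induction p rule: polys_induct)
  case (monomial \<alpha>)
  then have "\<alpha> i = 0" for i by (simp add: exponents_def)
  then show ?case by (simp add: monomial_fun_def)
qed simp_all

lemma continuous_sym_polys:
  assumes "\<tau> \<in> sym_polys D"
  shows "continuous_on S \<tau>"
proof -
  have "(\<lambda>x. \<tau> x $ i $ j) \<in> polys D" for i j
    using assms by (simp add: sym_polys_def)
  then have "continuous_on S (\<lambda>x. \<chi> i j. \<tau> x $ i $ j)"
    by (intro continuous_on_vec_lambda polys_continuous)
  then show ?thesis by simp
qed

lemma trace_polys:
  assumes "\<tau> \<in> sym_polys D"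
  shows "(\<lambda>x. s \<bullet> (\<tau> x *v \<nu>)) \<in> polys D"
proof -
  have "(\<lambda>x. \<Sum>i\<in>UNIV. s $ i * (\<Sum>j\<in>UNIV. \<nu> $ j * \<tau> x $ i $ j)) \<in> polys D"
    using assms by (intro polys_sum polys_scale) (simp add: sym_polys_def)
  then show ?thesis by (simp add: inner_vec_def matrix_vector_mult_def mult.commute)
qed

lemma continuous_polys_on:
  assumes "q \<in> polys_on m F"
  shows "continuous_on F q"
proof -
  obtain p where p: "p \<in> polys {..m}" "q = (\<lambda>x. if x \<in> F then p x else 0)"
    using assms by (auto simp: polys_on_def)
  show ?thesis unfolding p(2)
    by (rule continuous_on_eq[OF polys_continuous[OF p(1)]]) simp
qed

context simplex_coords
begin

lemma grd_tangent:
  assumes "S \<subseteq> C" "v \<in> C - S" "t \<in> tangent_vectors (convex hull S)"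
  shows "grd v \<bullet> t = 0"
  using assms(3) unfolding tangent_vectors_def
proof (induction rule: span_induct_alt)
  case (step c z y)
  then obtain a b where "z = a - b" "a \<in> convex hull S" "b \<in> convex hull S" by auto
  then show ?case
    using step assms(2) grd_inner_diff[of v a b] mem_hull_iff[OF assms(1)] by (simp add: inner_add_right)
qed simp

lemma face_neighbourhood_nonzero:
  assumes S: "S \<subseteq> C" and x: "\<forall>v\<in>S. 0 < lam v x" "\<forall>v\<in>C - S. lam v x = 0" and e: "0 < e"
  shows "emeasure (flat_measure (convex hull S)) (ball x e \<inter> convex hull S) \<noteq> 0"
proof -
  define U where "U = ball x e \<inter> (\<Inter>v\<in>S. {y. 0 < lam v y})"
  have "open {y. 0 < lam v y}" if "v \<in> S" for v
    using polys_continuous[OF lam_polys[of v]] that S by (intro open_Collect_less) auto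
  then have "open U"
    unfolding U_def using finite_subset_C[OF S] by (intro open_Int open_INT) auto
  moreover have "x \<in> U" using x e by (simp add: U_def)
  ultimately obtain d where d: "0 < d" "ball x d \<subseteq> U" using open_contains_ball by blast
  show ?thesis
  proof (rule flat_measure_neighbourhood_nonzero[OF _ d(1)])
    show "x \<in> convex hull S" using x by (simp add: mem_hull_iff[OF S] less_imp_le)
    have "compact (convex hull S)"
      using finite_subset_C[OF S] by (simp add: finite_imp_compact_convex_hull)
    then show "ball x e \<inter> convex hull S \<in> sets borel"
      by (intro sets.Int) (simp_all add: borel_compact)
    fix z assume z: "z - x \<in> tangent_vectors (convex hull S)" "norm (z - x) < d"
    have "z \<in> U" using z(2) d(2) by (auto simp: dist_norm norm_minus_commute)
    moreover have "lam v z = 0" if "v \<in> C - S" for v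
      using grd_tangent[OF S that z(1)] grd_inner_diff[of v z x] that x(2) by simp
    ultimately show "z \<in> ball x e \<inter> convex hull S"
      by (auto simp: U_def mem_hull_iff[OF S] less_imp_le)
  qed
qed

lemma interior_point_exists:
  assumes "S \<subseteq> C" "S \<noteq> {}"
  shows "\<exists>x. (\<forall>v\<in>S. 0 < lam v x) \<and> (\<forall>v\<in>C - S. lam v x = 0)"
proof -
  have "0 < card S" using assms finite_subset_C by (simp add: card_gt_0_iff)
  then have "(\<Sum>v\<in>S. 1 / real (card S)) = 1" by simp
  from lam_vertex_combination[OF _ assms(1) this] \<open>0 < card S\<close> assms(1)
  show ?thesis by (intro exI[of _ "\<Sum>v\<in>S. (1 / real (card S)) *\<^sub>R v"]) auto
qed

lemma face_measure:
  assumes "S \<subseteq> C" "S \<noteq> {}"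
  shows "compact (convex hull S)" "emeasure (flat_measure (convex hull S)) (convex hull S) < \<infinity>"
    "measure (flat_measure (convex hull S)) (convex hull S) \<noteq> 0"
proof -
  let ?F = "convex hull S"
  show c: "compact ?F"
    using finite_subset_C[OF assms(1)] by (simp add: finite_imp_compact_convex_hull)
  then show fin: "emeasure (flat_measure ?F) ?F < \<infinity>"
    using assms(2) by (intro flat_measure_bounded_finite) (auto simp: borel_compact compact_imp_bounded)
  obtain x where x: "\<forall>v\<in>S. 0 < lam v x" "\<forall>v\<in>C - S. lam v x = 0"
    using interior_point_exists[OF assms] by blast
  have "emeasure (flat_measure ?F) (ball x 1 \<inter> ?F) \<le> emeasure (flat_measure ?F) ?F"
    using c by (intro emeasure_mono) (auto simp: borel_compact)
  then have "emeasure (flat_measure ?F) ?F \<noteq> 0"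
    using face_neighbourhood_nonzero[OF assms(1) x, of 1] by auto
  then show "measure (flat_measure ?F) ?F \<noteq> 0"
    using fin by (auto simp: measure_def enn2real_eq_0_iff)
qed

lemma face_integrable:
  fixes f :: "real^'n \<Rightarrow> real"
  assumes "S \<subseteq> C" "S \<noteq> {}" "continuous_on (convex hull S) f"
  shows "set_integrable (flat_measure (convex hull S)) (convex hull S) f"
  by (rule integrable_continuous_compact_finite[OF sets_flat_measure face_measure(1,2)[OF assms(1,2)] assms(3)])

text \<open>Since \<open>g\<close> vanishes on the boundary of the face, it is the product of the barycentric coordinates
  of the face and a cofactor whose degree makes it an admissible test function. Against this
  cofactor the integrand is nonnegative.\<close>

lemma zero_on_face_if_moments_vanish:
  assumes S: "S \<subseteq> C" "S \<noteq> {}" and g: "g \<in> polys {..m}" "0 < m"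
    and bdry: "\<And>v x. v \<in> S \<Longrightarrow> x \<in> convex hull (S - {v}) \<Longrightarrow> g x = 0"
    and moments: "\<And>q. q \<in> polys_on (m - card S) (convex hull S) \<Longrightarrow>
      (LINT x:convex hull S|flat_measure (convex hull S). g x * q x) = 0"
    and x: "x \<in> convex hull S"
  shows "g x = 0"
proof -
  let ?F = "convex hull S"
  have "\<exists>q\<in>polys {..m - card S}. \<forall>x. (\<forall>v\<in>C - S. lam v x = 0) \<longrightarrow> g x = (\<Prod>v\<in>S. lam v x) * q x"
    by (rule polys_divisible_on_face[OF S order_refl g]) (rule bdry)
  then obtain q where q: "q \<in> polys {..m - card S}"
    and gq: "\<And>x. \<forall>v\<in>C - S. lam v x = 0 \<Longrightarrow> g x = (\<Prod>v\<in>S. lam v x) * q x"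
    by blast
  define q' where "q' x = (if x \<in> ?F then q x else 0)" for x
  have "q' \<in> polys_on (m - card S) ?F"
    unfolding polys_on_def using q by (intro image_eqI[of _ _ q]) (auto simp: q'_def)
  from moments[OF this] have "(LINT x:?F|flat_measure ?F. g x * q' x) = 0" .
  moreover have "(LINT x:?F|flat_measure ?F. g x * q' x) = (LINT x:?F|flat_measure ?F. g x * q x)"
    unfolding set_lebesgue_integral_def
    by (intro Bochner_Integration.integral_cong refl) (simp add: q'_def indicator_def)
  ultimately have int0: "(LINT x:?F|flat_measure ?F. g x * q x) = 0" by simp
  have g0: "g y = 0" if y: "\<forall>v\<in>S. 0 < lam v y" "\<forall>v\<in>C - S. lam v y = 0" for y
  proof -
    have "g y * q y = 0"
    proof (rule integral_nonneg_eq_0_imp_eq_0[of "flat_measure ?F" ?F])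
      show "continuous_on ?F (\<lambda>x. g x * q x)"
        using polys_continuous[OF g(1)] polys_continuous[OF q] by (rule continuous_on_mult)
      show "0 \<le> g z * q z" if "z \<in> ?F" for z
      proof -
        have "g z * q z = (\<Prod>v\<in>S. lam v z) * (q z * q z)"
          using gq[of z] that by (simp add: mem_hull_iff[OF S(1)] mult.assoc)
        moreover have "0 \<le> (\<Prod>v\<in>S. lam v z)"
          using that by (intro prod_nonneg) (simp add: mem_hull_iff[OF S(1)])
        ultimately show ?thesis by (metis mult_nonneg_nonneg zero_le_square)
      qed
      show "y \<in> ?F" using y by (simp add: mem_hull_iff[OF S(1)] less_imp_le)
      show "emeasure (flat_measure ?F) (ball y e \<inter> ?F) \<noteq> 0" if "0 < e" for e
        using face_neighbourhood_nonzero[OF S(1) y that] .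
    qed (use face_measure[OF S] int0 in auto)
    then show "g y = 0" using gq[OF y(2)] by auto
  qed
  show ?thesis
    by (rule polys_eq_0_on_face[OF S g(1) g0]) (use x in \<open>auto simp: mem_hull_iff[OF S(1)]\<close>)
qed

lemma affine_independent_subset: "S \<subseteq> C \<Longrightarrow> \<not> affine_dependent S"
  using affine_independent_C affine_dependent_subset by blast

lemma subsimplices_eq:
  "subsimplices l (convex hull C) = (\<lambda>S. convex hull S) ` {S. S \<subseteq> C \<and> card S = l + 1}"
proof
  show "subsimplices l (convex hull C) \<subseteq> (\<lambda>S. convex hull S) ` {S. S \<subseteq> C \<and> card S = l + 1}"
  proof
    fix F assume F: "F \<in> subsimplices l (convex hull C)"
    then obtain S where S: "S \<subseteq> C" "F = convex hull S"
      using face_of_convex_hull_affine_independent[OF affine_independent_C] by (auto simp: subsimplices_def)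
    have "int l simplex F" using F by (simp add: subsimplices_def)
    then have "aff_dim F = int l" by (rule aff_dim_simplex)
    then have "int (card S) = int l + 1"
      using aff_dim_affine_independent[OF affine_independent_subset[OF S(1)]] S(2)
      by (simp add: aff_dim_convex_hull)
    then have "card S = l + 1" by linarith
    then show "F \<in> (\<lambda>S. convex hull S) ` {S. S \<subseteq> C \<and> card S = l + 1}" using S by blast
  qed
next
  show "(\<lambda>S. convex hull S) ` {S. S \<subseteq> C \<and> card S = l + 1} \<subseteq> subsimplices l (convex hull C)"
  proof
    fix F assume "F \<in> (\<lambda>S. convex hull S) ` {S. S \<subseteq> C \<and> card S = l + 1}"
    then obtain S where S: "S \<subseteq> C" "card S = l + 1" "F = convex hull S" by blast
    have "F face_of convex hull C"
      using S face_of_convex_hull_affine_independent[OF affine_independent_C] by blast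
    moreover have "int l simplex F"
      unfolding simplex_def using S affine_independent_subset[OF S(1)] by (intro exI[of _ S]) simp
    ultimately show "F \<in> subsimplices l (convex hull C)" by (simp add: subsimplices_def)
  qed
qed

lemma card_subsimplices_le:
  "card (subsimplices l (convex hull C)) \<le> (CARD('n) + 1) choose (l + 1)"
  and finite_subsimplices: "finite (subsimplices l (convex hull C))"
proof -
  have fin: "finite {S. S \<subseteq> C \<and> card S = l + 1}" by simp
  have "card (subsimplices l (convex hull C)) \<le> card {S. S \<subseteq> C \<and> card S = l + 1}"
    unfolding subsimplices_eq by (rule card_image_le[OF fin])
  also have "\<dots> = (CARD('n) + 1) choose (l + 1)"
    using n_subsets[OF finite_C, of "l + 1"] by (simp add: card_C)
  finally show "card (subsimplices l (convex hull C)) \<le> (CARD('n) + 1) choose (l + 1)" .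
  show "finite (subsimplices l (convex hull C))"
    unfolding subsimplices_eq using fin by (rule finite_imageI)
qed

lemma dim_tangent_le:
  assumes "S \<subseteq> C" "S \<noteq> {}"
  shows "dim (tangent_vectors (convex hull S)) \<le> card S - 1"
proof -
  let ?F = "convex hull S"
  obtain a where a: "a \<in> S" using assms(2) by blast
  let ?G = "(\<lambda>x. - a + x) ` ?F"
  have "{x - y |x y. x \<in> ?F \<and> y \<in> ?F} \<subseteq> span ?G"
  proof
    fix z assume "z \<in> {x - y |x y. x \<in> ?F \<and> y \<in> ?F}"
    then obtain x y where xy: "z = (- a + x) - (- a + y)" "x \<in> ?F" "y \<in> ?F" by auto
    then show "z \<in> span ?G" by (simp only: xy(1)) (intro span_diff span_base imageI xy(2,3))
  qed
  then have "tangent_vectors ?F \<subseteq> span ?G"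
    unfolding tangent_vectors_def by (rule span_minimal) simp
  then have "dim (tangent_vectors ?F) \<le> dim ?G" by (rule dim_mono)
  moreover have "aff_dim ?F = int (dim ?G)"
    using a by (intro aff_dim_eq_dim) (simp add: hull_inc)
  moreover have "aff_dim ?F = int (card S) - 1"
    using aff_dim_affine_independent[OF affine_independent_subset[OF assms(1)]]
    by (simp add: aff_dim_convex_hull)
  ultimately show ?thesis by linarith
qed

end

text \<open>The dimensions of the tangent and the normal space add up to \<open>n\<close>, so both bases span.\<close>

lemma tangent_normal_bases_span:
  fixes F :: "(real^'n) set"
  assumes T: "T \<subseteq> tangent_vectors F" "independent T" "card T = l"
    and N: "N \<subseteq> normal_vectors F" "independent N" "card N = CARD('n) - l"
    and dim: "dim (tangent_vectors F) \<le> l"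
  shows "normal_vectors F \<subseteq> span N" "\<And>z. \<forall>s\<in>T \<union> N. s \<bullet> z = 0 \<Longrightarrow> z = 0"
proof -
  have sub: "subspace (tangent_vectors F)" by (simp add: tangent_vectors_def)
  have spT: "tangent_vectors F \<subseteq> span T"
    using T dim by (intro card_ge_dim_independent) auto
  then have "dim (tangent_vectors F) = l"
    using T basis_card_eq_dim by metis
  then have "dim (normal_vectors F) + l = CARD('n)"
    using dim_subspace_orthogonal_to_vectors[OF sub subspace_UNIV subset_UNIV]
    by (simp add: normal_vectors_def orthogonal_comp_def)
  then show spN: "normal_vectors F \<subseteq> span N"
    using N by (intro card_ge_dim_independent) auto
  fix z assume z: "\<forall>s\<in>T \<union> N. s \<bullet> z = 0"
  have sub0: "subspace {s. s \<bullet> z = 0}" by (auto simp: subspace_def inner_add_left)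
  have "span T \<subseteq> {s. s \<bullet> z = 0}" using z by (intro span_minimal[OF _ sub0]) auto
  then have "z \<in> normal_vectors F"
    using spT by (auto simp: normal_vectors_def orthogonal_comp_def orthogonal_def)
  moreover have "span N \<subseteq> {s. s \<bullet> z = 0}" using z by (intro span_minimal[OF _ sub0]) auto
  ultimately have "z \<bullet> z = 0" using spN by auto
  then show "z = 0" by simp
qed

context simplex_coords
begin

text \<open>Induction on the dimension of the face. The normal vectors of a face are also normal to its
  subfaces, so the induction hypothesis gives zero boundary values.\<close>

lemma normal_traces_vanish:
  assumes \<tau>: "\<tau> \<in> sym_polys {..CARD('n) + 1}"
    and bases: "\<And>S. S \<subseteq> C \<Longrightarrow> S \<noteq> {} \<Longrightarrow> card S \<le> CARD('n) \<Longrightarrow>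
      N S \<subseteq> normal_vectors (convex hull S) \<and> normal_vectors (convex hull S) \<subseteq> span (N S)
      \<and> (\<forall>z. (\<forall>s\<in>T S \<union> N S. s \<bullet> z = 0) \<longrightarrow> z = 0)"
    and moments: "\<And>S s \<nu> q. S \<subseteq> C \<Longrightarrow> S \<noteq> {} \<Longrightarrow> card S \<le> CARD('n) \<Longrightarrow> s \<in> T S \<union> N S \<Longrightarrow> \<nu> \<in> N S \<Longrightarrow>
      q \<in> polys_on (CARD('n) + 1 - card S) (convex hull S) \<Longrightarrow>
      (LINT x:convex hull S|flat_measure (convex hull S). (s \<bullet> (\<tau> x *v \<nu>)) * q x) = 0"
  shows "S \<subseteq> C \<Longrightarrow> S \<noteq> {} \<Longrightarrow> card S \<le> CARD('n) \<Longrightarrow> x \<in> convex hull S \<Longrightarrow>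
    \<nu> \<in> normal_vectors (convex hull S) \<Longrightarrow> \<tau> x *v \<nu> = 0"
proof (induction "card S" arbitrary: S x \<nu> rule: less_induct)
  case less
  note S = less.prems(1,2,3)
  have "finite S" using finite_subset_C[OF S(1)] .
  have basis: "\<tau> y *v \<mu> = 0" if y: "y \<in> convex hull S" and \<mu>: "\<mu> \<in> N S" for y \<mu>
  proof -
    have "s \<bullet> (\<tau> y *v \<mu>) = 0" if s: "s \<in> T S \<union> N S" for s
    proof (rule zero_on_face_if_moments_vanish[OF S(1,2) trace_polys[OF \<tau>] _ _ _ y])
      fix v z assume v: "v \<in> S" and z: "z \<in> convex hull (S - {v})"
      have "S - {v} \<noteq> {}"
      proof
        assume e: "S - {v} = {}"
        show False using z unfolding e by simp
      qed
      have "convex hull (S - {v}) \<subseteq> convex hull S" by (intro hull_mono) auto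
      then have "tangent_vectors (convex hull (S - {v})) \<subseteq> tangent_vectors (convex hull S)"
        unfolding tangent_vectors_def by (intro span_mono) blast
      then have "normal_vectors (convex hull S) \<subseteq> normal_vectors (convex hull (S - {v}))"
        unfolding normal_vectors_def by (rule orthogonal_comp_anti_mono)
      moreover have "\<mu> \<in> normal_vectors (convex hull S)" using bases[OF S] \<mu> by blast
      moreover have "card (S - {v}) < card S" by (rule card_Diff1_less[OF \<open>finite S\<close> v])
      ultimately have "\<tau> z *v \<mu> = 0"
        using S \<open>S - {v} \<noteq> {}\<close> z by (intro less.hyps[of "S - {v}"]) auto
      then show "s \<bullet> (\<tau> z *v \<mu>) = 0" by simp
    qed (use moments[OF S s \<mu>] in auto)
    then show ?thesis using bases[OF S] by blast
  qed
  have "subspace {\<mu>. \<tau> x *v \<mu> = 0}"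
    by (auto simp: subspace_def matrix_vector_right_distrib matrix_vector_mult_scaleR)
  then have "span (N S) \<subseteq> {\<mu>. \<tau> x *v \<mu> = 0}"
    using basis less.prems(4) by (intro span_minimal) auto
  then show ?case using bases[OF S] less.prems(5) by blast
qed

text \<open>The divergence of \<open>\<tau>\<close> is affine, so it may serve as the test field in the integration by
  parts, where its gradient is constant.\<close>

lemma bubble_with_zero_average_div_free:
  assumes \<tau>: "\<tau> \<in> bubbles" and div: "row_div \<tau> \<in> vec_polys {..1}"
    and avg: "\<And>i j. intK (\<lambda>x. \<tau> x $ i $ j) = 0"
  shows "row_div \<tau> = 0"
proof -
  let ?v = "row_div \<tau>"
  let ?t = "\<lambda>e. fst e - snd e :: real^'n"
  obtain q where q: "\<forall>e\<in>edges. q e \<in> polys {..CARD('n) - 1}"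
    and \<tau>q: "\<tau> = edge_field (\<lambda>e x. edge_bubble e x * q e x)"
    using bubbles_representation[OF \<tau>] by blast
  define G where "G k l = dir_deriv (axis l 1) (\<lambda>y. ?v y $ k) 0" for k l
  have comp: "(\<lambda>y. ?v y $ k) \<in> polys {..1}" for k using div by (simp add: vec_polys_def)
  have strain: "dir_deriv t (\<lambda>y. ?v y \<bullet> t) x = (\<Sum>k\<in>UNIV. \<Sum>l\<in>UNIV. G k l * (t $ k * t $ l))" for t x
  proof -
    have "dir_deriv t (\<lambda>y. ?v y \<bullet> t) x = dir_deriv t (\<lambda>y. \<Sum>k\<in>UNIV. t $ k * ?v y $ k) x"
      by (simp add: inner_vec_def mult.commute)
    also have "\<dots> = (\<Sum>k\<in>UNIV. dir_deriv t (\<lambda>y. t $ k * ?v y $ k) x)"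
      by (rule dir_deriv_sum) (rule polys_differentiable[OF polys_scale[OF comp]])
    also have "\<dots> = (\<Sum>k\<in>UNIV. t $ k * dir_deriv t (\<lambda>y. ?v y $ k) x)"
      by (intro sum.cong refl dir_deriv_scale polys_differentiable[OF comp])
    also have "\<dots> = (\<Sum>k\<in>UNIV. t $ k * (\<Sum>l\<in>UNIV. t $ l * G k l))"
    proof (intro sum.cong refl arg_cong2[of _ _ _ _ "(*)"])
      fix k
      have "dir_deriv (axis l 1) (\<lambda>y. ?v y $ k) x = G k l" for l
        unfolding G_def using polys_dir_deriv_le[OF comp, of "axis l 1" k] by (intro polys_degree_0_const) simp
      then show "dir_deriv t (\<lambda>y. ?v y $ k) x = (\<Sum>l\<in>UNIV. t $ l * G k l)"
        by (simp add: dir_deriv_components[OF polys_differentiable[OF comp], of t])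
    qed
    finally show ?thesis by (simp add: sum_distrib_left mult_ac)
  qed
  have ebq: "(\<lambda>x. edge_bubble e x * q e x) \<in> polys {..2 + (CARD('n) - 1)}" if "e \<in> edges" for e
    using edge_bubble_polys[OF that] q that by (intro polys_mult) auto
  have "(\<Sum>e\<in>edges. intK (\<lambda>x. edge_bubble e x * q e x * dir_deriv (?t e) (\<lambda>y. ?v y \<bullet> ?t e) x))
      = (\<Sum>e\<in>edges. (\<Sum>k\<in>UNIV. \<Sum>l\<in>UNIV. G k l * (?t e $ k * ?t e $ l)) * intK (\<lambda>x. edge_bubble e x * q e x))"
    unfolding strain by (subst intK_scale[symmetric]) (simp add: mult.commute)
  also have "\<dots> = (\<Sum>e\<in>edges. \<Sum>k\<in>UNIV. \<Sum>l\<in>UNIV. G k l * (?t e $ k * ?t e $ l) * intK (\<lambda>x. edge_bubble e x * q e x))"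
    by (simp add: sum_distrib_right)
  also have "\<dots> = (\<Sum>k\<in>UNIV. \<Sum>l\<in>UNIV. \<Sum>e\<in>edges. G k l * (?t e $ k * ?t e $ l) * intK (\<lambda>x. edge_bubble e x * q e x))"
    by (subst sum.swap, intro sum.cong refl, rule sum.swap)
  also have "\<dots> = (\<Sum>k\<in>UNIV. \<Sum>l\<in>UNIV. G k l * intK (\<lambda>x. \<tau> x $ k $ l))"
  proof (intro sum.cong refl)
    fix k l
    have "intK (\<lambda>x. \<tau> x $ k $ l) = intK (\<lambda>x. \<Sum>e\<in>edges. (?t e $ k * ?t e $ l) * (edge_bubble e x * q e x))"
      unfolding \<tau>q edge_field_def by (simp add: mult.commute)
    also have "\<dots> = (\<Sum>e\<in>edges. intK (\<lambda>x. (?t e $ k * ?t e $ l) * (edge_bubble e x * q e x)))"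
      by (rule intK_sum) (rule polys_continuous[OF polys_scale[OF ebq]])
    also have "\<dots> = (\<Sum>e\<in>edges. (?t e $ k * ?t e $ l) * intK (\<lambda>x. edge_bubble e x * q e x))"
      by (intro sum.cong refl intK_scale)
    finally show "(\<Sum>e\<in>edges. G k l * (?t e $ k * ?t e $ l) * intK (\<lambda>x. edge_bubble e x * q e x))
        = G k l * intK (\<lambda>x. \<tau> x $ k $ l)"
      by (simp only: sum_distrib_left mult.assoc)
  qed
  also have "\<dots> = 0" by (simp add: avg)
  finally have "intK (\<lambda>x. ?v x \<bullet> ?v x) = 0"
    using integration_by_parts[of q "CARD('n) - 1" ?v 1] q div by (simp flip: \<tau>q)
  then have "?v x = 0" if "\<forall>v\<in>C. 0 < lam v x" for x
    using intK_nonneg_eq_0[of "\<lambda>x. ?v x \<bullet> ?v x" x] that continuous_vec_polys[OF div]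
    by (simp add: continuous_on_inner)
  then show ?thesis
    using \<tau> bubbles_subset by (intro row_div_eq_0_everywhere) auto
qed

end

section \<open>Unisolvence\<close>

lemma linear_on_restrict: "subspace V \<Longrightarrow> linear_on V f \<Longrightarrow> linear_on V (restrict f V)"
  unfolding linear_on_def by (simp add: subspace_add subspace_scale)

text \<open>Since \<open>\<tau>\<close> is symmetric, \<open>\<mu>\<^sup>T \<tau> \<nu>\<close> and \<open>\<nu>\<^sup>T \<tau> \<mu>\<close> give the same functional. Only upper bounds are proved for the
  numbers of degrees of freedom; equality will follow from the comparison with the dimension.\<close>

lemma card_face_dofs_le:
  fixes K F :: "(real^'n) set"
  assumes T: "finite T" "card T = l" and N: "finite N" "card N = m" and Q: "finite Q" "card Q \<le> k"
  shows "finite (face_dofs K F T N Q)" "card (face_dofs K F T N Q) \<le> (((m + 1) choose 2) + l * m) * k"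
proof -
  obtain P where P: "P \<subseteq> N \<times> N" "card P = (m + 1) choose 2"
    "\<forall>a\<in>N. \<forall>b\<in>N. (a, b) \<in> P \<or> (b, a) \<in> P"
    using unordered_pairs_exist[OF N(1)] unfolding N(2) by (elim exE conjE)
  define \<phi> where "\<phi> = (\<lambda>((s, \<nu>), q). \<lambda>\<tau>\<in>P2star K. mean_moment F (\<lambda>x. s \<bullet> (\<tau> x *v \<nu>)) q)"
  have sym: "\<phi> ((\<mu>, \<nu>), q) = \<phi> ((\<nu>, \<mu>), q)" for \<mu> \<nu> q
    unfolding \<phi>_def prod.case
  proof (rule restrict_ext)
    fix \<tau> assume "\<tau> \<in> P2star K"
    then have "transpose (\<tau> x) = \<tau> x" for x using P2star_subset[of K] by (auto simp: sym_polys_def)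
    then have "\<mu> \<bullet> (\<tau> x *v \<nu>) = \<nu> \<bullet> (\<tau> x *v \<mu>)" for x
      by (metis dot_lmul_matrix inner_commute vector_transpose_matrix)
    then show "mean_moment F (\<lambda>x. \<mu> \<bullet> (\<tau> x *v \<nu>)) q = mean_moment F (\<lambda>x. \<nu> \<bullet> (\<tau> x *v \<mu>)) q" by simp
  qed
  have finP: "finite P" using P(1) N(1) by (simp add: finite_subset)
  have "face_dofs K F T N Q \<subseteq> \<phi> ` ((T \<times> N) \<times> Q) \<union> \<phi> ` (P \<times> Q)"
  proof
    fix f assume "f \<in> face_dofs K F T N Q"
    then consider (1) t \<nu> q where "f = \<phi> ((t, \<nu>), q)" "t \<in> T" "\<nu> \<in> N" "q \<in> Q"
      | (2) \<mu> \<nu> q where "f = \<phi> ((\<mu>, \<nu>), q)" "\<mu> \<in> N" "\<nu> \<in> N" "q \<in> Q"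
      unfolding face_dofs_def \<phi>_def by auto
    then show "f \<in> \<phi> ` ((T \<times> N) \<times> Q) \<union> \<phi> ` (P \<times> Q)"
    proof cases
      case 1
      then show ?thesis by auto
    next
      case 2
      then have "((\<mu>, \<nu>), q) \<in> P \<times> Q \<or> ((\<nu>, \<mu>), q) \<in> P \<times> Q" using P(3) by simp
      then have "f \<in> \<phi> ` (P \<times> Q)"
        unfolding 2(1) using sym[of \<mu> \<nu> q] by (metis image_eqI)
      then show ?thesis by simp
    qed
  qed
  moreover have fin: "finite (\<phi> ` ((T \<times> N) \<times> Q) \<union> \<phi> ` (P \<times> Q))"
    using T N Q finP by simp
  ultimately show "finite (face_dofs K F T N Q)" by (rule finite_subset)
  have "card (face_dofs K F T N Q) \<le> card (\<phi> ` ((T \<times> N) \<times> Q) \<union> \<phi> ` (P \<times> Q))"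
    using fin \<open>face_dofs K F T N Q \<subseteq> _\<close> by (rule card_mono)
  also have "\<dots> \<le> card (\<phi> ` ((T \<times> N) \<times> Q)) + card (\<phi> ` (P \<times> Q))"
    by (rule card_Un_le)
  also have "\<dots> \<le> card ((T \<times> N) \<times> Q) + card (P \<times> Q)"
    using T N Q finP by (intro add_mono card_image_le) auto
  also have "\<dots> = (((m + 1) choose 2) + l * m) * card Q"
    using T N P(2) by (simp add: card_cartesian_product algebra_simps)
  also have "\<dots> \<le> (((m + 1) choose 2) + l * m) * k" using Q(2) by (rule mult_le_mono2)
  finally show "card (face_dofs K F T N Q) \<le> (((m + 1) choose 2) + l * m) * k" .
qed

lemma card_average_dofs_le:
  fixes K :: "(real^'n) set"
  shows "finite (average_dofs K)" "card (average_dofs K) \<le> (CARD('n) + 1) choose 2"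
proof -
  obtain P :: "('n \<times> 'n) set" where P: "card P = (CARD('n) + 1) choose 2"
    "\<forall>a\<in>UNIV. \<forall>b\<in>UNIV. (a, b) \<in> P \<or> (b, a) \<in> P"
    using unordered_pairs_exist[OF finite[of "UNIV :: 'n set"]] by (elim exE conjE)
  define \<phi> where "\<phi> = (\<lambda>(i, j). \<lambda>\<tau>\<in>P2star K. (LINT x:K|lborel. \<tau> x $ i $ j) / measure lborel K)"
  have sym: "\<phi> (i, j) = \<phi> (j, i)" for i j
    unfolding \<phi>_def prod.case
  proof (rule restrict_ext)
    fix \<tau> assume "\<tau> \<in> P2star K"
    then have "transpose (\<tau> x) = \<tau> x" for x using P2star_subset[of K] by (auto simp: sym_polys_def)
    then have "\<tau> x $ i $ j = \<tau> x $ j $ i" for x by (auto simp: transpose_def vec_eq_iff)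
    then show "(LINT x:K|lborel. \<tau> x $ i $ j) / measure lborel K
      = (LINT x:K|lborel. \<tau> x $ j $ i) / measure lborel K" by simp
  qed
  have sub: "average_dofs K \<subseteq> \<phi> ` P"
  proof
    fix f assume "f \<in> average_dofs K"
    then obtain i j where f: "f = \<phi> (i, j)" by (auto simp: average_dofs_def \<phi>_def)
    have "(i, j) \<in> P \<or> (j, i) \<in> P" using P(2) by simp
    then show "f \<in> \<phi> ` P" unfolding f using sym[of i j] by (metis image_eqI)
  qed
  have finP: "finite P" by (rule finite_subset[OF subset_UNIV finite])
  show "finite (average_dofs K)" using sub finP by (simp add: finite_subset)
  have "card (average_dofs K) \<le> card (\<phi> ` P)" using finP sub by (intro card_mono) auto
  also have "\<dots> \<le> card P" using finP by (rule card_image_le)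
  finally show "card (average_dofs K) \<le> (CARD('n) + 1) choose 2" using P(1) by simp
qed

context simplex_coords
begin

lemma measure_hull_nonzero: "measure lborel (convex hull C) \<noteq> 0"
proof -
  obtain x where x: "\<forall>v\<in>C. 0 < lam v x"
    using interior_point_exists[OF order_refl C_nonempty] by blast
  have "emeasure lborel (ball x 1 \<inter> convex hull C) \<le> emeasure lborel (convex hull C)"
    using borel_compact[OF compact_hull_C] by (intro emeasure_mono) auto
  then have "emeasure lborel (convex hull C) \<noteq> 0"
    using emeasure_neighbourhood_hull_nonzero[OF x, of 1] by auto
  moreover have "emeasure lborel (convex hull C) < \<infinity>"
    using emeasure_bounded_finite[OF compact_imp_bounded[OF compact_hull_C]] by simp
  ultimately show ?thesis by (auto simp: measure_def enn2real_eq_0_iff)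
qed

lemma linear_on_interior_dof:
  assumes "\<theta> \<in> sym_polys D"
  shows "linear_on (P2star (convex hull C)) (\<lambda>\<tau>. LINT x:convex hull C|lborel. \<tau> x \<bullet> \<theta> x)"
proof (rule linear_onI)
  fix \<sigma> \<tau> assume "\<sigma> \<in> P2star (convex hull C)" "\<tau> \<in> P2star (convex hull C)"
  then have "\<sigma> \<in> sym_polys {..CARD('n) + 1}" "\<tau> \<in> sym_polys {..CARD('n) + 1}"
    using P2star_subset by auto
  from this[THEN continuous_sym_polys]
  have "intK (\<lambda>x. \<sigma> x \<bullet> \<theta> x + \<tau> x \<bullet> \<theta> x) = intK (\<lambda>x. \<sigma> x \<bullet> \<theta> x) + intK (\<lambda>x. \<tau> x \<bullet> \<theta> x)"
    by (intro intK_add continuous_on_inner continuous_sym_polys[OF assms])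
  then show "(LINT x:convex hull C|lborel. (\<sigma> + \<tau>) x \<bullet> \<theta> x)
      = (LINT x:convex hull C|lborel. \<sigma> x \<bullet> \<theta> x) + (LINT x:convex hull C|lborel. \<tau> x \<bullet> \<theta> x)"
    by (simp add: intK_def inner_add_left)
qed (simp add: scaleR_fun_apply)

lemma linear_on_average_dof:
  "linear_on (P2star (convex hull C))
    (\<lambda>\<tau>. (LINT x:convex hull C|lborel. \<tau> x $ i $ j) / measure lborel (convex hull C))"
proof (rule linear_onI)
  fix \<sigma> \<tau> assume "\<sigma> \<in> P2star (convex hull C)" "\<tau> \<in> P2star (convex hull C)"
  then have "(\<lambda>x. \<sigma> x $ i $ j) \<in> polys {..CARD('n) + 1}" "(\<lambda>x. \<tau> x $ i $ j) \<in> polys {..CARD('n) + 1}"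
    using P2star_subset[of "convex hull C"] by (auto simp: sym_polys_def)
  from this[THEN polys_continuous]
  have "intK (\<lambda>x. \<sigma> x $ i $ j + \<tau> x $ i $ j) = intK (\<lambda>x. \<sigma> x $ i $ j) + intK (\<lambda>x. \<tau> x $ i $ j)"
    by (rule intK_add)
  then show "(LINT x:convex hull C|lborel. (\<sigma> + \<tau>) x $ i $ j) / measure lborel (convex hull C)
      = (LINT x:convex hull C|lborel. \<sigma> x $ i $ j) / measure lborel (convex hull C)
      + (LINT x:convex hull C|lborel. \<tau> x $ i $ j) / measure lborel (convex hull C)"
    by (simp add: intK_def add_divide_distrib)
qed (simp add: scaleR_fun_apply)

lemma linear_on_mean_moment:
  assumes S: "S \<subseteq> C" "S \<noteq> {}" and q: "continuous_on (convex hull S) q"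
  shows "linear_on (P2star (convex hull C)) (\<lambda>\<tau>. mean_moment (convex hull S) (\<lambda>x. s \<bullet> (\<tau> x *v \<nu>)) q)"
proof (rule linear_onI)
  let ?F = "convex hull S"
  have int: "set_integrable (flat_measure ?F) ?F (\<lambda>x. (s \<bullet> (\<tau> x *v \<nu>)) * q x)"
    if "\<tau> \<in> P2star (convex hull C)" for \<tau>
  proof -
    have "\<tau> \<in> sym_polys {..CARD('n) + 1}" using that P2star_subset by auto
    then show ?thesis
      by (intro face_integrable[OF S] continuous_on_mult q polys_continuous[OF trace_polys])
  qed
  fix \<sigma> \<tau> assume "\<sigma> \<in> P2star (convex hull C)" "\<tau> \<in> P2star (convex hull C)"
  from set_integral_add(2)[OF this[THEN int]]
  show "mean_moment ?F (\<lambda>x. s \<bullet> ((\<sigma> + \<tau>) x *v \<nu>)) q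
      = mean_moment ?F (\<lambda>x. s \<bullet> (\<sigma> x *v \<nu>)) q + mean_moment ?F (\<lambda>x. s \<bullet> (\<tau> x *v \<nu>)) q"
    by (simp add: mean_moment_def matrix_vector_mult_add_rdistrib inner_add_right distrib_right
        add_divide_distrib)
next
  fix c and \<tau> :: "real^'n \<Rightarrow> real^'n^'n"
  show "mean_moment (convex hull S) (\<lambda>x. s \<bullet> ((c *\<^sub>R \<tau>) x *v \<nu>)) q
      = c *\<^sub>R mean_moment (convex hull S) (\<lambda>x. s \<bullet> (\<tau> x *v \<nu>)) q"
    by (simp add: mean_moment_def scaleR_fun_apply scaleR_matrix_vector_assoc[symmetric] mult.assoc)
qed

text \<open>The given degrees of freedom use a basis of test functions; by linearity they control the moments
  against all test functions.\<close>

lemma moments_vanish_on_span: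
  assumes S: "S \<subseteq> C" "S \<noteq> {}" and g: "continuous_on (convex hull S) g"
    and Q: "\<And>q. q \<in> Q \<Longrightarrow> continuous_on (convex hull S) q \<and> mean_moment (convex hull S) g q = 0"
    and q: "q \<in> span Q"
  shows "(LINT x:convex hull S|flat_measure (convex hull S). g x * q x) = 0"
proof -
  let ?F = "convex hull S"
  let ?Z = "{q. continuous_on ?F q \<and> (LINT x:?F|flat_measure ?F. g x * q x) = 0}"
  have int: "set_integrable (flat_measure ?F) ?F (\<lambda>x. g x * q x)" if "continuous_on ?F q" for q
    by (rule face_integrable[OF S continuous_on_mult[OF g that]])
  have "span Q \<subseteq> ?Z"
  proof (rule span_minimal)
    show "Q \<subseteq> ?Z" using Q face_measure(3)[OF S] by (auto simp: mean_moment_def)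
    have "p + q \<in> ?Z" if "p \<in> ?Z" "q \<in> ?Z" for p q
    proof -
      have "continuous_on ?F (p + q)"
        unfolding plus_fun_def using that by (intro continuous_on_add) auto
      then show ?thesis
        using that set_integral_add(2)[OF int int, of p q] by (simp add: distrib_left)
    qed
    moreover have "c *\<^sub>R p \<in> ?Z" if "p \<in> ?Z" for c p
    proof -
      have "continuous_on ?F (c *\<^sub>R p)"
        unfolding scaleR_fun_def using that by (intro continuous_on_scaleR continuous_on_const) auto
      then show ?thesis using that by (simp add: scaleR_fun_apply mult.left_commute)
    qed
    moreover have "0 \<in> ?Z" by (simp add: zero_fun_def)
    ultimately show "subspace ?Z" by (simp add: subspace_def)
  qed
  then show ?thesis using q by auto
qed

text \<open>A field may be tested against itself once it lies in the span of the test fields.\<close>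

lemma eq_0_if_orthogonal_to_spanning_set:
  assumes \<tau>: "\<tau> \<in> sym_polys {..m}" and \<Theta>: "\<Theta> \<subseteq> sym_polys {..k}" "\<tau> \<in> span \<Theta>"
    and orth: "\<And>\<theta>. \<theta> \<in> \<Theta> \<Longrightarrow> intK (\<lambda>x. \<tau> x \<bullet> \<theta> x) = 0"
  shows "\<tau> = 0"
proof -
  let ?Z = "{\<theta> \<in> sym_polys {..k}. intK (\<lambda>x. \<tau> x \<bullet> \<theta> x) = 0}"
  have "linear_on (sym_polys {..k}) (\<lambda>\<theta>. intK (\<lambda>x. \<tau> x \<bullet> \<theta> x))"
  proof (rule linear_onI)
    fix \<rho> \<theta> :: "real^'n \<Rightarrow> real^'n^'n"
    assume "\<rho> \<in> sym_polys {..k}" "\<theta> \<in> sym_polys {..k}"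
    from this[THEN continuous_sym_polys] continuous_sym_polys[OF \<tau>]
    show "intK (\<lambda>x. \<tau> x \<bullet> (\<rho> + \<theta>) x) = intK (\<lambda>x. \<tau> x \<bullet> \<rho> x) + intK (\<lambda>x. \<tau> x \<bullet> \<theta> x)"
      by (simp add: inner_add_right intK_add continuous_on_inner)
  qed (simp add: scaleR_fun_apply intK_scale)
  then have "subspace ?Z" by (rule subspace_kernel_on) simp
  then have "span \<Theta> \<subseteq> ?Z" using \<Theta>(1) orth by (intro span_minimal) auto
  then have int0: "intK (\<lambda>x. \<tau> x \<bullet> \<tau> x) = 0" using \<Theta>(2) by auto
  have pos: "\<tau> x = 0" if "\<forall>v\<in>C. 0 < lam v x" for x
    using intK_nonneg_eq_0[OF _ _ int0 that] continuous_sym_polys[OF \<tau>] by (simp add: continuous_on_inner)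
  have "(\<lambda>x. \<tau> x $ i $ j) \<in> polys {..m}" for i j using \<tau> by (simp add: sym_polys_def)
  then have "\<tau> x $ i $ j = 0" for x i j
    by (rule polys_eq_0_everywhere) (simp add: pos)
  then show ?thesis by (simp add: fun_eq_iff vec_eq_iff)
qed

text \<open>The face moments force \<open>\<tau>\<close> to be a bubble field, the averages then make it divergence-free, so
  it belongs to \<open>M2\<close>, where the interior moments detect it.\<close>

lemma dofs_injective:
  fixes T N :: "(real^'n) set \<Rightarrow> (real^'n) set" and Q :: "(real^'n) set \<Rightarrow> (real^'n \<Rightarrow> real) set"
  assumes tangents: "\<And>l F. l < CARD('n) \<Longrightarrow> F \<in> subsimplices l (convex hull C) \<Longrightarrow>
          T F \<subseteq> tangent_vectors F \<and> independent (T F) \<and> card (T F) = l"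
    and normals: "\<And>l F. l < CARD('n) \<Longrightarrow> F \<in> subsimplices l (convex hull C) \<Longrightarrow>
          N F \<subseteq> normal_vectors F \<and> independent (N F) \<and> card (N F) = CARD('n) - l"
    and face_tests: "\<And>l F. l < CARD('n) \<Longrightarrow> F \<in> subsimplices l (convex hull C) \<Longrightarrow>
          basis_of (Q F) (polys_on (CARD('n) - l) F)"
    and interior_tests: "basis_of \<Theta> (M2 (convex hull C))"
    and \<tau>: "\<tau> \<in> P2star (convex hull C)"
    and face0: "\<And>l F \<phi>. l < CARD('n) \<Longrightarrow> F \<in> subsimplices l (convex hull C) \<Longrightarrow>
          \<phi> \<in> face_dofs (convex hull C) F (T F) (N F) (Q F) \<Longrightarrow> \<phi> \<tau> = 0"
    and avg0: "\<And>\<phi>. \<phi> \<in> average_dofs (convex hull C) \<Longrightarrow> \<phi> \<tau> = 0"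
    and int0: "\<And>\<phi>. \<phi> \<in> interior_dofs (convex hull C) \<Theta> \<Longrightarrow> \<phi> \<tau> = 0"
  shows "\<tau> = 0"
proof -
  let ?K = "convex hull C"
  have s: "\<tau> \<in> sym_polys {..CARD('n) + 1}" using \<tau> P2star_subset by auto
  have face: "card S - 1 < CARD('n) \<and> convex hull S \<in> subsimplices (card S - 1) ?K
      \<and> CARD('n) - (card S - 1) = CARD('n) + 1 - card S"
    if "S \<subseteq> C" "S \<noteq> {}" "card S \<le> CARD('n)" for S
  proof -
    have "0 < card S" using that finite_subset_C[of S] by (simp add: card_gt_0_iff)
    then show ?thesis using that by (auto simp: subsimplices_eq)
  qed
  have traces: "\<tau> x *v \<nu> = 0"
    if "S \<subseteq> C" "S \<noteq> {}" "card S \<le> CARD('n)" "x \<in> convex hull S" "\<nu> \<in> normal_vectors (convex hull S)"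
    for S x \<nu>
  proof (rule normal_traces_vanish[OF s _ _ that,
        where T = "\<lambda>S. T (convex hull S)" and N = "\<lambda>S. N (convex hull S)"])
    fix S assume S: "S \<subseteq> C" "S \<noteq> {}" "card S \<le> CARD('n)"
    note f = face[OF S]
    note t = tangents[OF conjunct1[OF f] conjunct1[OF conjunct2[OF f]]]
    note nv = normals[OF conjunct1[OF f] conjunct1[OF conjunct2[OF f]]]
    note sp = tangent_normal_bases_span[of "T (convex hull S)" "convex hull S" "card S - 1" "N (convex hull S)"]
    show "N (convex hull S) \<subseteq> normal_vectors (convex hull S)
        \<and> normal_vectors (convex hull S) \<subseteq> span (N (convex hull S))
        \<and> (\<forall>z. (\<forall>s\<in>T (convex hull S) \<union> N (convex hull S). s \<bullet> z = 0) \<longrightarrow> z = 0)"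
      using t nv sp dim_tangent_le[OF S(1,2)] by blast
    fix s \<nu> q
    assume sT: "s \<in> T (convex hull S) \<union> N (convex hull S)" and \<nu>: "\<nu> \<in> N (convex hull S)"
      and q: "q \<in> polys_on (CARD('n) + 1 - card S) (convex hull S)"
    have sQ: "span (Q (convex hull S)) = polys_on (CARD('n) + 1 - card S) (convex hull S)"
      using face_tests[OF conjunct1[OF f] conjunct1[OF conjunct2[OF f]]] f by (simp add: basis_of_def)
    show "(LINT x:convex hull S|flat_measure (convex hull S). (s \<bullet> (\<tau> x *v \<nu>)) * q x) = 0"
    proof (rule moments_vanish_on_span[OF S(1,2) polys_continuous[OF trace_polys[OF s]]])
      show "q \<in> span (Q (convex hull S))" using q sQ by simp
      fix r assume r: "r \<in> Q (convex hull S)"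
      then have "r \<in> polys_on (CARD('n) + 1 - card S) (convex hull S)"
        using span_superset[of "Q (convex hull S)"] unfolding sQ by auto
      moreover have "(\<lambda>\<tau>\<in>P2star ?K. mean_moment (convex hull S) (\<lambda>x. s \<bullet> (\<tau> x *v \<nu>)) r)
          \<in> face_dofs ?K (convex hull S) (T (convex hull S)) (N (convex hull S)) (Q (convex hull S))"
        unfolding face_dofs_def using sT \<nu> r by blast
      from face0[OF conjunct1[OF f] conjunct1[OF conjunct2[OF f]] this]
      have "mean_moment (convex hull S) (\<lambda>x. s \<bullet> (\<tau> x *v \<nu>)) r = 0" using \<tau> by simp
      ultimately show "continuous_on (convex hull S) r \<and> mean_moment (convex hull S) (\<lambda>x. s \<bullet> (\<tau> x *v \<nu>)) r = 0"
        using continuous_polys_on by blast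
    qed
  qed
  have facet: "C - {u} \<noteq> {} \<and> card (C - {u}) \<le> CARD('n)" if "u \<in> C" for u
  proof -
    have "card (C - {u}) = CARD('n)" using that card_C by simp
    then show ?thesis using zero_less_card_finite[where 'a='n] by (metis card.empty less_irrefl order_refl)
  qed
  have \<tau>b: "\<tau> \<in> bubbles"
    unfolding bubbles_def using s
  proof (intro CollectI conjI ballI)
    fix u x assume u: "u \<in> C" and x: "x \<in> convex hull (C - {u})"
    show "\<tau> x *v grd u = 0"
      by (rule traces[OF Diff_subset _ _ x hull_facet(2)[OF u]]) (use facet[OF u] in auto)
  qed
  have "row_div \<tau> = 0"
  proof (rule bubble_with_zero_average_div_free[OF \<tau>b])
    obtain \<sigma> \<rho> where \<sigma>\<rho>: "\<tau> = \<sigma> + \<rho>" "\<sigma> \<in> sym_polys {..2}" "\<rho> \<in> Sigma_DF ?K"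
      using \<tau> by (auto simp: P2star_def)
    have n1: "1 \<le> CARD('n)" using zero_less_card_finite[where 'a='n] by linarith
    have big: "\<sigma> \<in> sym_polys {..CARD('n) + 1}" "\<rho> \<in> sym_polys {..CARD('n) + 1}"
      using \<sigma>\<rho>(2,3) n1 sym_polys_mono[of "{..2}" "{..CARD('n) + 1}"]
        sym_polys_mono[of "{3..CARD('n) + 1}" "{..CARD('n) + 1}"]
      by (auto simp: Sigma_DF_def)
    have "row_div \<rho> = 0"
      using \<sigma>\<rho>(3) by (intro row_div_eq_0_everywhere[OF big(2)]) (auto simp: Sigma_DF_def mem_hull_iff less_imp_le)
    then have "row_div \<tau> = row_div \<sigma>" unfolding \<sigma>\<rho>(1) row_div_add[OF big] by simp
    then show "row_div \<tau> \<in> vec_polys {..1}"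
      using row_div_in_vec_polys[OF \<sigma>\<rho>(2), of "{..1}"] by auto
    fix i j
    have "(\<lambda>\<tau>\<in>P2star ?K. (LINT x:?K|lborel. \<tau> x $ i $ j) / measure lborel ?K) \<in> average_dofs ?K"
      unfolding average_dofs_def by blast
    from avg0[OF this] show "intK (\<lambda>x. \<tau> x $ i $ j) = 0"
      using \<tau> measure_hull_nonzero by (simp add: intK_def)
  qed
  moreover have "\<tau> x *v \<nu> = 0" if F: "F facet_of ?K" "x \<in> F" "\<nu> \<in> normal_vectors F" for F x \<nu>
  proof -
    obtain u where u: "u \<in> C" "F = convex hull (C - {u})"
      using F(1) facet_of_convex_hull_affine_independent[OF affine_independent_C] by blast
    show ?thesis
      by (rule traces[OF Diff_subset _ _ F(2,3)[unfolded u(2)]]) (use facet[OF u(1)] in auto)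
  qed
  ultimately have "\<tau> \<in> M2 ?K" using \<tau> by (simp add: M2_def)
  then have "\<tau> \<in> span \<Theta>" using interior_tests by (simp add: basis_of_def)
  moreover have "\<Theta> \<subseteq> sym_polys {..CARD('n) + 1}"
  proof -
    have "\<Theta> \<subseteq> M2 ?K" using interior_tests span_superset by (auto simp: basis_of_def)
    then show ?thesis using P2star_subset[of ?K] by (auto simp: M2_def)
  qed
  moreover have "intK (\<lambda>x. \<tau> x \<bullet> \<theta> x) = 0" if "\<theta> \<in> \<Theta>" for \<theta>
  proof -
    have "(\<lambda>\<tau>\<in>P2star ?K. LINT x:?K|lborel. \<tau> x \<bullet> \<theta> x) \<in> interior_dofs ?K \<Theta>"
      unfolding interior_dofs_def using that by blast
    from int0[OF this] show ?thesis using \<tau> by (simp add: intK_def)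
  qed
  ultimately show "\<tau> = 0" using s by (intro eq_0_if_orthogonal_to_spanning_set)
qed

lemma card_dofs_le:
  fixes T N :: "(real^'n) set" and Q :: "(real^'n \<Rightarrow> real) set"
  assumes "S \<subseteq> C" "card S = l + 1" "l < CARD('n)"
    and T: "independent T" "card T = l" and N: "independent N" "card N = CARD('n) - l"
    and Q: "basis_of Q (polys_on (CARD('n) - l) (convex hull S))"
  shows "finite (face_dofs K F T N Q)"
    and "card (face_dofs K F T N Q)
      \<le> (((CARD('n) + 1 - l) choose 2) + l * (CARD('n) - l)) * (CARD('n) choose l)"
proof -
  have ne: "S \<noteq> {}" using assms(2) by auto
  obtain B where B: "finite B" "card B \<le> (CARD('n) - l + (card S - 1)) choose (card S - 1)"
    "polys_on (CARD('n) - l) (convex hull S) \<subseteq> span B"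
    using polys_on_face_span[OF assms(1) ne, of "CARD('n) - l"] by blast
  have "Q \<subseteq> span B" using Q B(3) span_superset[of Q] by (auto simp: basis_of_def)
  then have "finite Q \<and> card Q \<le> card B"
    using Q by (intro independent_span_bound[OF B(1)]) (simp_all add: basis_of_def)
  then have Q': "finite Q" "card Q \<le> CARD('n) choose l"
    using B(2) assms(2,3) by auto
  have eq: "CARD('n) - l + 1 = CARD('n) + 1 - l" using assms(3) by simp
  show "finite (face_dofs K F T N Q)"
    and "card (face_dofs K F T N Q)
      \<le> (((CARD('n) + 1 - l) choose 2) + l * (CARD('n) - l)) * (CARD('n) choose l)"
    using card_face_dofs_le[OF independent_imp_finite[OF T(1)] T(2)
        independent_imp_finite[OF N(1)] N(2) Q', of K F]
    unfolding eq by auto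
qed

end

lemma double_sum_bounded:
  fixes f :: "'a \<Rightarrow> nat" and A :: "nat \<Rightarrow> 'a set"
  assumes fin: "\<And>l. l < n \<Longrightarrow> finite (A l)" and card: "\<And>l. l < n \<Longrightarrow> card (A l) \<le> c l"
    and le: "\<And>l x. l < n \<Longrightarrow> x \<in> A l \<Longrightarrow> f x \<le> w l"
  shows "(\<Sum>l<n. \<Sum>x\<in>A l. f x) \<le> (\<Sum>l<n. c l * w l)"
    and "(\<Sum>l<n. \<Sum>x\<in>A l. f x) = (\<Sum>l<n. c l * w l) \<Longrightarrow> l < n \<Longrightarrow> x \<in> A l \<Longrightarrow> f x = w l"
proof -
  have 1: "(\<Sum>x\<in>A l. f x) \<le> (\<Sum>x\<in>A l. w l)" if "l < n" for l
    using le[OF that] by (rule sum_mono)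
  have 2: "(\<Sum>x\<in>A l. w l) \<le> c l * w l" if "l < n" for l
    using card[OF that] by simp
  have 3: "(\<Sum>x\<in>A l. f x) \<le> c l * w l" if "l < n" for l
    using 1[OF that] 2[OF that] by linarith
  then show "(\<Sum>l<n. \<Sum>x\<in>A l. f x) \<le> (\<Sum>l<n. c l * w l)" by (intro sum_mono) auto
  assume eq: "(\<Sum>l<n. \<Sum>x\<in>A l. f x) = (\<Sum>l<n. c l * w l)" and l: "l < n" and x: "x \<in> A l"
  have "(\<Sum>x\<in>A l. f x) = c l * w l"
    by (rule sum_mono_inv[OF eq]) (use 3 l in auto)
  then have "(\<Sum>x\<in>A l. f x) = (\<Sum>x\<in>A l. w l)" using 1[OF l] 2[OF l] by linarith
  then show "f x = w l" by (rule sum_mono_inv) (use le[OF l] x fin[OF l] in auto)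
qed

theorem theorem3p1:
  fixes K :: "(real^'n) set"
    and T N :: "(real^'n) set \<Rightarrow> (real^'n) set"
    and Q :: "(real^'n) set \<Rightarrow> (real^'n \<Rightarrow> real) set"
    and \<Theta> :: "(real^'n \<Rightarrow> real^'n^'n) set"
    and n :: nat
  assumes dimension: "n = CARD('n)"
    and simplex: "int n simplex K"
    and tangents: "\<And>l F. l < n \<Longrightarrow> F \<in> subsimplices l K \<Longrightarrow>
          T F \<subseteq> tangent_vectors F \<and> independent (T F) \<and> card (T F) = l"
    and normals: "\<And>l F. l < n \<Longrightarrow> F \<in> subsimplices l K \<Longrightarrow>
          N F \<subseteq> normal_vectors F \<and> independent (N F) \<and> card (N F) = n - l"
    and face_tests: "\<And>l F. l < n \<Longrightarrow> F \<in> subsimplices l K \<Longrightarrow>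
          basis_of (Q F) (polys_on (n - l) F)"
    and interior_tests: "basis_of \<Theta> (M2 K)"
  shows "unisolvent (P2star K)
          ((\<Union>l<n. \<Union>F\<in>subsimplices l K. face_dofs K F (T F) (N F) (Q F))
            \<union> average_dofs K \<union> interior_dofs K \<Theta>)
    \<and> (\<Sum>l<n. \<Sum>F\<in>subsimplices l K. card (face_dofs K F (T F) (N F) (Q F)))
            + card (average_dofs K) + card (interior_dofs K \<Theta>) = dim (P2star K)
    \<and> (\<forall>l<n. \<forall>F\<in>subsimplices l K.
          card (face_dofs K F (T F) (N F) (Q F))
            = (((n + 1 - l) choose 2) + l * (n - l)) * (n choose l)
          \<and> (real ((n + 1 - l) choose 2) + real (l * (n - l))) * real (n choose l)
            = real ((n - l) * (n + l + 1)) / 2 * real (n choose l))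
    \<and> real (card (average_dofs K)) = real (n * (n + 1)) / 2
    \<and> real (card (interior_dofs K \<Theta>))
            = fact (2 * n - 1) / (fact n * fact (n - 1)) * (real (n * (n + 1)) / 2)
              + real (n * (n + 1)) / 2 - real n * (fact (2 * n) / (fact n * fact n))"
proof -
  from simplex obtain C where C: "\<not> affine_dependent C" "int (card C) = int n + 1" "K = convex hull C"
    by (auto simp: simplex_def)
  then have "card C = Suc CARD('n)" using dimension by linarith
  from simplex_coords_exist[OF C(1) this] obtain lam grd where "simplex_coords C lam grd" by blast
  then interpret simplex_coords C lam grd .
  define \<Phi> where "\<Phi> = (\<Union>l<n. \<Union>F\<in>subsimplices l K. face_dofs K F (T F) (N F) (Q F))
            \<union> average_dofs K \<union> interior_dofs K \<Theta>"
  define w where "w l = (((n + 1 - l) choose 2) + l * (n - l)) * (n choose l)" for l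
  define c where "c = (n + 1) choose 2"
  define E where "E = (2 * n) choose n"
  define b where "b = (2 * n - 1) choose n"
  define X where "X = (\<Sum>l<n. \<Sum>F\<in>subsimplices l K. card (face_dofs K F (T F) (N F) (Q F)))"
  have n1: "1 \<le> n" using dimension zero_less_card_finite[where 'a='n] by linarith
  have c2: "2 * c = n * (n + 1)" unfolding c_def by (rule twice_choose_two)

  have \<Theta>: "\<Theta> \<subseteq> M2 K" "independent \<Theta>" "span \<Theta> = M2 K"
    using interior_tests span_superset by (auto simp: basis_of_def)
  have fin\<Theta>: "finite \<Theta>"
    using fin_dim_independent_finite[OF fin_dim_M2] \<Theta> C(3) by simp
  have card\<Theta>: "card \<Theta> = dim (M2 K)" using \<Theta> by (intro basis_card_eq_dim) auto
  have face: "finite (face_dofs K F (T F) (N F) (Q F)) \<and> card (face_dofs K F (T F) (N F) (Q F)) \<le> w l"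
    if l: "l < n" and F: "F \<in> subsimplices l K" for l F
  proof -
    obtain S where S: "S \<subseteq> C" "card S = l + 1" "F = convex hull S"
      using F unfolding C(3) subsimplices_eq by blast
    show ?thesis
      using card_dofs_le[OF S(1,2), of "T F" "N F" "Q F" K F] tangents[OF l F] normals[OF l F]
        face_tests[OF l F] l S(3) unfolding w_def dimension by simp
  qed
  have subs: "finite (subsimplices l K)" "card (subsimplices l K) \<le> (n + 1) choose (l + 1)" for l
    unfolding C(3) dimension by (rule finite_subsimplices, rule card_subsimplices_le)
  have interior: "finite (interior_dofs K \<Theta>)" "card (interior_dofs K \<Theta>) \<le> card \<Theta>"
  proof -
    have "interior_dofs K \<Theta> = (\<lambda>\<theta>. \<lambda>\<tau>\<in>P2star K. LINT x:K|lborel. \<tau> x \<bullet> \<theta> x) ` \<Theta>"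
      unfolding interior_dofs_def by auto
    then show "finite (interior_dofs K \<Theta>)" "card (interior_dofs K \<Theta>) \<le> card \<Theta>"
      using fin\<Theta> by (simp_all add: card_image_le)
  qed
  have average: "finite (average_dofs K)" "card (average_dofs K) \<le> c"
    using card_average_dofs_le[of K] unfolding c_def dimension by auto

  have fin\<Phi>: "finite \<Phi>"
    unfolding \<Phi>_def using face subs average interior by auto
  have inj: "\<tau> = 0" if \<tau>: "\<tau> \<in> P2star K" "\<forall>\<phi>\<in>\<Phi>. \<phi> \<tau> = 0" for \<tau>
  proof (rule dofs_injective[of T N Q \<Theta> \<tau>])
    show "\<phi> \<tau> = 0" if "l < CARD('n)" "F \<in> subsimplices l (convex hull C)"
      "\<phi> \<in> face_dofs (convex hull C) F (T F) (N F) (Q F)" for l F \<phi>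
      using \<tau>(2) that unfolding \<Phi>_def C(3) dimension by blast
    show "\<phi> \<tau> = 0" if "\<phi> \<in> average_dofs (convex hull C)" for \<phi>
      using \<tau>(2) that unfolding \<Phi>_def C(3) by blast
    show "\<phi> \<tau> = 0" if "\<phi> \<in> interior_dofs (convex hull C) \<Theta>" for \<phi>
      using \<tau>(2) that unfolding \<Phi>_def C(3) by blast
  qed (use tangents normals face_tests interior_tests \<tau>(1) in \<open>auto simp: C(3) dimension\<close>)
  have lin: "linear_on (P2star K) \<phi>" if "\<phi> \<in> \<Phi>" for \<phi>
  proof -
    consider (face) l F where "l < n" "F \<in> subsimplices l K" "\<phi> \<in> face_dofs K F (T F) (N F) (Q F)"
      | (average) "\<phi> \<in> average_dofs K" | (interior) "\<phi> \<in> interior_dofs K \<Theta>"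
      using \<open>\<phi> \<in> \<Phi>\<close> unfolding \<Phi>_def by blast
    then show ?thesis
    proof cases
      case face
      obtain S where S: "S \<subseteq> C" "card S = l + 1" "F = convex hull S"
        using face(2) unfolding C(3) subsimplices_eq by blast
      then have "S \<noteq> {}" by auto
      obtain s \<nu> q where \<phi>: "\<phi> = (\<lambda>\<tau>\<in>P2star K. mean_moment F (\<lambda>x. s \<bullet> (\<tau> x *v \<nu>)) q)" "q \<in> Q F"
        using face(3) unfolding face_dofs_def by blast
      have "Q F \<subseteq> polys_on (n - l) F"
        using face_tests[OF face(1,2)] span_superset[of "Q F"] by (simp add: basis_of_def)
      then have "continuous_on (convex hull S) q"
        using \<phi>(2) continuous_polys_on S(3) by blast
      from linear_on_mean_moment[OF S(1) \<open>S \<noteq> {}\<close> this]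
      show ?thesis unfolding \<phi>(1) S(3) C(3) by (rule linear_on_restrict[OF subspace_P2star])
    next
      case average
      then obtain i j where
        "\<phi> = (\<lambda>\<tau>\<in>P2star K. (LINT x:K|lborel. \<tau> x $ i $ j) / measure lborel K)"
        unfolding average_dofs_def by blast
      then show ?thesis
        unfolding C(3) using linear_on_restrict[OF subspace_P2star linear_on_average_dof] by simp
    next
      case interior
      then obtain \<theta> where \<theta>: "\<theta> \<in> \<Theta>" "\<phi> = (\<lambda>\<tau>\<in>P2star K. LINT x:K|lborel. \<tau> x \<bullet> \<theta> x)"
        unfolding interior_dofs_def by blast
      have "\<theta> \<in> sym_polys {..CARD('n) + 1}"
        using \<theta>(1) \<Theta>(1) P2star_subset[of K] by (auto simp: M2_def)
      from linear_on_interior_dof[OF this] show ?thesis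
        unfolding \<theta>(2) C(3) by (rule linear_on_restrict[OF subspace_P2star])
    qed
  qed
  have dim_le: "dim (P2star K) \<le> card \<Phi>"
    by (rule dim_le_card_separating_functionals[where \<phi> = "\<lambda>\<phi>. \<phi>"]) (use fin\<Phi> lin inj in auto)

  have "card \<Phi> \<le> card (\<Union>l<n. \<Union>F\<in>subsimplices l K. face_dofs K F (T F) (N F) (Q F))
      + card (average_dofs K) + card (interior_dofs K \<Theta>)"
    unfolding \<Phi>_def by (meson add_le_mono1 card_Un_le order_trans)
  moreover have "card (\<Union>l<n. \<Union>F\<in>subsimplices l K. face_dofs K F (T F) (N F) (Q F)) \<le> X"
  proof -
    have "card (\<Union>l<n. \<Union>F\<in>subsimplices l K. face_dofs K F (T F) (N F) (Q F))
        \<le> (\<Sum>l<n. card (\<Union>F\<in>subsimplices l K. face_dofs K F (T F) (N F) (Q F)))"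
      by (rule card_UN_le) simp
    also have "\<dots> \<le> X" unfolding X_def by (intro sum_mono card_UN_le subs(1))
    finally show ?thesis .
  qed
  ultimately have card_le: "card \<Phi> \<le> X + card (average_dofs K) + card (interior_dofs K \<Theta>)"
    by linarith
  let ?W = "\<Sum>l<n. ((n + 1) choose (l + 1)) * w l"
  have X_le: "X \<le> ?W"
    unfolding X_def by (rule double_sum_bounded(1)) (use subs face in auto)
  have W: "?W + c * b = c * ((2 * n + 1) choose n)"
    using sum_face_weights[OF n1] unfolding w_def c_def b_def .
  have lower: "c * ((2 * n + 1) choose n) + 2 * c \<le> dim (P2star K) + n * E"
    using dim_P2star_ge[OF dimension, of K, folded c_def E_def] unfolding c2 .
  have upper: "card \<Theta> + n * E \<le> c * b + c"
    using dim_M2_le unfolding card\<Theta> C(3)[symmetric] dimension[symmetric] c_def E_def b_def .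
  \<comment> \<open>dimension, number of functionals, sum of the cardinalities and sum of their bounds form a
    cycle of inequalities, so all of them are equalities\<close>
  have eqs: "X = ?W" "card (average_dofs K) = c" "card (interior_dofs K \<Theta>) + n * E = c * b + c"
    "card \<Phi> = dim (P2star K)"
    "X + card (average_dofs K) + card (interior_dofs K \<Theta>) = dim (P2star K)"
    using dim_le card_le X_le W lower upper average(2) interior(2) by linarith+

  have face_eq: "card (face_dofs K F (T F) (N F) (Q F)) = w l" if "l < n" "F \<in> subsimplices l K" for l F
    by (rule double_sum_bounded(2)[where A = "\<lambda>l. subsimplices l K" and c = "\<lambda>l. (n + 1) choose (l + 1)"])
      (use subs face eqs(1) that in \<open>auto simp: X_def\<close>)
  have weight: "real ((n + 1 - l) choose 2) + real (l * (n - l)) = real ((n - l) * (n + l + 1)) / 2"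
    if "l < n" for l
  proof -
    define k where "k = n - l"
    then have k: "n = l + k" using that by simp
    have "n + 1 - l = k + 1" "n - l = k" using k by auto
    moreover have "2 * real ((k + 1) choose 2) = real k * (real k + 1)"
      using arg_cong[OF twice_choose_two[of k], of real] by (simp add: distrib_left)
    ultimately show ?thesis by (simp add: k field_simps)
  qed
  have realc: "real c = real (n * (n + 1)) / 2" using arg_cong[OF c2, of real] by simp
  have realE: "real E = fact (2 * n) / (fact n * fact n)"
    unfolding E_def by (subst binomial_fact) (simp_all add: mult_2)
  have realb: "real b = fact (2 * n - 1) / (fact n * fact (n - 1))"
  proof -
    have "2 * n - 1 - n = n - 1" using n1 by simp
    then show ?thesis unfolding b_def using n1 by (subst binomial_fact) simp_all
  qed
  have "real (card (interior_dofs K \<Theta>)) + real n * real E = real c * real b + real c"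
    using arg_cong[OF eqs(3), of real] by simp
  then have int_real: "real (card (interior_dofs K \<Theta>))
      = fact (2 * n - 1) / (fact n * fact (n - 1)) * (real (n * (n + 1)) / 2)
        + real (n * (n + 1)) / 2 - real n * (fact (2 * n) / (fact n * fact n))"
    unfolding realc realE realb by (simp add: mult.commute)
  have "unisolvent (P2star K) \<Phi>"
    unfolding unisolvent_def using fin\<Phi> eqs(4) inj by blast
  moreover have "card (face_dofs K F (T F) (N F) (Q F))
            = (((n + 1 - l) choose 2) + l * (n - l)) * (n choose l)
          \<and> (real ((n + 1 - l) choose 2) + real (l * (n - l))) * real (n choose l)
            = real ((n - l) * (n + l + 1)) / 2 * real (n choose l)"
    if "l < n" "F \<in> subsimplices l K" for l F
    using face_eq[OF that] weight[OF that(1)] by (simp only: w_def)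
  ultimately show ?thesis
    using eqs(2,5) realc int_real unfolding \<Phi>_def X_def by (intro conjI allI impI ballI) simp_all
qed

end
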